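(* Let $k\in\mathbb{N}/2$, $\ell\in\mathbb{R}_+$ with $k\le\ell$, let $\varphi_{\ell,k}$ be the generalized Wu function, and let $\Phi(x)=\varphi_{\ell,k}(\|x\|_2)$ on $\mathbb{R}^{2k+1}$. Then $$\mathcal{N}_\Phi(\mathbb{R}^{2k+1})=P*L^2(\mathbb{R}^{2k+1}):=\{P*g:g\in L^2(\mathbb{R}^{2k+1})\},$$ where $P(x)=\frac{\Gamma(\ell+1)}{\Gamma(\ell-k+1)}(2/\pi)^{k/2}(1-\|x\|_2^2)_+^{\ell-k}$. Moreover, the convolution operator $C_P:L^2(\mathbb{R}^{2k+1})\to\mathcal{N}_\Phi(\mathbb{R}^{2k+1})$, $C_Pg=P*g$, is a bijective isometry.
   Context: $\mathbb{R}_+=[0,\infty)$, $\mathbb{N}/2=\{0,\tfrac12,1,\tfrac32,\dots\}$. $f_\ell(r)=(1-r^2)_+^\ell$, $f_\ell*f_\ell(r)=\int_{\mathbb{R}}f_\ell(|y|)f_\ell(|r-y|)dy$. The $f$-form is $\mathcal{F}\varphi(r)=\varphi(\sqrt{2r})$, $\mathcal{F}^{-1}\varphi(r)=\varphi(r^2/2)$. For $\nu>0$, $I_\nu\varphi(r)=\int_r^\infty\frac{(x-r)^{\nu-1}}{\Gamma(\nu)}\varphi(x)dx$; $I_0=\mathrm{id}$; $I_{-n}=(-1)^n d^n/dr^n$ ($n\in\mathbb{N}$); $I_{-\nu}=I_{n-\nu}I_{-n}$ with $n=\lceil\nu\rceil$. The generalized Wu function is $\varphi_{\ell,k}:=\mathscr{D}^k(f_\ell*f_\ell)$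 with $\mathscr{D}^k:=\mathcal{F}^{-1}I_{-k}\mathcal{F}$. The native space $\mathcal{N}_\Phi(\mathbb{R}^d)$ is the reproducing kernel Hilbert space of real functions on $\mathbb{R}^d$ with reproducing kernel $(x,y)\mapsto\Phi(x-y)$, with its Hilbert norm. *)

theory Defs
  imports "HOL-Analysis.Analysis"
begin

definition pos_pow :: "real \<Rightarrow> real \<Rightarrow> real" where
  "pos_pow t a = (if t > 0 then t powr a else 0)"

definition f_trunc :: "real \<Rightarrow> real \<Rightarrow> real" where
  "f_trunc l r = pos_pow (1 - r^2) l"

definition f_selfconv :: "real \<Rightarrow> real \<Rightarrow> real" where
  "f_selfconv l r = (\<integral>y. f_trunc l \<bar>y\<bar> * f_trunc l \<bar>r - y\<bar> \<partial>lborel)"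

definition fform :: "(real \<Rightarrow> real) \<Rightarrow> real \<Rightarrow> real" where
  "fform \<phi> r = \<phi> (sqrt (2 * r))"

definition fform_inv :: "(real \<Rightarrow> real) \<Rightarrow> real \<Rightarrow> real" where
  "fform_inv \<phi> r = \<phi> (r^2 / 2)"

definition rderiv :: "(real \<Rightarrow> real) \<Rightarrow> real \<Rightarrow> real" where
  "rderiv \<phi> x = (SOME D. (\<phi> has_real_derivative D) (at x within {0..}))"

definition neg_deriv :: "nat \<Rightarrow> (real \<Rightarrow> real) \<Rightarrow> real \<Rightarrow> real" where
  "neg_deriv n \<phi> r = (-1)^n * (rderiv ^^ n) \<phi> r"

definition frac_int :: "real \<Rightarrow> (real \<Rightarrow> real) \<Rightarrow> real \<Rightarrow> real" where
  "frac_int \<nu> \<phi> r = (if \<nu> = 0 then \<phi> r else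
     (\<integral>x. indicator {r<..} x * ((x - r) powr (\<nu> - 1) / Gamma \<nu> * \<phi> x) \<partial>lborel))"

definition Iop :: "real \<Rightarrow> (real \<Rightarrow> real) \<Rightarrow> real \<Rightarrow> real" where
  "Iop \<nu> \<phi> = (if \<nu> \<ge> 0 then frac_int \<nu> \<phi>
     else frac_int (real (nat \<lceil>-\<nu>\<rceil>) + \<nu>) (neg_deriv (nat \<lceil>-\<nu>\<rceil>) \<phi>))"

definition wu :: "real \<Rightarrow> real \<Rightarrow> real \<Rightarrow> real" where
  "wu l k = fform_inv (Iop (-k) (fform (f_selfconv l)))"

definition P_ker :: "real \<Rightarrow> real \<Rightarrow> 'a::euclidean_space \<Rightarrow> real" where
  "P_ker l k x = Gamma (l + 1) / Gamma (l - k + 1) * (2 / pi) powr (k / 2)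
                  * pos_pow (1 - (norm x)^2) (l - k)"

text \<open>Square-integrable real functions (representatives of L^2).\<close>
definition sq_integrable :: "('a::euclidean_space \<Rightarrow> real) \<Rightarrow> bool" where
  "sq_integrable g \<longleftrightarrow> g \<in> borel_measurable lborel \<and> integrable lborel (\<lambda>x. (g x)^2)"

definition conv :: "('a::euclidean_space \<Rightarrow> real) \<Rightarrow> ('a \<Rightarrow> real) \<Rightarrow> 'a \<Rightarrow> real" where
  "conv P g x = (\<integral>y. P (x - y) * g y \<partial>lborel)"

definition is_RKHS :: "('a \<Rightarrow> 'a \<Rightarrow> real) \<Rightarrow> ('a \<Rightarrow> real) set
    \<Rightarrow> (('a \<Rightarrow> real) \<Rightarrow> ('a \<Rightarrow> real) \<Rightarrow> real) \<Rightarrow> bool" where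
  "is_RKHS K H ip \<longleftrightarrow>
     (\<lambda>_. 0) \<in> H \<and>
     (\<forall>f\<in>H. \<forall>g\<in>H. (\<lambda>x. f x + g x) \<in> H) \<and>
     (\<forall>c. \<forall>f\<in>H. (\<lambda>x. c * f x) \<in> H) \<and>
     (\<forall>f\<in>H. \<forall>g\<in>H. ip f g = ip g f) \<and>
     (\<forall>f\<in>H. \<forall>g\<in>H. \<forall>h\<in>H. ip (\<lambda>x. f x + g x) h = ip f h + ip g h) \<and>
     (\<forall>c. \<forall>f\<in>H. \<forall>g\<in>H. ip (\<lambda>x. c * f x) g = c * ip f g) \<and>
     (\<forall>f\<in>H. ip f f \<ge> 0 \<and> (ip f f = 0 \<longrightarrow> f = (\<lambda>_. 0))) \<and>
     (\<forall>s::nat \<Rightarrow> 'a \<Rightarrow> real. (\<forall>n. s n \<in> H) \<and>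
        (\<forall>e>0. \<exists>N. \<forall>m\<ge>N. \<forall>n\<ge>N.
            sqrt (ip (\<lambda>x. s m x - s n x) (\<lambda>x. s m x - s n x)) < e)
        \<longrightarrow> (\<exists>f\<in>H. (\<lambda>n. sqrt (ip (\<lambda>x. s n x - f x) (\<lambda>x. s n x - f x))) \<longlonglongrightarrow> 0)) \<and>
     (\<forall>y. (\<lambda>x. K x y) \<in> H) \<and>
     (\<forall>f\<in>H. \<forall>y. ip f (\<lambda>x. K x y) = f y)"

end

theory Submission
  imports Defs "HOL-Probability.Probability" "HOL-Complex_Analysis.Complex_Analysis"
begin

text \<open>The kernel is an autoconvolution: wu l k (norm x) = (P * P)(x) on the space of dimension d = 2 k + 1.
  Integrating a radial function over a line acts on its f-form as the operator I of order 1/2 (up to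
  sqrt (2 pi)), and it commutes with convolution. Integrating P * P over d - 1 = 2 k coordinates
  therefore gives I of order k of its f-form on one side and a multiple of f_l * f_l on the other,
  because each line integral raises the exponent of (1 - r^2)_+ by 1/2. Inverting I of order k needs
  no smoothness for integer k; for half-integer k it uses that the profile of P * P has a bounded
  density, obtained by decomposing P into indicators of balls.

  Once K(x, y) is the inner product of P(x - .) and P(y - .) in L2, the space of all P * g with the norm of g
  is a reproducing kernel space for K as soon as g is determined by P * g. For the latter, truncate g to large
  balls: the convolutions tend to 0 in L2, the Fourier transform of P is nonzero almost everywhere
  (it is entire along rays), and a Gaussian-weighted Plancherel inequality shows that all Gaussian
  means of g vanish. Finally, a reproducing kernel determines its Hilbert space.\<close>

section \<open>Uniqueness of reproducing kernel spaces\<close>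

text \<open>\<open>wu\<close> is built from chosen derivatives (\<open>SOME\<close>) on [0,
  \<infinity>), so its values carry meaning only where derivatives are known to exist. Comparing 2 k
  line integrals identifies the f-form of f_l * f_l, pointwise for t \<ge> 0, with a multiple of an
  iterated antiderivative of the profile of P * P, and the derivatives are read off from that.
  Working with \<open>ennreal\<close> integrals keeps these interchanges of integrals free of
  integrability conditions.

  The obstacle is half-integer k = m + 1/2: the definition differentiates m + 1 times and only then
  integrates to order 1/2, so a half-order derivative of the profile has to exist. When l = k, P is
  a multiple of a ball indicator and the profile has a corner at the origin; the half-order
  derivative may blow up at t = 0 and is used only for t > 0.

  The factor (2 / pi)^(k/2) in P is a normalisation. 2 k line integrals are (2 pi)^k times I of
  order k, and they turn (1 - r^2)_+^(l-k) into \<kappa> (1 - r^2)_+^l; with c the leading constant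
  of P, c \<kappa> = (2 pi)^(k/2).\<close>

locale rkhs =
  fixes K :: "'a \<Rightarrow> 'a \<Rightarrow> real" and H :: "('a \<Rightarrow> real) set"
    and ip :: "('a \<Rightarrow> real) \<Rightarrow> ('a \<Rightarrow> real) \<Rightarrow> real"
  assumes rkhs: "is_RKHS K H ip"
begin

lemma zero_mem: "(\<lambda>_. 0) \<in> H"
  and add_mem: "f \<in> H \<Longrightarrow> g \<in> H \<Longrightarrow> (\<lambda>x. f x + g x) \<in> H"
  and scale_mem: "f \<in> H \<Longrightarrow> (\<lambda>x. c * f x) \<in> H"
  and ip_sym: "f \<in> H \<Longrightarrow> g \<in> H \<Longrightarrow> ip f g = ip g f"
  and ip_add: "f \<in> H \<Longrightarrow> g \<in> H \<Longrightarrow> h \<in> H \<Longrightarrow> ip (\<lambda>x. f x + g x) h = ip f h + ip g h"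
  and ip_scale: "f \<in> H \<Longrightarrow> g \<in> H \<Longrightarrow> ip (\<lambda>x. c * f x) g = c * ip f g"
  and ip_nonneg: "f \<in> H \<Longrightarrow> 0 \<le> ip f f"
  and kernel_mem: "(\<lambda>x. K x y) \<in> H"
  and reproducing: "f \<in> H \<Longrightarrow> ip f (\<lambda>x. K x y) = f y"
  using rkhs unfolding is_RKHS_def by blast+

lemma complete:
  assumes "\<And>n. s n \<in> H"
    and "\<And>e. e > 0 \<Longrightarrow> \<exists>N. \<forall>m\<ge>N. \<forall>n\<ge>N. sqrt (ip (\<lambda>x. s m x - s n x) (\<lambda>x. s m x - s n x)) < e"
  shows "\<exists>f\<in>H. (\<lambda>n. sqrt (ip (\<lambda>x. s n x - f x) (\<lambda>x. s n x - f x))) \<longlonglongrightarrow> 0"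
proof -
  have "\<forall>s::nat \<Rightarrow> 'a \<Rightarrow> real. (\<forall>n. s n \<in> H) \<and>
        (\<forall>e>0. \<exists>N. \<forall>m\<ge>N. \<forall>n\<ge>N. sqrt (ip (\<lambda>x. s m x - s n x) (\<lambda>x. s m x - s n x)) < e)
        \<longrightarrow> (\<exists>f\<in>H. (\<lambda>n. sqrt (ip (\<lambda>x. s n x - f x) (\<lambda>x. s n x - f x))) \<longlonglongrightarrow> 0)"
    using rkhs unfolding is_RKHS_def by (elim conjE)
  then show ?thesis using assms by blast
qed

lemma diff_mem: "f \<in> H \<Longrightarrow> g \<in> H \<Longrightarrow> (\<lambda>x. f x - g x) \<in> H"
  using add_mem[of f "\<lambda>x. (-1) * g x"] scale_mem[of g "-1"] by simp

lemma ip_diff: "f \<in> H \<Longrightarrow> g \<in> H \<Longrightarrow> h \<in> H \<Longrightarrow> ip (\<lambda>x. f x - g x) h = ip f h - ip g h"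
  using ip_add[of f "\<lambda>x. (-1) * g x" h] scale_mem[of g "-1"] ip_scale[of g h "-1"] by simp

lemma ip_add_self:
  assumes "f \<in> H" "g \<in> H"
  shows "ip (\<lambda>x. f x + g x) (\<lambda>x. f x + g x) = ip f f + 2 * ip f g + ip g g"
  using assms add_mem[OF assms] ip_add ip_sym[of f "\<lambda>x. f x + g x"] ip_sym[of g "\<lambda>x. f x + g x"]
    ip_sym[of f g] by simp

lemma ip_scale_self: "f \<in> H \<Longrightarrow> ip (\<lambda>x. c * f x) (\<lambda>x. c * f x) = c\<^sup>2 * ip f f"
  using ip_scale[of f "\<lambda>x. c * f x" c] ip_scale[of f f c] scale_mem[of f c]
    ip_sym[of f "\<lambda>x. c * f x"] by (simp add: power2_eq_square)

lemma ip_add_scale_self: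
  assumes "f \<in> H" "g \<in> H"
  shows "ip (\<lambda>x. f x + c * g x) (\<lambda>x. f x + c * g x) = ip f f + 2 * c * ip f g + c\<^sup>2 * ip g g"
  using ip_add_self[OF assms(1) scale_mem[OF assms(2)], of c] ip_scale_self[OF assms(2), of c]
    ip_sym[OF assms(1) scale_mem[OF assms(2)], of c] ip_scale[OF assms(2,1), of c]
    ip_sym[OF assms]
  by simp

lemma ip_diff_self:
  assumes "f \<in> H" "g \<in> H"
  shows "ip (\<lambda>x. f x - g x) (\<lambda>x. f x - g x) = ip f f - 2 * ip f g + ip g g"
  using ip_add_scale_self[OF assms, of "-1"] by simp

lemma cauchy_schwarz:
  assumes "f \<in> H" "g \<in> H"
  shows "(ip f g)\<^sup>2 \<le> ip f f * ip g g"
proof (cases "ip g g = 0")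
  case True
  \<comment> \<open>With \<open>ip g g = 0\<close> the quadratic in \<open>c\<close> degenerates to
    an affine function that is nonnegative everywhere, so its slope must vanish.\<close>
  have lin: "0 \<le> ip f f + 2 * c * ip f g" for c
    using ip_add_scale_self[OF assms, of c] ip_nonneg[OF add_mem[OF assms(1) scale_mem[OF assms(2)]], of c] True
    by simp
  have "ip f g = 0"
  proof (rule ccontr)
    assume "ip f g \<noteq> 0"
    then have "2 * (- (ip f f + 1) / (2 * ip f g)) * ip f g = - (ip f f + 1)" by simp
    then show False using lin[of "- (ip f f + 1) / (2 * ip f g)"] by linarith
  qed
  then show ?thesis using True by simp
next
  case False
  then have pos: "ip g g > 0" using ip_nonneg[OF assms(2)] by simp
  have "0 \<le> ip f f + 2 * (- ip f g / ip g g) * ip f g + (- ip f g / ip g g)\<^sup>2 * ip g g"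
    using ip_add_scale_self[OF assms, of "- ip f g / ip g g"]
      ip_nonneg[OF add_mem[OF assms(1) scale_mem[OF assms(2)]], of "- ip f g / ip g g"] by simp
  also have "\<dots> = ip f f - (ip f g)\<^sup>2 / ip g g"
    using pos by (simp add: field_simps power2_eq_square)
  finally show ?thesis using pos by (simp add: field_simps)
qed

text \<open>Point evaluation is the inner product with a kernel function, hence bounded with norm at
  most sqrt (K y y). Norm convergence thus becomes pointwise convergence, the link between two
  Hilbert spaces that share only their kernel.\<close>

lemma eval_bound: "f \<in> H \<Longrightarrow> \<bar>f y\<bar> \<le> sqrt (ip f f) * sqrt (K y y)"
  using cauchy_schwarz[OF _ kernel_mem, of f y] reproducing[of f y] reproducing[OF kernel_mem, of y y]
  by (metis real_sqrt_abs real_sqrt_le_mono real_sqrt_mult)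

lemma pointwise_limit:
  assumes "\<And>n. s n \<in> H" "f \<in> H" "(\<lambda>n. sqrt (ip (\<lambda>x. s n x - f x) (\<lambda>x. s n x - f x))) \<longlonglongrightarrow> 0"
  shows "(\<lambda>n. s n y) \<longlonglongrightarrow> f y"
proof -
  have "(\<lambda>n. s n y - f y) \<longlonglongrightarrow> 0"
  proof (rule tendsto_rabs_zero_cancel, rule tendsto_sandwich[of "\<lambda>_. 0"])
    show "eventually (\<lambda>n. \<bar>s n y - f y\<bar> \<le> sqrt (ip (\<lambda>x. s n x - f x) (\<lambda>x. s n x - f x)) * sqrt (K y y)) sequentially"
      using eval_bound[OF diff_mem[OF assms(1,2)]] by simp
    show "(\<lambda>n. sqrt (ip (\<lambda>x. s n x - f x) (\<lambda>x. s n x - f x)) * sqrt (K y y)) \<longlonglongrightarrow> 0"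
      using tendsto_mult_right[OF assms(3), of "sqrt (K y y)"] by simp
  qed auto
  then show ?thesis by (simp add: LIM_zero_iff)
qed

end

section \<open>The span of the kernel functions\<close>

inductive_set kernel_span :: "('a \<Rightarrow> 'a \<Rightarrow> real) \<Rightarrow> ('a \<Rightarrow> real) set" for K where
  zero: "(\<lambda>_. 0) \<in> kernel_span K"
| step: "s \<in> kernel_span K \<Longrightarrow> (\<lambda>x. s x + c * K x y) \<in> kernel_span K"

lemma kernel_span_scale: "s \<in> kernel_span K \<Longrightarrow> (\<lambda>x. a * s x) \<in> kernel_span K"
proof (induction rule: kernel_span.induct)
  case zero
  show ?case by (simp add: kernel_span.zero)
next
  case (step s c y)
  then show ?case using kernel_span.step[of "\<lambda>x. a * s x" K "a * c" y] by (simp add: algebra_simps)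
qed

lemma kernel_span_add: "s \<in> kernel_span K \<Longrightarrow> t \<in> kernel_span K \<Longrightarrow> (\<lambda>x. t x + s x) \<in> kernel_span K"
proof (induction rule: kernel_span.induct)
  case (step s c y)
  then show ?case using kernel_span.step[of "\<lambda>x. t x + s x" K c y] by (simp add: algebra_simps)
qed simp

context rkhs
begin

lemma kernel_span_mem: "s \<in> kernel_span K \<Longrightarrow> s \<in> H"
  by (induction rule: kernel_span.induct) (auto intro!: zero_mem add_mem scale_mem kernel_mem)

text \<open>Adding one kernel function changes the inner product by a point value. Iterated, this
  computes inner products of span elements from \<open>K\<close> alone, whatever the space.\<close>

lemma ip_kernel_span_step:
  assumes "s \<in> H" "t \<in> H"
  shows "ip s (\<lambda>x. t x + c * K x y) = ip s t + c * s y"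
  using assms ip_sym[OF assms(1) add_mem[OF assms(2) scale_mem[OF kernel_mem]], of c y]
    ip_add[OF assms(2) scale_mem[OF kernel_mem] assms(1), of c y] ip_scale[OF kernel_mem assms(1), of c y]
    reproducing[OF assms(1), of y] ip_sym[OF assms] ip_sym[OF assms(1) kernel_mem, of y]
  by simp

lemma ip_zero: "f \<in> H \<Longrightarrow> ip f (\<lambda>_. 0) = 0"
  using ip_scale[OF zero_mem, of f 0] ip_sym[OF zero_mem, of f] by simp

text \<open>A minimising sequence for the distance from f to the span of the kernel functions
  converges to some p in H, and f - p vanishes at every point by the first variation.\<close>

lemma kernel_span_dense:
  assumes f: "f \<in> H"
  obtains s where "\<And>n. s n \<in> kernel_span K"
    "(\<lambda>n. sqrt (ip (\<lambda>x. s n x - f x) (\<lambda>x. s n x - f x))) \<longlonglongrightarrow> 0"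
proof -
  define q where "q s = ip (\<lambda>x. s x - f x) (\<lambda>x. s x - f x)" for s
  define D where "D = Inf (q ` kernel_span K)"
  have q0: "0 \<le> q s" if "s \<in> kernel_span K" for s
    unfolding q_def using ip_nonneg[OF diff_mem[OF kernel_span_mem[OF that] f]] .
  have bdd: "bdd_below (q ` kernel_span K)" using q0 by (auto intro!: bdd_belowI[of _ 0])
  have ne: "q ` kernel_span K \<noteq> {}" using kernel_span.zero by auto
  have qD: "D \<le> q s" if "s \<in> kernel_span K" for s
    unfolding D_def using bdd that by (auto intro!: cInf_lower)
  have "\<exists>s\<in>kernel_span K. q s < D + 1 / real (Suc n)" for n
    using cInf_lessD[OF ne, of "D + 1 / real (Suc n)"] unfolding D_def by auto
  then obtain s where s: "\<And>n. s n \<in> kernel_span K" "\<And>n. q (s n) < D + 1 / real (Suc n)"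
    by metis
  have sH: "s n \<in> H" for n using kernel_span_mem[OF s(1)] .
  \<comment> \<open>Parallelogram law: the midpoint of \<open>s m\<close> and \<open>s n\<close>
    lies in the span, hence at squared distance at least \<open>D\<close> from \<open>f\<close>,
    which forces two near-minimisers to be close.\<close>
  have gap: "ip (\<lambda>x. s m x - s n x) (\<lambda>x. s m x - s n x) \<le> 2 / real (Suc m) + 2 / real (Suc n)" for m n
  proof -
    let ?a = "\<lambda>x. s m x - f x" and ?b = "\<lambda>x. s n x - f x"
    let ?mid = "\<lambda>x. (1/2) * (s m x + s n x)"
    have aH: "?a \<in> H" and bH: "?b \<in> H" using diff_mem sH f by auto
    have mid: "?mid \<in> kernel_span K"
      using kernel_span_scale[OF kernel_span_add[OF s(1) s(1)], where a="1/2"] by simp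
    have "q ?mid = ip (\<lambda>x. (1/2) * (?a x + ?b x)) (\<lambda>x. (1/2) * (?a x + ?b x))"
      unfolding q_def by (rule arg_cong2[of _ _ _ _ ip]) (auto simp: field_simps)
    also have "\<dots> = (ip ?a ?a + 2 * ip ?a ?b + ip ?b ?b) / 4"
      using ip_scale_self[OF add_mem[OF aH bH], of "1/2"] ip_add_self[OF aH bH]
      by (simp add: power2_eq_square)
    finally have 1: "4 * D \<le> ip ?a ?a + 2 * ip ?a ?b + ip ?b ?b" using qD[OF mid] by simp
    have "ip (\<lambda>x. s m x - s n x) (\<lambda>x. s m x - s n x) = ip (\<lambda>x. ?a x - ?b x) (\<lambda>x. ?a x - ?b x)"
      by simp
    also have "\<dots> = ip ?a ?a - 2 * ip ?a ?b + ip ?b ?b" by (rule ip_diff_self[OF aH bH])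
    also have "\<dots> \<le> 2 * (q (s m) - D) + 2 * (q (s n) - D)" using 1 unfolding q_def by simp
    also have "\<dots> \<le> 2 / real (Suc m) + 2 / real (Suc n)"
      using s(2)[of m] s(2)[of n] by simp
    finally show ?thesis .
  qed
  have "\<exists>p\<in>H. (\<lambda>n. sqrt (ip (\<lambda>x. s n x - p x) (\<lambda>x. s n x - p x))) \<longlonglongrightarrow> 0"
  proof (rule complete[OF sH])
    fix e :: real assume e: "e > 0"
    obtain N where N: "4 / e\<^sup>2 < real N" using reals_Archimedean2 by blast
    have bnd: "2 / real (Suc m) < e\<^sup>2 / 2" if "m \<ge> N" for m
    proof -
      have "4 / e\<^sup>2 < real (Suc m)" using N that by linarith
      then show ?thesis using e by (simp add: field_simps)
    qed
    have "sqrt (ip (\<lambda>x. s m x - s n x) (\<lambda>x. s m x - s n x)) < e" if "m \<ge> N" "n \<ge> N" for m n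
    proof -
      have "ip (\<lambda>x. s m x - s n x) (\<lambda>x. s m x - s n x) < e\<^sup>2"
        using gap[of m n] bnd[OF that(1)] bnd[OF that(2)] by linarith
      then show ?thesis using e by (simp add: real_less_lsqrt ip_nonneg diff_mem sH)
    qed
    then show "\<exists>N. \<forall>m\<ge>N. \<forall>n\<ge>N. sqrt (ip (\<lambda>x. s m x - s n x) (\<lambda>x. s m x - s n x)) < e" by blast
  qed
  then obtain p where p: "p \<in> H" "(\<lambda>n. sqrt (ip (\<lambda>x. s n x - p x) (\<lambda>x. s n x - p x))) \<longlonglongrightarrow> 0" by blast
  \<comment> \<open>The first variation for the step c used below, with b = K y y and e = p y - f y.
    Dividing by b + 1 instead of b keeps the step defined when K y y = 0.\<close>
  have var_id: "2 * c * e + c\<^sup>2 * b = - e\<^sup>2 * (b + 2) / (b + 1)\<^sup>2"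
    if "c = - e / (b + 1)" "b + 1 \<noteq> 0" for b c e :: real
  proof -
    have e: "e = - (c * (b + 1))" using that by simp
    have "- e\<^sup>2 * (b + 2) / (b + 1)\<^sup>2 = - c\<^sup>2 * (b + 2)"
      unfolding e using that(2) by (simp add: power_mult_distrib)
    moreover have "2 * c * e + c\<^sup>2 * b = - c\<^sup>2 * (b + 2)"
      unfolding e by (simp add: algebra_simps power2_eq_square)
    ultimately show ?thesis by simp
  qed
  have "p y = f y" for y
  proof -
    \<comment> \<open>Moving \<open>s n\<close> along the kernel function at \<open>y\<close> stays
      in the span, so it cannot undercut \<open>D\<close>; the slack 1 / (n + 1) disappears in the
      limit, where only point values of \<open>s n\<close> occur.\<close>
    have var: "0 \<le> 2 * c * (p y - f y) + c\<^sup>2 * K y y" for c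
    proof (rule LIMSEQ_le)
      show "(\<lambda>n. 2 * c * (s n y - f y) + c\<^sup>2 * K y y) \<longlonglongrightarrow> 2 * c * (p y - f y) + c\<^sup>2 * K y y"
        by (intro tendsto_intros pointwise_limit[OF sH p])
      show "(\<lambda>n. - (1 / real (Suc n))) \<longlonglongrightarrow> 0"
        using tendsto_minus[OF LIMSEQ_inverse_real_of_nat] by (simp add: inverse_eq_divide)
      have "- (1 / real (Suc n)) \<le> 2 * c * (s n y - f y) + c\<^sup>2 * K y y" for n
      proof -
        let ?a = "\<lambda>x. s n x - f x"
        have aH: "?a \<in> H" using diff_mem sH f by auto
        have "D \<le> q (\<lambda>x. s n x + c * K x y)" by (rule qD[OF kernel_span.step[OF s(1)]])
        also have "\<dots> = ip (\<lambda>x. ?a x + c * K x y) (\<lambda>x. ?a x + c * K x y)"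
          unfolding q_def by (rule arg_cong2[of _ _ _ _ ip]) auto
        also have "\<dots> = q (s n) + 2 * c * (s n y - f y) + c\<^sup>2 * K y y"
          unfolding ip_add_scale_self[OF aH kernel_mem] reproducing[OF aH] reproducing[OF kernel_mem]
          by (simp add: q_def)
        finally show ?thesis using s(2)[of n] by simp
      qed
      then show "\<exists>N. \<forall>n\<ge>N. - (1 / real (Suc n)) \<le> 2 * c * (s n y - f y) + c\<^sup>2 * K y y" by blast
    qed
    show "p y = f y"
    proof (rule ccontr)
      assume "p y \<noteq> f y"
      have K0: "0 \<le> K y y" using ip_nonneg[OF kernel_mem, of y] reproducing[OF kernel_mem, of y y] by simp
      define c where "c = - (p y - f y) / (K y y + 1)"
      have "2 * c * (p y - f y) + c\<^sup>2 * K y y = - (p y - f y)\<^sup>2 * (K y y + 2) / (K y y + 1)\<^sup>2"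
        by (rule var_id) (use K0 in \<open>auto simp: c_def\<close>)
      also have "\<dots> < 0" using \<open>p y \<noteq> f y\<close> K0 by (simp add: divide_neg_pos mult_neg_pos)
      finally show False using var[of c] by simp
    qed
  qed
  then have "p = f" by auto
  then show ?thesis using that s(1) p(2) by blast
qed

end

text \<open>Both inner products obey the recursion \<open>ip_kernel_span_step\<close>, which
  involves only point values of \<open>s\<close>; so induction on \<open>t\<close> with
  \<open>s\<close> fixed suffices.\<close>

lemma kernel_span_ip_eq:
  assumes "is_RKHS K H ip" "is_RKHS K H' ip'" "s \<in> kernel_span K" "t \<in> kernel_span K"
  shows "ip s t = ip' s t"
  using assms(4)
proof (induction rule: kernel_span.induct)
  interpret A: rkhs K H ip by unfold_locales fact
  interpret B: rkhs K H' ip' by unfold_locales fact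
  case zero
  show ?case using A.ip_zero B.ip_zero A.kernel_span_mem B.kernel_span_mem assms(3) by simp
next
  interpret A: rkhs K H ip by unfold_locales fact
  interpret B: rkhs K H' ip' by unfold_locales fact
  case (step t c y)
  then show ?case using A.ip_kernel_span_step B.ip_kernel_span_step A.kernel_span_mem B.kernel_span_mem assms(3)
    by simp
qed

text \<open>An approximating sequence from the span is Cauchy in both norms, which agree on the
  span. Its limit in \<open>H'\<close> has the point values of \<open>f\<close>, so it is
  \<open>f\<close>, and squared norms pass to the limit in each space.\<close>

lemma rkhs_unique_aux:
  assumes A: "is_RKHS K H ip" and B: "is_RKHS K H' ip'" and f: "f \<in> H"
  shows "f \<in> H' \<and> ip' f f = ip f f"
proof -
  interpret A: rkhs K H ip by unfold_locales fact
  interpret B: rkhs K H' ip' by unfold_locales fact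
  obtain s where s: "\<And>n. s n \<in> kernel_span K"
    "(\<lambda>n. sqrt (ip (\<lambda>x. s n x - f x) (\<lambda>x. s n x - f x))) \<longlonglongrightarrow> 0"
    using A.kernel_span_dense[OF f] by blast
  have sH: "s n \<in> H" and sH': "s n \<in> H'" for n
    using A.kernel_span_mem B.kernel_span_mem s(1) by auto
  have sdiff: "(\<lambda>x. s m x - s n x) \<in> kernel_span K" for m n
    using kernel_span_add[OF kernel_span_scale[where a = "-1", OF s(1)] s(1)] by simp
  have eq: "ip' (\<lambda>x. s m x - s n x) (\<lambda>x. s m x - s n x) = ip (\<lambda>x. s m x - s n x) (\<lambda>x. s m x - s n x)" for m n
    using kernel_span_ip_eq[OF B A sdiff sdiff] .
  have tri: "sqrt (ip (\<lambda>x. u x + v x) (\<lambda>x. u x + v x)) \<le> sqrt (ip u u) + sqrt (ip v v)"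
    if u: "u \<in> H" and v: "v \<in> H" for u v
  proof -
    have "ip u v \<le> sqrt (ip u u) * sqrt (ip v v)"
      using A.cauchy_schwarz[OF u v] by (metis abs_le_D1 real_sqrt_abs real_sqrt_le_mono real_sqrt_mult)
    then have "ip (\<lambda>x. u x + v x) (\<lambda>x. u x + v x) \<le> (sqrt (ip u u) + sqrt (ip v v))\<^sup>2"
      using A.ip_add_self[OF u v] A.ip_nonneg[OF u] A.ip_nonneg[OF v] by (simp add: power2_sum)
    then show ?thesis
      using A.ip_nonneg[OF u] A.ip_nonneg[OF v] by (simp add: real_le_lsqrt)
  qed
  have "\<exists>g\<in>H'. (\<lambda>n. sqrt (ip' (\<lambda>x. s n x - g x) (\<lambda>x. s n x - g x))) \<longlonglongrightarrow> 0"
  proof (rule B.complete[OF sH'])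
    fix e :: real assume "e > 0"
    then have "eventually (\<lambda>n. sqrt (ip (\<lambda>x. s n x - f x) (\<lambda>x. s n x - f x)) < e / 2) sequentially"
      using order_tendstoD(2)[OF s(2), of "e/2"] by simp
    then obtain N where N: "\<And>n. n \<ge> N \<Longrightarrow> sqrt (ip (\<lambda>x. s n x - f x) (\<lambda>x. s n x - f x)) < e / 2"
      unfolding eventually_sequentially by blast
    have "sqrt (ip' (\<lambda>x. s m x - s n x) (\<lambda>x. s m x - s n x)) < e" if "m \<ge> N" "n \<ge> N" for m n
    proof -
      let ?u = "\<lambda>x. s m x - f x" and ?v = "\<lambda>x. (-1) * (s n x - f x)"
      have u: "?u \<in> H" and v: "?v \<in> H" and v': "(\<lambda>x. s n x - f x) \<in> H"
        using A.diff_mem[OF sH f] A.scale_mem by blast+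
      have "sqrt (ip (\<lambda>x. s m x - s n x) (\<lambda>x. s m x - s n x)) = sqrt (ip (\<lambda>x. ?u x + ?v x) (\<lambda>x. ?u x + ?v x))"
        by simp
      also have "\<dots> \<le> sqrt (ip ?u ?u) + sqrt (ip ?v ?v)" by (rule tri[OF u v])
      also have "ip ?v ?v = ip (\<lambda>x. s n x - f x) (\<lambda>x. s n x - f x)"
        using A.ip_scale_self[OF v', of "-1"] by simp
      finally show ?thesis using N[OF that(1)] N[OF that(2)] eq by simp
    qed
    then show "\<exists>N. \<forall>m\<ge>N. \<forall>n\<ge>N. sqrt (ip' (\<lambda>x. s m x - s n x) (\<lambda>x. s m x - s n x)) < e" by blast
  qed
  then obtain g where g: "g \<in> H'" "(\<lambda>n. sqrt (ip' (\<lambda>x. s n x - g x) (\<lambda>x. s n x - g x))) \<longlonglongrightarrow> 0" by blast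
  have "g y = f y" for y
    using LIMSEQ_unique[OF B.pointwise_limit[OF sH' g] A.pointwise_limit[OF sH f s(2)]] .
  then have gf: "g = f" by auto
  have lim: "(\<lambda>n. i (s n) (s n)) \<longlonglongrightarrow> i f f" if R: "is_RKHS K L i" and fL: "f \<in> L" 
    and conv: "(\<lambda>n. sqrt (i (\<lambda>x. s n x - f x) (\<lambda>x. s n x - f x))) \<longlonglongrightarrow> 0" for L i
  proof -
    interpret R: rkhs K L i by unfold_locales fact
    have sL: "s n \<in> L" for n using R.kernel_span_mem s(1) by auto
    let ?d = "\<lambda>n x. s n x - f x"
    have dL: "?d n \<in> L" for n using R.diff_mem sL fL by auto
    have dd: "(\<lambda>n. i (?d n) (?d n)) \<longlonglongrightarrow> 0"
      using tendsto_mult[OF conv conv] R.ip_nonneg[OF dL] by simp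
    have "(\<lambda>n. i (?d n) f) \<longlonglongrightarrow> 0"
    proof (rule tendsto_rabs_zero_cancel, rule tendsto_sandwich[of "\<lambda>_. 0"])
      show "eventually (\<lambda>n. \<bar>i (?d n) f\<bar> \<le> sqrt (i (?d n) (?d n)) * sqrt (i f f)) sequentially"
        using R.cauchy_schwarz[OF dL fL]
        by (intro always_eventually allI) (metis real_sqrt_abs real_sqrt_le_mono real_sqrt_mult)
      show "(\<lambda>n. sqrt (i (?d n) (?d n)) * sqrt (i f f)) \<longlonglongrightarrow> 0"
        using tendsto_mult_right[OF conv, of "sqrt (i f f)"] by simp
    qed auto
    then have "(\<lambda>n. i (?d n) (?d n) + 2 * i (?d n) f + i f f) \<longlonglongrightarrow> 0 + 2 * 0 + i f f"
      using dd by (intro tendsto_intros) auto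
    moreover have "i (?d n) (?d n) + 2 * i (?d n) f + i f f = i (s n) (s n)" for n
      using R.ip_add_self[OF dL fL, of n] by simp
    ultimately show ?thesis by simp
  qed
  have "ip' f f = ip f f"
    using LIMSEQ_unique[OF lim[OF B g(1)[unfolded gf] g(2)[unfolded gf]]] lim[OF A f s(2)]
      kernel_span_ip_eq[OF A B s(1) s(1)] by simp
  then show ?thesis using g(1) gf by simp
qed

lemma rkhs_unique:
  assumes "is_RKHS K H ip" "is_RKHS K H' ip'"
  shows "H' = H" and "f \<in> H \<Longrightarrow> ip' f f = ip f f"
  using rkhs_unique_aux[OF assms] rkhs_unique_aux[OF assms(2,1)] by blast+

section \<open>Square-integrable functions\<close>

lemma sq_integrableD:
  "sq_integrable g \<Longrightarrow> g \<in> borel_measurable borel"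
  "sq_integrable g \<Longrightarrow> integrable lborel (\<lambda>x. (g x)\<^sup>2)"
  unfolding sq_integrable_def by auto

lemma integrable_mult_sq:
  fixes g h :: "'a::euclidean_space \<Rightarrow> real"
  assumes "sq_integrable g" "sq_integrable h"
  shows "integrable lborel (\<lambda>x. g x * h x)"
proof (rule Bochner_Integration.integrable_bound)
  show "integrable lborel (\<lambda>x. (g x)\<^sup>2 + (h x)\<^sup>2)"
    using sq_integrableD[OF assms(1)] sq_integrableD[OF assms(2)] by simp
  show "(\<lambda>x. g x * h x) \<in> borel_measurable lborel"
    using sq_integrableD(1)[OF assms(1)] sq_integrableD(1)[OF assms(2)] by simp
  have "\<bar>a * b\<bar> \<le> a\<^sup>2 + b\<^sup>2" for a b :: real
    using sum_squares_bound[of "\<bar>a\<bar>" "\<bar>b\<bar>"] mult_nonneg_nonneg[of "\<bar>a\<bar>" "\<bar>b\<bar>"]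
    unfolding abs_mult power2_abs by linarith
  then show "AE x in lborel. norm (g x * h x) \<le> norm ((g x)\<^sup>2 + (h x)\<^sup>2)" by simp
qed

lemma sq_integrable_add:
  assumes "sq_integrable g" "sq_integrable h"
  shows "sq_integrable (\<lambda>x. g x + h x)"
  using assms integrable_mult_sq[OF assms] unfolding sq_integrable_def by (auto simp: power2_sum mult.assoc)

lemma sq_integrable_scale: "sq_integrable g \<Longrightarrow> sq_integrable (\<lambda>x. c * g x)"
  unfolding sq_integrable_def by (auto simp: power_mult_distrib)

lemma sq_integrable_diff:
  assumes "sq_integrable g" "sq_integrable h"
  shows "sq_integrable (\<lambda>x. g x - h x)"
  using sq_integrable_add[OF assms(1) sq_integrable_scale[OF assms(2), of "-1"]] by simp

lemma sq_integrable_zero: "sq_integrable (\<lambda>_. 0)"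
  unfolding sq_integrable_def by simp

lemma sq_nn_integral:
  assumes "sq_integrable g"
  shows "(\<integral>\<^sup>+x. ennreal ((g x)\<^sup>2) \<partial>lborel) = ennreal (\<integral>x. (g x)\<^sup>2 \<partial>lborel)"
  using sq_integrableD(2)[OF assms] by (intro nn_integral_eq_integral) auto

lemma sq_integrable_cauchy_schwarz:
  fixes g h :: "'a::euclidean_space \<Rightarrow> real"
  assumes g: "sq_integrable g" and h: "sq_integrable h"
  shows "(\<integral>x. g x * h x \<partial>lborel)\<^sup>2 \<le> (\<integral>x. (g x)\<^sup>2 \<partial>lborel) * (\<integral>x. (h x)\<^sup>2 \<partial>lborel)"
proof -
  define A B C where "A = (\<integral>x. (g x)\<^sup>2 \<partial>lborel)" "B = (\<integral>x. g x * h x \<partial>lborel)" "C = (\<integral>x. (h x)\<^sup>2 \<partial>lborel)"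
  note ABC = A_B_C_def
  have quad: "0 \<le> A + 2 * c * B + c\<^sup>2 * C" for c
  proof -
    have "0 \<le> (\<integral>x. (g x + c * h x)\<^sup>2 \<partial>lborel)" by simp
    also have "(\<lambda>x. (g x + c * h x)\<^sup>2) = (\<lambda>x. (g x)\<^sup>2 + 2 * c * (g x * h x) + c\<^sup>2 * (h x)\<^sup>2)"
      by (auto simp: power2_eq_square algebra_simps)
    also have "(\<integral>x. (g x)\<^sup>2 + 2 * c * (g x * h x) + c\<^sup>2 * (h x)\<^sup>2 \<partial>lborel) = A + 2 * c * B + c\<^sup>2 * C"
      using sq_integrableD(2)[OF g] sq_integrableD(2)[OF h] integrable_mult_sq[OF g h]
      by (simp add: ABC)
    finally show ?thesis .
  qed
  have "B\<^sup>2 \<le> A * C"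
  proof (cases "C = 0")
    case True
    have "B = 0"
    proof (rule ccontr)
      assume "B \<noteq> 0"
      then have "2 * (- (A + 1) / (2 * B)) * B = - (A + 1)" by simp
      then show False using quad[of "- (A + 1) / (2 * B)"] True by simp
    qed
    then show ?thesis using True by simp
  next
    case False
    have "0 \<le> C" unfolding ABC by simp
    then have C: "C > 0" using False by simp
    have "0 \<le> A + 2 * (- B / C) * B + (- B / C)\<^sup>2 * C" by (rule quad)
    also have "\<dots> = A - B\<^sup>2 / C" using C by (simp add: field_simps power2_eq_square)
    finally show ?thesis using C by (simp add: field_simps)
  qed
  then show ?thesis by (simp add: ABC)
qed

text \<open>Along a subsequence with squared increments below 4^-n, the bound
  2|d| <= 2^-n + 2^n d^2 makes the increments absolutely summable almost everywhere.\<close>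

lemma sq_integrable_complete:
  fixes g :: "nat \<Rightarrow> 'a::euclidean_space \<Rightarrow> real"
  assumes sq: "\<And>n. sq_integrable (g n)"
    and cauchy: "\<And>e. e > 0 \<Longrightarrow> \<exists>N. \<forall>m\<ge>N. \<forall>n\<ge>N. (\<integral>x. (g m x - g n x)\<^sup>2 \<partial>lborel) < e"
  obtains h where "sq_integrable h" "(\<lambda>n. \<integral>x. (g n x - h x)\<^sup>2 \<partial>lborel) \<longlonglongrightarrow> 0"
proof -
  have [measurable]: "g n \<in> borel_measurable borel" for n using sq_integrableD(1)[OF sq] .
  have sqd: "sq_integrable (\<lambda>x. g m x - g n x)" for m n by (rule sq_integrable_diff[OF sq sq])
  have "\<exists>N. \<forall>k. (\<forall>m\<ge>N k. \<forall>n\<ge>N k. (\<integral>x. (g m x - g n x)\<^sup>2 \<partial>lborel) < 1 / 4 ^ k)"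
    using cauchy[of "1 / 4 ^ _"] by (intro choice) auto
  then obtain N where N: "\<And>k m n. m \<ge> N k \<Longrightarrow> n \<ge> N k \<Longrightarrow> (\<integral>x. (g m x - g n x)\<^sup>2 \<partial>lborel) < 1 / 4 ^ k"
    by blast
  \<comment> \<open>The partial sums are nondecreasing and dominate every \<open>N k\<close>, so
    \<open>r k\<close> and \<open>r (Suc k)\<close> both lie beyond \<open>N k\<close>.\<close>
  define r where "r k = (\<Sum>i\<le>k. N i) + k" for k
  have rN: "r k \<ge> N k" for k unfolding r_def by (simp add: trans_le_add1 member_le_sum)
  have rS: "r (Suc k) \<ge> r k" for k unfolding r_def by simp
  define d where "d k x = g (r (Suc k)) x - g (r k) x" for k x
  have dint: "(\<integral>\<^sup>+x. ennreal ((d k x)\<^sup>2) \<partial>lborel) \<le> ennreal (1 / 4 ^ k)" for k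
  proof -
    have "(\<integral>x. (d k x)\<^sup>2 \<partial>lborel) < 1 / 4 ^ k"
      unfolding d_def using rN[of k] rS[of k] by (intro N) auto
    then show ?thesis using sq_nn_integral[OF sqd, of "r (Suc k)" "r k"]
      unfolding d_def by (simp add: ennreal_leI)
  qed
  have [measurable]: "d k \<in> borel_measurable borel" for k unfolding d_def by measurable
  have "(\<integral>\<^sup>+x. (\<Sum>k. ennreal (2 ^ k * (d k x)\<^sup>2)) \<partial>lborel) = (\<Sum>k. \<integral>\<^sup>+x. ennreal (2 ^ k * (d k x)\<^sup>2) \<partial>lborel)"
    by (rule nn_integral_suminf) measurable
  also have "\<dots> \<le> (\<Sum>k. ennreal ((1/2) ^ k))"
  proof (intro suminf_le)
    fix k
    have "(\<integral>\<^sup>+x. ennreal (2 ^ k * (d k x)\<^sup>2) \<partial>lborel) = ennreal (2 ^ k) * (\<integral>\<^sup>+x. ennreal ((d k x)\<^sup>2) \<partial>lborel)"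
      by (subst nn_integral_cmult[symmetric]) (auto simp: ennreal_mult')
    also have "\<dots> \<le> ennreal (2 ^ k) * ennreal (1 / 4 ^ k)" by (intro mult_left_mono dint) auto
    also have "\<dots> = ennreal ((1/2) ^ k)"
    proof -
      have "(4::real) ^ k = 2 ^ k * 2 ^ k" by (simp flip: power_mult_distrib)
      then have "(2::real) ^ k * (1 / 4 ^ k) = (1/2) ^ k"
        by (simp add: field_simps)
      then show ?thesis by (metis ennreal_mult' zero_le_numeral zero_le_power)
    qed
    finally show "(\<integral>\<^sup>+x. ennreal (2 ^ k * (d k x)\<^sup>2) \<partial>lborel) \<le> ennreal ((1/2) ^ k)" .
  qed auto
  also have "\<dots> = ennreal (\<Sum>k. (1/2) ^ k)" by (intro suminf_ennreal2 summable_geometric) auto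
  also have "\<dots> < \<infinity>" by simp
  finally have "AE x in lborel. (\<Sum>k. ennreal (2 ^ k * (d k x)\<^sup>2)) \<noteq> \<infinity>"
    by (intro nn_integral_PInf_AE) auto
  moreover have lim: "convergent (\<lambda>n. g (r n) x)" if "(\<Sum>k. ennreal (2 ^ k * (d k x)\<^sup>2)) \<noteq> \<infinity>" for x
  proof -
    have "summable (\<lambda>k. 2 ^ k * (d k x)\<^sup>2)"
      using that summable_iff_suminf_neq_top[of "\<lambda>k. 2 ^ k * (d k x)\<^sup>2"] by fastforce
    then have "summable (\<lambda>k. (1/2) ^ k + 2 ^ k * (d k x)\<^sup>2)"
      by (intro summable_add summable_geometric) auto
    then have "summable (\<lambda>k. d k x)"
    proof (rule summable_comparison_test')
      fix k :: nat
      have "0 \<le> (2 ^ k * \<bar>d k x\<bar> - 1)\<^sup>2" by simp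
      then have "2 * (2 ^ k * \<bar>d k x\<bar>) \<le> 1 + (2 ^ k)\<^sup>2 * (d k x)\<^sup>2"
        by (simp add: power2_eq_square algebra_simps)
      then have "2 * \<bar>d k x\<bar> \<le> (1/2) ^ k + 2 ^ k * (d k x)\<^sup>2"
        by (simp add: field_simps power2_eq_square)
      moreover have "0 \<le> \<bar>d k x\<bar>" by simp
      ultimately show "norm (d k x) \<le> (1/2) ^ k + 2 ^ k * (d k x)\<^sup>2" unfolding real_norm_def by linarith
    qed
    then have "(\<lambda>n. \<Sum>k<n. d k x) \<longlonglongrightarrow> (\<Sum>k. d k x)" by (rule summable_LIMSEQ)
    moreover have "(\<Sum>k<n. d k x) = g (r n) x - g (r 0) x" for n
      unfolding d_def by (rule sum_lessThan_telescope)
    ultimately have "(\<lambda>n. g (r n) x - g (r 0) x + g (r 0) x) \<longlonglongrightarrow> (\<Sum>k. d k x) + g (r 0) x"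
      by (intro tendsto_add) auto
    then show ?thesis unfolding convergent_def by auto
  qed
  ultimately have AElim: "AE x in lborel. (\<lambda>n. g (r n) x) \<longlonglongrightarrow> lim (\<lambda>n. g (r n) x)"
    by (auto simp: convergent_LIMSEQ_iff elim!: eventually_mono)
  \<comment> \<open>On the null set without convergence \<open>lim\<close> has an unspecified value;
    \<open>h\<close> is still measurable and the integrals do not see it.\<close>
  define h where "h x = lim (\<lambda>n. g (r n) x)" for x
  have [measurable]: "h \<in> borel_measurable borel" unfolding h_def by measurable
  \<comment> \<open>Fatou along the subsequence with \<open>n\<close> fixed, which yields L2
    convergence of the full sequence and not just of the subsequence.\<close>
  have fatou: "(\<integral>\<^sup>+x. ennreal ((g n x - h x)\<^sup>2) \<partial>lborel) \<le> ennreal (1 / 4 ^ k)" if n: "n \<ge> N k" for n k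
  proof -
    have "(\<integral>\<^sup>+x. ennreal ((g n x - h x)\<^sup>2) \<partial>lborel)
        = (\<integral>\<^sup>+x. liminf (\<lambda>m. ennreal ((g n x - g (r m) x)\<^sup>2)) \<partial>lborel)"
    proof (rule nn_integral_cong_AE, use AElim in eventually_elim)
      fix x assume "(\<lambda>n. g (r n) x) \<longlonglongrightarrow> lim (\<lambda>n. g (r n) x)"
      then have "(\<lambda>m. ennreal ((g n x - g (r m) x)\<^sup>2)) \<longlonglongrightarrow> ennreal ((g n x - h x)\<^sup>2)"
        unfolding h_def by (intro tendsto_ennrealI tendsto_intros)
      from lim_imp_Liminf[OF trivial_limit_sequentially this] show "ennreal ((g n x - h x)\<^sup>2) = liminf (\<lambda>m. ennreal ((g n x - g (r m) x)\<^sup>2))"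
        by simp
    qed
    also have "\<dots> \<le> liminf (\<lambda>m. \<integral>\<^sup>+x. ennreal ((g n x - g (r m) x)\<^sup>2) \<partial>lborel)"
      by (rule nn_integral_liminf) measurable
    also have "\<dots> \<le> ennreal (1 / 4 ^ k)"
    proof (rule Liminf_le[OF sequentially_bot])
      have "(\<integral>\<^sup>+x. ennreal ((g n x - g (r m) x)\<^sup>2) \<partial>lborel) \<le> ennreal (1 / 4 ^ k)" if "m \<ge> k" for m
      proof -
        have "r m \<ge> r k" using that by (induction rule: dec_induct) (auto intro: order_trans rS)
        then have "r m \<ge> N k" using rN[of k] by linarith
        from N[OF n this] show ?thesis using sq_nn_integral[OF sqd, of n "r m"] by (simp add: ennreal_leI)
      qed
      then show "\<forall>\<^sub>F m in sequentially. (\<integral>\<^sup>+x. ennreal ((g n x - g (r m) x)\<^sup>2) \<partial>lborel) \<le> ennreal (1 / 4 ^ k)"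
        unfolding eventually_sequentially by blast
    qed
    finally show ?thesis .
  qed
  have sqgh: "sq_integrable (\<lambda>x. g n x - h x)" if "n \<ge> N 0" for n
    unfolding sq_integrable_def
  proof (intro conjI integrableI_bounded)
    show "(\<integral>\<^sup>+x. ennreal (norm ((g n x - h x)\<^sup>2)) \<partial>lborel) < \<infinity>"
      using le_less_trans[OF fatou[OF that]] by simp
  qed measurable
  have h: "sq_integrable h" using sq_integrable_diff[OF sq sqgh[of "N 0"], of "N 0"] by simp
  show ?thesis
  proof (rule that[OF h])
    show "(\<lambda>n. \<integral>x. (g n x - h x)\<^sup>2 \<partial>lborel) \<longlonglongrightarrow> 0"
    proof (rule LIMSEQ_I)
      fix e :: real assume "e > 0"
      then obtain k where k: "(1/4) ^ k < e" using real_arch_pow_inv[of e "1/4"] by auto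
      have "norm ((\<integral>x. (g n x - h x)\<^sup>2 \<partial>lborel) - 0) < e" if "n \<ge> N k" for n
      proof -
        have "ennreal (\<integral>x. (g n x - h x)\<^sup>2 \<partial>lborel) \<le> ennreal (1 / 4 ^ k)"
          using fatou[OF that] sq_nn_integral[OF sq_integrable_diff[OF sq h], of n] by simp
        then have "(\<integral>x. (g n x - h x)\<^sup>2 \<partial>lborel) \<le> 1 / 4 ^ k" by (simp add: ennreal_le_iff)
        then show ?thesis using k by (simp add: power_one_over)
      qed
      then show "\<exists>no. \<forall>n\<ge>no. norm ((\<integral>x. (g n x - h x)\<^sup>2 \<partial>lborel) - 0) < e" by blast
    qed
  qed
qed

section \<open>Line integrals of radial profiles\<close>

lemma nn_integral_lborel_affine:
  fixes f :: "'a::euclidean_space \<Rightarrow> ennreal"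
  assumes [measurable]: "f \<in> borel_measurable borel" and "c \<noteq> 0"
  shows "(\<integral>\<^sup>+x. f x \<partial>lborel) = ennreal (\<bar>c\<bar> ^ DIM('a)) * (\<integral>\<^sup>+x. f (t + c *\<^sub>R x) \<partial>lborel)"
proof -
  have "(\<integral>\<^sup>+x. f x \<partial>lborel) = (\<integral>\<^sup>+x. f x \<partial>density (distr lborel borel (\<lambda>x. t + c *\<^sub>R x)) (\<lambda>x. ennreal (\<bar>c\<bar> ^ DIM('a))))"
    using lborel_affine[OF assms(2), where t=t] by simp
  also have "\<dots> = ennreal (\<bar>c\<bar> ^ DIM('a)) * (\<integral>\<^sup>+x. f (t + c *\<^sub>R x) \<partial>lborel)"
    by (simp add: nn_integral_density nn_integral_distr nn_integral_cmult)
  finally show ?thesis .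
qed

lemma nn_integral_lborel_shift:
  fixes f :: "'a::euclidean_space \<Rightarrow> ennreal"
  assumes [measurable]: "f \<in> borel_measurable borel"
  shows "(\<integral>\<^sup>+x. f (c + x) \<partial>lborel) = (\<integral>\<^sup>+x. f x \<partial>lborel)"
    and "(\<integral>\<^sup>+x. f (x - c) \<partial>lborel) = (\<integral>\<^sup>+x. f x \<partial>lborel)"
    and "(\<integral>\<^sup>+x. f (c - x) \<partial>lborel) = (\<integral>\<^sup>+x. f x \<partial>lborel)"
  using nn_integral_lborel_affine[OF assms, of 1 c] nn_integral_lborel_affine[OF assms, of 1 "-c"]
    nn_integral_lborel_affine[OF assms, of "-1" c] by simp_all

text \<open>Uniqueness of translation-invariant measures: the image of Lebesgue measure under T is compared
  with Lebesgue measure through a convolution with the unit ball, which T preserves.\<close>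

lemma nn_integral_lborel_isometry:
  fixes f :: "'a::euclidean_space \<Rightarrow> ennreal"
  assumes [measurable]: "f \<in> borel_measurable borel"
    and lin: "linear T" and norm: "\<And>x. norm (T x) = norm x" and inv: "\<And>x. T (T x) = x"
  shows "(\<integral>\<^sup>+x. f (T x) \<partial>lborel) = (\<integral>\<^sup>+x. f x \<partial>lborel)"
proof -
  have [measurable]: "T \<in> borel_measurable borel"
    using lin by (intro borel_measurable_continuous_onI linear_continuous_on linear_conv_bounded_linear[THEN iffD1])
  define B :: "'a \<Rightarrow> ennreal" where "B = indicator (ball 0 1)"
  have [measurable]: "B \<in> borel_measurable borel" unfolding B_def by (intro borel_measurable_indicator) auto
  define b where "b = (\<integral>\<^sup>+x. B x \<partial>lborel)"
  have b_eq: "b = emeasure lborel (ball (0::'a) 1)" unfolding b_def B_def by simp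
  have b0: "b \<noteq> 0"
  proof
    assume "b = 0"
    then have "negligible (ball (0::'a) 1)"
      unfolding b_eq by (simp add: negligible_iff_null_sets null_setsI null_sets_completionI)
    then show False using open_not_negligible[of "ball (0::'a) 1"] by simp
  qed
  have bfin: "b < \<infinity>" unfolding b_eq by (rule emeasure_lborel_ball_finite)
  have "(\<integral>\<^sup>+x. f (T x) \<partial>lborel) * b = (\<integral>\<^sup>+y. (\<integral>\<^sup>+x. f (T x) \<partial>lborel) * B y \<partial>lborel)"
    unfolding b_def by (simp add: nn_integral_cmult)
  \<comment> \<open>Translating \<open>x\<close> by \<open>T y\<close> before \<open>T\<close> is
    translating by \<open>y\<close> after it, because \<open>T\<close> is its own inverse.\<close>
  also have "\<dots> = (\<integral>\<^sup>+y. (\<integral>\<^sup>+x. f (T x + y) * B y \<partial>lborel) \<partial>lborel)"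
  proof (rule nn_integral_cong)
    fix y
    have "(\<integral>\<^sup>+x. f (T x) \<partial>lborel) = (\<integral>\<^sup>+x. f (T (T y + x)) \<partial>lborel)"
      by (rule nn_integral_lborel_shift(1)[of "\<lambda>x. f (T x)", symmetric]) measurable
    also have "\<dots> = (\<integral>\<^sup>+x. f (T x + y) \<partial>lborel)"
      using linear_add[OF lin] by (simp add: inv add.commute)
    finally show "(\<integral>\<^sup>+x. f (T x) \<partial>lborel) * B y = (\<integral>\<^sup>+x. f (T x + y) * B y \<partial>lborel)"
      by (simp add: nn_integral_multc)
  qed
  also have "\<dots> = (\<integral>\<^sup>+x. (\<integral>\<^sup>+y. f (T x + y) * B y \<partial>lborel) \<partial>lborel)"
    by (rule lborel_pair.Fubini') measurable
  also have "\<dots> = (\<integral>\<^sup>+x. (\<integral>\<^sup>+y. f y * B (y - T x) \<partial>lborel) \<partial>lborel)"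
  proof (rule nn_integral_cong)
    fix x
    show "(\<integral>\<^sup>+y. f (T x + y) * B y \<partial>lborel) = (\<integral>\<^sup>+y. f y * B (y - T x) \<partial>lborel)"
      using nn_integral_lborel_shift(1)[of "\<lambda>y. f y * B (y - T x)" "T x"] by simp
  qed
  also have "\<dots> = (\<integral>\<^sup>+y. (\<integral>\<^sup>+x. f y * B (y - T x) \<partial>lborel) \<partial>lborel)"
    by (rule lborel_pair.Fubini') measurable
  also have "\<dots> = (\<integral>\<^sup>+y. f y * b \<partial>lborel)"
  proof (rule nn_integral_cong)
    fix y
    \<comment> \<open>This takes \<open>T\<close> off the integration variable, so that invariance
      under translations and x -> -x finishes the comparison.\<close>
    have "norm (y - T x) = norm (T y - x)" for x
      using norm[of "y - T x"] linear_diff[OF lin, of y "T x"] by (simp add: inv)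
    then have "B (y - T x) = B (T y - x)" for x unfolding B_def by (simp add: indicator_def)
    then show "(\<integral>\<^sup>+x. f y * B (y - T x) \<partial>lborel) = f y * b"
      unfolding b_def using nn_integral_lborel_shift(3)[of B "T y"] by (simp add: nn_integral_cmult)
  qed
  also have "\<dots> = (\<integral>\<^sup>+y. f y \<partial>lborel) * b" by (simp add: nn_integral_multc)
  finally show ?thesis
    using b0 bfin by (auto simp: ennreal_mult_cancel_left mult.commute[of _ b])
qed

text \<open>The reflection in the hyperplane orthogonal to v = x - y. Equal norms give 2 (x . v) = v
  . v, so it exchanges x and y.\<close>

lemma reflection_exists:
  fixes x y :: "'a::euclidean_space"
  assumes "norm x = norm y"
  obtains T where "linear T" "\<And>z. norm (T z) = norm z" "\<And>z. T (T z) = z" "T x = y"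
proof (cases "x = y")
  case True
  then show ?thesis using that[of id] by (simp add: linear_id)
next
  case False
  define v where "v = x - y"
  have v0: "v \<bullet> v \<noteq> 0" using False unfolding v_def by simp
  define T where "T z = z - (2 * (z \<bullet> v) / (v \<bullet> v)) *\<^sub>R v" for z
  have xx: "x \<bullet> x = y \<bullet> y" using assms by (simp add: norm_eq)
  have "linear T" unfolding T_def
    by (intro linearI) (auto simp: inner_add_left algebra_simps add_divide_distrib scaleR_add_left)
  moreover have "norm (T z) = norm z" for z
    unfolding norm_eq T_def using v0
    by (simp add: inner_diff_left inner_diff_right inner_commute field_simps)
  moreover have "T (T z) = z" for z
    unfolding T_def using v0 by (simp add: inner_diff_left algebra_simps)
  moreover have "T x = y"
  proof -
    have "2 * (x \<bullet> v) = v \<bullet> v" unfolding v_def using xx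
      by (simp add: inner_diff_left inner_diff_right inner_commute)
    then show ?thesis unfolding T_def using v0 by (simp add: v_def)
  qed
  ultimately show ?thesis using that by blast
qed

text \<open>Rescaling the Euler integral from the unit interval to (a, b). It composes two Abel
  kernels into one, and the identities for half-order integration below reduce to it.\<close>

lemma nn_integral_Beta:
  fixes a b p q :: real
  assumes "a < b" "0 < p" "0 < q"
  shows "(\<integral>\<^sup>+x. indicator {a<..<b} x * ennreal ((x - a) powr (p - 1) * (b - x) powr (q - 1)) \<partial>lborel)
    = ennreal (Beta p q * (b - a) powr (p + q - 1))"
proof -
  let ?f = "\<lambda>x. indicator {a<..<b} x * ennreal ((x - a) powr (p - 1) * (b - x) powr (q - 1))"
  have "(\<integral>\<^sup>+x. ?f x \<partial>lborel) = ennreal \<bar>b - a\<bar> * (\<integral>\<^sup>+v. ?f (a + (b - a) * v) \<partial>lborel)"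
    using assms by (intro nn_integral_real_affine) auto
  also have "(\<integral>\<^sup>+v. ?f (a + (b - a) * v) \<partial>lborel) =
      (\<integral>\<^sup>+v. ennreal ((b - a) powr (p + q - 2)) * ennreal (indicator {0..1} v * (v powr (p - 1) * (1 - v) powr (q - 1))) \<partial>lborel)"
  proof (rule nn_integral_cong)
    fix v :: real
    consider "v \<le> 0" | "v \<ge> 1" | "0 < v" "v < 1" by linarith
    then show "?f (a + (b - a) * v) = ennreal ((b - a) powr (p + q - 2)) * ennreal (indicator {0..1} v * (v powr (p - 1) * (1 - v) powr (q - 1)))"
    proof cases
      case 1
      then have "\<not> 0 < (b - a) * v" using assms by (simp add: zero_less_mult_iff)
      then show ?thesis using 1 by (auto simp: indicator_def)
    next
      case 2
      then have "(b - a) * v \<ge> (b - a) * 1" using assms by (intro mult_left_mono) auto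
      then show ?thesis using 2 by (auto simp: indicator_def)
    next
      case 3
      have "(b - a) * v < (b - a) * 1" using assms 3 by (intro mult_strict_left_mono) auto
      moreover have "(b - a) * v > 0" using assms 3 by simp
      ultimately have ind: "a + (b - a) * v \<in> {a<..<b}" by simp
      have e: "a + (b - a) * v - a = (b - a) * v" "b - (a + (b - a) * v) = (b - a) * (1 - v)"
        by (auto simp: algebra_simps)
      have "(b - a) powr (p - 1) * (b - a) powr (q - 1) = (b - a) powr (p + q - 2)"
        by (simp flip: powr_add)
      then have "(a + (b - a) * v - a) powr (p - 1) * (b - (a + (b - a) * v)) powr (q - 1)
        = (b - a) powr (p + q - 2) * (v powr (p - 1) * (1 - v) powr (q - 1))"
        unfolding e using assms 3 by (simp add: powr_mult mult.commute mult.left_commute)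
      then show ?thesis using ind 3 by (simp add: ennreal_mult')
    qed
  qed
  also have "\<dots> = ennreal ((b - a) powr (p + q - 2)) * ennreal (Beta p q)"
    by (subst nn_integral_cmult) (use nn_integral_has_integral_lebesgue[OF _ has_integral_Beta_real[OF assms(2,3)]] in auto)
  also have "ennreal \<bar>b - a\<bar> * \<dots> = ennreal ((b - a) * ((b - a) powr (p + q - 2) * Beta p q))"
    using assms by (simp add: ennreal_mult' Beta_def Gamma_real_pos less_imp_le flip: ennreal_mult)
  also have "(b - a) * ((b - a) powr (p + q - 2) * Beta p q) = Beta p q * (b - a) powr (p + q - 1)"
    using assms powr_mult_base[of "b - a" "p + q - 2"] by (simp add: algebra_simps)
  finally show ?thesis .
qed

text \<open>For a radial function with value \<open>\<phi>\<close> (norm^2 / 2) and t \<ge> 0, this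
  is its integral over a line at distance sqrt (2 t) from the origin: t + s^2 / 2 is half the
  squared norm at offset s.\<close>

definition line_int :: "(real \<Rightarrow> ennreal) \<Rightarrow> real \<Rightarrow> ennreal" where
  "line_int \<phi> t = (\<integral>\<^sup>+s. \<phi> (t + s\<^sup>2 / 2) \<partial>lborel)"

lemma borel_measurable_line_int [measurable]:
  assumes [measurable]: "\<phi> \<in> borel_measurable borel"
  shows "line_int \<phi> \<in> borel_measurable borel"
  unfolding line_int_def by measurable

text \<open>The substitution x = t + s^2 / 2 on each of the two half-lines has dx = s ds with s =
  sqrt (2 (x - t)), hence the kernel sqrt 2 (x - t)^(-1/2). As Gamma (1/2) = sqrt pi, this is sqrt
  (2 pi) times the integral of order 1/2.\<close>

lemma line_int_Abel:
  assumes [measurable]: "\<phi> \<in> borel_measurable borel"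
  shows "line_int \<phi> t = (\<integral>\<^sup>+x. indicator {t<..} x * (ennreal (sqrt 2 * (x - t) powr (-1/2)) * \<phi> x) \<partial>lborel)"
proof -
  define k where "k x = sqrt 2 * (x - t) powr (-1/2)" for x
  have [measurable]: "k \<in> borel_measurable borel" unfolding k_def by measurable
  have even: "(\<integral>\<^sup>+s. h (s\<^sup>2) \<partial>lborel) = 2 * (\<integral>\<^sup>+s. h (s\<^sup>2) * indicator {0..} s \<partial>lborel)"
    if [measurable]: "h \<in> borel_measurable borel" for h :: "real \<Rightarrow> ennreal"
  proof -
    have "(\<integral>\<^sup>+s. h (s\<^sup>2) \<partial>lborel) = (\<integral>\<^sup>+s. h (s\<^sup>2) * indicator {0..} s + h (s\<^sup>2) * indicator {..0} s \<partial>lborel)"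
      using AE_lborel_singleton[of "0::real"]
      by (intro nn_integral_cong_AE) (auto elim!: eventually_mono simp: indicator_def)
    also have "\<dots> = (\<integral>\<^sup>+s. h (s\<^sup>2) * indicator {0..} s \<partial>lborel) + (\<integral>\<^sup>+s. h (s\<^sup>2) * indicator {..0} s \<partial>lborel)"
      by (intro nn_integral_add) auto
    also have "(\<integral>\<^sup>+s. h (s\<^sup>2) * indicator {..0} s \<partial>lborel) = (\<integral>\<^sup>+s. h (s\<^sup>2) * indicator {0..} s \<partial>lborel)"
      by (subst nn_integral_real_affine[where c="-1" and t=0]) (auto simp: indicator_def intro!: nn_integral_cong)
    finally show ?thesis by (simp add: mult_2)
  qed
  \<comment> \<open>The substitution is carried out for finite integrands on bounded intervals;
    general \<open>\<phi>\<close> is reached by truncation and monotone convergence.\<close>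
  have fin: "(\<integral>\<^sup>+s. \<phi>' (t + s\<^sup>2 / 2) * indicator {0..real i} s \<partial>lborel) * 2
      = (\<integral>\<^sup>+x. ennreal (k x) * \<phi>' x * indicator {t..t + (real i)\<^sup>2 / 2} x \<partial>lborel)"
    if \<phi>'[measurable]: "\<phi>' \<in> borel_measurable borel" and fin: "\<And>x. \<phi>' x \<noteq> \<infinity>" for \<phi>' :: "real \<Rightarrow> ennreal" and i :: nat
  proof -
    define h where "h x = enn2real (\<phi>' x)" for x
    have h: "\<phi>' x = ennreal (h x)" "h x \<ge> 0" for x using fin[of x] unfolding h_def by (simp_all add: less_top)
    have [measurable]: "h \<in> borel_measurable borel" unfolding h_def by measurable
    let ?g = "\<lambda>s::real. t + s\<^sup>2 / 2"
    have "(\<integral>\<^sup>+x. ennreal (k x * h x * indicator {?g 0..?g (real i)} x) \<partial>lborel) =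
      (\<integral>\<^sup>+s. ennreal (k (?g s) * h (?g s) * s * indicator {0..real i} s) \<partial>lborel)"
      by (rule nn_integral_substitution)
        (auto intro!: derivative_eq_intros continuous_intros simp: set_borel_measurable_def)
    also have "\<dots> = (\<integral>\<^sup>+s. \<phi>' (t + s\<^sup>2 / 2) * indicator {0..real i} s * 2 \<partial>lborel)"
    proof (rule nn_integral_cong_AE, use AE_lborel_singleton[of "0::real"] in eventually_elim)
      fix s :: real assume "s \<noteq> 0"
      show "ennreal (k (?g s) * h (?g s) * s * indicator {0..real i} s) = \<phi>' (t + s\<^sup>2 / 2) * indicator {0..real i} s * 2"
      proof (cases "s \<in> {0..real i}")
        case True
        then have "s > 0" using \<open>s \<noteq> 0\<close> by simp
        then have "k (?g s) * s = 2"
          unfolding k_def by (simp add: powr_minus powr_half_sqrt real_sqrt_divide field_simps)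
        then have "k (?g s) * h (?g s) * s = h (?g s) * 2" by (simp add: mult.assoc mult.left_commute)
        then have "ennreal (k (?g s) * h (?g s) * s) = ennreal (h (?g s)) * 2"
          using h(2) by (simp only: ennreal_mult'' ennreal_numeral zero_le_numeral)
        then show ?thesis using True h by simp
      qed simp
    qed
    also have "\<dots> = (\<integral>\<^sup>+s. \<phi>' (t + s\<^sup>2 / 2) * indicator {0..real i} s \<partial>lborel) * 2"
      by (rule nn_integral_multc) measurable
    also have "(\<integral>\<^sup>+x. ennreal (k x * h x * indicator {?g 0..?g (real i)} x) \<partial>lborel)
      = (\<integral>\<^sup>+x. ennreal (k x) * \<phi>' x * indicator {t..t + (real i)\<^sup>2 / 2} x \<partial>lborel)"
      by (intro nn_integral_cong) (simp add: h(1) ennreal_mult'' h(2) indicator_def)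
    finally show ?thesis ..
  qed
  define A where "A i s = min (\<phi> (t + s\<^sup>2 / 2)) (of_nat i) * indicator {0..real i} s" for i :: nat and s
  define C where "C i x = ennreal (k x) * min (\<phi> x) (of_nat i) * indicator {t..t + (real i)\<^sup>2 / 2} x" for i :: nat and x
  have [measurable]: "A i \<in> borel_measurable borel" "C i \<in> borel_measurable borel" for i
    unfolding A_def C_def by measurable
  have eq: "(\<integral>\<^sup>+s. A i s \<partial>lborel) * 2 = (\<integral>\<^sup>+x. C i x \<partial>lborel)" for i
    unfolding A_def C_def by (rule fin) (auto simp: min_def top_unique)
  have min_sup: "(SUP i. min y (of_nat i)) = y" for y :: ennreal
    using inf_SUP[of y "of_nat :: nat \<Rightarrow> ennreal" UNIV] by (simp add: inf_min ennreal_SUP_of_nat_eq_top)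
  \<comment> \<open>Cutoff height and exhausting set grow with the same index, so one supremum
    recovers both; \<open>max i n\<close> reaches a given height inside the set.\<close>
  have sup_ind: "(SUP i. c * min y (of_nat i) * indicator (I i) z) = c * y * indicator (\<Union>i. I i) z"
    if "incseq I" for c y :: ennreal and I :: "nat \<Rightarrow> real set" and z
  proof (cases "z \<in> (\<Union>i. I i)")
    case False
    then show ?thesis by (simp add: indicator_def)
  next
    case True
    then obtain n where n: "z \<in> I n" by blast
    have "(SUP i. c * min y (of_nat i) * indicator (I i) z) = (SUP i. c * min y (of_nat i))"
    proof (rule SUP_eq)
      fix i
      show "\<exists>j\<in>UNIV. c * min y (of_nat i) * indicator (I i) z \<le> c * min y (of_nat j)"
        by (auto intro!: exI[of _ i] simp: indicator_def)
      have "z \<in> I (max i n)" using n that by (meson incseqD max.cobounded2 subsetD)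
      moreover have "min y (of_nat i) \<le> min y (of_nat (max i n) :: ennreal)"
        by (intro min.mono) auto
      ultimately show "\<exists>j\<in>UNIV. c * min y (of_nat i) \<le> c * min y (of_nat j) * indicator (I j) z"
        by (intro bexI[of _ "max i n"]) (auto intro!: mult_left_mono)
    qed
    also have "\<dots> = c * y" using SUP_mult_left_ennreal[of c "\<lambda>i. min y (of_nat i)" UNIV] min_sup by simp
    finally show ?thesis using True by simp
  qed
  have inc: "incseq (\<lambda>i z. c z * min (y z) (of_nat i) * indicator (I i) z)" if "incseq I"
    for c y :: "real \<Rightarrow> ennreal" and I :: "nat \<Rightarrow> real set"
  proof (intro incseq_SucI le_funI)
    fix i z
    have "min (y z) (of_nat i) \<le> min (y z) (of_nat (Suc i))"
      by (intro min.mono) (auto simp: of_nat_Suc[symmetric] simp del: of_nat_Suc)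
    moreover have "indicator (I i) z \<le> (indicator (I (Suc i)) z :: ennreal)"
      using incseq_SucD[OF that, of i] by (auto simp: indicator_def)
    ultimately show "c z * min (y z) (of_nat i) * indicator (I i) z \<le> c z * min (y z) (of_nat (Suc i)) * indicator (I (Suc i)) z"
      by (intro mult_mono) auto
  qed
  have I1: "incseq (\<lambda>i. {0..real i})"
    by (auto intro!: incseq_SucI)
  have I2: "incseq (\<lambda>i. {t..t + (real i)\<^sup>2 / 2})"
  proof (rule incseq_SucI)
    fix i
    have "(real i)\<^sup>2 \<le> (real (Suc i))\<^sup>2" by (intro power_mono) auto
    then show "{t..t + (real i)\<^sup>2 / 2} \<subseteq> {t..t + (real (Suc i))\<^sup>2 / 2}" by auto
  qed
  have U1: "(\<Union>i. {0..real i}) = {0..}" using real_arch_simple by auto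
  have U2: "(\<Union>i. {t..t + (real i)\<^sup>2 / 2}) = {t..}"
  proof (intro equalityI subsetI)
    fix x assume "x \<in> {t..}"
    obtain n :: nat where n: "2 * (x - t) \<le> real n" "1 \<le> n"
      using real_arch_simple[of "max 1 (2 * (x - t))"] by auto
    have "real n \<le> (real n)\<^sup>2" using n by (intro self_le_power) auto
    moreover have "x \<le> t + w / 2" if "2 * (x - t) \<le> m" "m \<le> w" for m w :: real
      using that by argo
    ultimately have "x \<le> t + (real n)\<^sup>2 / 2" using n(1) by blast
    then show "x \<in> (\<Union>i. {t..t + (real i)\<^sup>2 / 2})" using \<open>x \<in> {t..}\<close> by auto
  qed auto
  have "line_int \<phi> t = 2 * (\<integral>\<^sup>+s. \<phi> (t + s\<^sup>2 / 2) * indicator {0..} s \<partial>lborel)"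
    unfolding line_int_def by (rule even[of "\<lambda>u. \<phi> (t + u / 2)"]) measurable
  also have "(\<integral>\<^sup>+s. \<phi> (t + s\<^sup>2 / 2) * indicator {0..} s \<partial>lborel) = (\<integral>\<^sup>+s. (SUP i. A i s) \<partial>lborel)"
    unfolding A_def using sup_ind[OF I1, where c=1] by (simp add: U1)
  also have "\<dots> = (SUP i. \<integral>\<^sup>+s. A i s \<partial>lborel)"
    by (rule nn_integral_monotone_convergence_SUP)
      (use inc[OF I1, of "\<lambda>_. 1" "\<lambda>s. \<phi> (t + s\<^sup>2 / 2)"] in \<open>auto simp: A_def[abs_def]\<close>)
  also have "2 * \<dots> = (SUP i. (\<integral>\<^sup>+s. A i s \<partial>lborel) * 2)"
    by (subst SUP_mult_left_ennreal) (simp add: mult.commute)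
  also have "\<dots> = (SUP i. \<integral>\<^sup>+x. C i x \<partial>lborel)" unfolding eq ..
  also have "\<dots> = (\<integral>\<^sup>+x. (SUP i. C i x) \<partial>lborel)"
    by (rule nn_integral_monotone_convergence_SUP[symmetric])
      (use inc[OF I2, of "\<lambda>x. ennreal (k x)" \<phi>] in \<open>auto simp: C_def[abs_def]\<close>)
  also have "\<dots> = (\<integral>\<^sup>+x. ennreal (k x) * \<phi> x * indicator {t..} x \<partial>lborel)"
    unfolding C_def using sup_ind[OF I2] by (simp add: U2)
  also have "\<dots> = (\<integral>\<^sup>+x. indicator {t<..} x * (ennreal (k x) * \<phi> x) \<partial>lborel)"
    using AE_lborel_singleton[of t]
    by (intro nn_integral_cong_AE) (auto elim!: eventually_mono simp: indicator_def)
  finally show ?thesis unfolding k_def .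
qed

text \<open>Two half-order integrals make a first-order one: the inner integral over y is Beta (1/2)
  (1/2) = pi for all t < x, and the two factors sqrt 2 supply the 2. Geometrically this is
  integration over a plane in polar coordinates.\<close>

lemma line_int_line_int:
  assumes [measurable]: "\<phi> \<in> borel_measurable borel"
  shows "line_int (line_int \<phi>) t = ennreal (2 * pi) * (\<integral>\<^sup>+x. indicator {t<..} x * \<phi> x \<partial>lborel)"
proof -
  let ?k = "\<lambda>t x. ennreal (sqrt 2 * (x - t) powr (-1/2))"
  have "line_int (line_int \<phi>) t = (\<integral>\<^sup>+y. indicator {t<..} y * (?k t y * line_int \<phi> y) \<partial>lborel)"
    by (rule line_int_Abel) measurable
  also have "\<dots> = (\<integral>\<^sup>+y. (\<integral>\<^sup>+x. indicator {t<..} y * (?k t y * (of_bool (y < x) * (?k y x * \<phi> x))) \<partial>lborel) \<partial>lborel)"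
    by (intro nn_integral_cong)
      (simp add: line_int_Abel nn_integral_cmult indicator_def of_bool_def cong: nn_integral_cong)
  also have "\<dots> = (\<integral>\<^sup>+x. (\<integral>\<^sup>+y. indicator {t<..} y * (?k t y * (of_bool (y < x) * (?k y x * \<phi> x))) \<partial>lborel) \<partial>lborel)"
    by (rule lborel_pair.Fubini') measurable
  also have "\<dots> = (\<integral>\<^sup>+x. ennreal (2 * pi) * (indicator {t<..} x * \<phi> x) \<partial>lborel)"
  proof (rule nn_integral_cong)
    fix x
    have "(\<integral>\<^sup>+y. indicator {t<..} y * (?k t y * (of_bool (y < x) * (?k y x * \<phi> x))) \<partial>lborel)
      = (\<integral>\<^sup>+y. 2 * \<phi> x * (indicator {t<..<x} y * ennreal ((y - t) powr (1/2 - 1) * (x - y) powr (1/2 - 1))) \<partial>lborel)"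
    proof (rule nn_integral_cong)
      fix y
      have "?k t y * ?k y x = 2 * ennreal ((y - t) powr (1/2 - 1) * (x - y) powr (1/2 - 1))"
        by (simp add: ennreal_mult'[symmetric] ennreal_numeral[symmetric] mult.assoc mult.left_commute del: ennreal_numeral)
      then show "indicator {t<..} y * (?k t y * (of_bool (y < x) * (?k y x * \<phi> x))) =
        2 * \<phi> x * (indicator {t<..<x} y * ennreal ((y - t) powr (1/2 - 1) * (x - y) powr (1/2 - 1)))"
        by (auto simp: indicator_def of_bool_def mult.assoc mult.left_commute mult.commute)
    qed
    also have "\<dots> = 2 * \<phi> x * (\<integral>\<^sup>+y. indicator {t<..<x} y * ennreal ((y - t) powr (1/2 - 1) * (x - y) powr (1/2 - 1)) \<partial>lborel)"
      by (rule nn_integral_cmult) measurable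
    also have "\<dots> = ennreal (2 * pi) * (indicator {t<..} x * \<phi> x)"
    proof (cases "t < x")
      case True
      have "Beta (1/2) (1/2) = (pi::real)" by (simp add: Beta_def Gamma_one_half_real)
      then show ?thesis using nn_integral_Beta[OF True, of "1/2" "1/2"] True
        by (simp add: ennreal_mult' mult.left_commute mult.commute mult.assoc)
    qed (simp add: indicator_def)
    finally show "(\<integral>\<^sup>+y. indicator {t<..} y * (?k t y * (of_bool (y < x) * (?k y x * \<phi> x))) \<partial>lborel)
      = ennreal (2 * pi) * (indicator {t<..} x * \<phi> x)" .
  qed
  also have "\<dots> = ennreal (2 * pi) * (\<integral>\<^sup>+x. indicator {t<..} x * \<phi> x \<partial>lborel)"
    by (rule nn_integral_cmult) measurable
  finally show ?thesis .
qed

lemma pos_pow_nonneg: "0 \<le> pos_pow t a"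
  unfolding pos_pow_def by simp

lemma borel_measurable_pos_pow [measurable]: "(\<lambda>t. pos_pow t a) \<in> borel_measurable borel"
  unfolding pos_pow_def by measurable

text \<open>In f-form (1 - r^2)_+^\<delta> reads (1 - 2 t)_+^\<delta>. The Beta integral on (t, 1/2)
  raises the exponent by 1/2; the powers of 2 from 1 - 2 x = 2 (1/2 - x) balance exactly.\<close>

lemma line_int_pos_pow:
  assumes "\<delta> > -1"
  shows "line_int (\<lambda>t. ennreal (pos_pow (1 - 2 * t) \<delta>)) t = ennreal (Beta (1/2) (\<delta> + 1) * pos_pow (1 - 2 * t) (\<delta> + 1/2))"
proof -
  let ?w = "\<lambda>t. ennreal (pos_pow (1 - 2 * t) \<delta>)"
  have "line_int ?w t = (\<integral>\<^sup>+x. indicator {t<..} x * (ennreal (sqrt 2 * (x - t) powr (-1/2)) * ?w x) \<partial>lborel)"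
    by (rule line_int_Abel) measurable
  also have "\<dots> = (\<integral>\<^sup>+x. ennreal (sqrt 2 * 2 powr \<delta>) * (indicator {t<..<1/2} x * ennreal ((x - t) powr (1/2 - 1) * (1/2 - x) powr ((\<delta> + 1) - 1))) \<partial>lborel)"
  proof (rule nn_integral_cong)
    fix x
    have "(1 - 2 * x) powr \<delta> = 2 powr \<delta> * (1/2 - x) powr \<delta>" if "x < 1/2"
      using that powr_mult[of 2 "1/2 - x" \<delta>] by (simp add: algebra_simps)
    then show "indicator {t<..} x * (ennreal (sqrt 2 * (x - t) powr (-1/2)) * ?w x) =
      ennreal (sqrt 2 * 2 powr \<delta>) * (indicator {t<..<1/2} x * ennreal ((x - t) powr (1/2 - 1) * (1/2 - x) powr ((\<delta> + 1) - 1)))"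
      by (auto simp: indicator_def pos_pow_def ennreal_mult'[symmetric] mult.assoc mult.left_commute)
  qed
  also have "\<dots> = ennreal (sqrt 2 * 2 powr \<delta>) * (\<integral>\<^sup>+x. (indicator {t<..<1/2} x * ennreal ((x - t) powr (1/2 - 1) * (1/2 - x) powr ((\<delta> + 1) - 1))) \<partial>lborel)"
    by (rule nn_integral_cmult) measurable
  also have "\<dots> = ennreal (Beta (1/2) (\<delta> + 1) * pos_pow (1 - 2 * t) (\<delta> + 1/2))"
  proof (cases "t < 1/2")
    case True
    have "(1 - 2 * t) powr (\<delta> + 1/2) = 2 powr (\<delta> + 1/2) * (1/2 - t) powr (\<delta> + 1/2)"
      using True powr_mult[of 2 "1/2 - t" "\<delta> + 1/2"] by (simp add: algebra_simps)
    moreover have "2 powr (\<delta> + 1/2) = sqrt 2 * 2 powr \<delta>"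
      by (simp add: powr_add powr_half_sqrt)
    ultimately have eq: "sqrt 2 * 2 powr \<delta> * (Beta (1/2) (\<delta> + 1) * (1/2 - t) powr (1/2 + (\<delta> + 1) - 1)) = Beta (1/2) (\<delta> + 1) * pos_pow (1 - 2 * t) (\<delta> + 1/2)"
      using True by (simp add: pos_pow_def algebra_simps)
    have I: "(\<integral>\<^sup>+x. (indicator {t<..<1/2} x * ennreal ((x - t) powr (1/2 - 1) * (1/2 - x) powr ((\<delta> + 1) - 1))) \<partial>lborel)
      = ennreal (Beta (1/2) (\<delta> + 1) * (1/2 - t) powr (1/2 + (\<delta> + 1) - 1))"
      using assms by (intro nn_integral_Beta True) auto
    show ?thesis unfolding I by (subst ennreal_mult'[symmetric]) (simp, simp only: eq)
  next
    case False
    then show ?thesis by (simp add: pos_pow_def)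
  qed
  finally show ?thesis .
qed

section \<open>Slicing Euclidean space along a coordinate axis\<close>

interpretation lborel_product: product_sigma_finite "\<lambda>_. lborel :: real measure"
  by standard

text \<open>The hyperplane orthogonal to \<open>b\<close> is kept as a product over
  \<open>Basis - {b}\<close>, so that no Euclidean type of one dimension less has to enter.\<close>

lemma nn_integral_lborel_slice:
  fixes f :: "'a::euclidean_space \<Rightarrow> ennreal"
  assumes [measurable]: "f \<in> borel_measurable borel" and b: "b \<in> Basis"
  shows "(\<integral>\<^sup>+x. f x \<partial>lborel) =
    (\<integral>\<^sup>+a. \<integral>\<^sup>+s. f (s *\<^sub>R b + (\<Sum>j\<in>Basis - {b}. a j *\<^sub>R j)) \<partial>lborel \<partial>Pi\<^sub>M (Basis - {b}) (\<lambda>_. lborel))"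
proof -
  have ins: "insert b (Basis - {b}) = (Basis :: 'a set)" using b by auto
  have "(\<integral>\<^sup>+x. f x \<partial>lborel) = (\<integral>\<^sup>+a. f (\<Sum>j\<in>Basis. a j *\<^sub>R j) \<partial>Pi\<^sub>M Basis (\<lambda>_. lborel))"
    by (subst lborel_eq, subst nn_integral_distr) auto
  also have "\<dots> = (\<integral>\<^sup>+a. f (\<Sum>j\<in>insert b (Basis - {b}). a j *\<^sub>R j) \<partial>Pi\<^sub>M (insert b (Basis - {b})) (\<lambda>_. lborel))"
    unfolding ins ..
  also have "\<dots> = (\<integral>\<^sup>+a. \<integral>\<^sup>+s. f (\<Sum>j\<in>insert b (Basis - {b}). (a(b := s)) j *\<^sub>R j) \<partial>lborel \<partial>Pi\<^sub>M (Basis - {b}) (\<lambda>_. lborel))"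
    by (rule lborel_product.product_nn_integral_insert) auto
  also have "\<dots> = (\<integral>\<^sup>+a. \<integral>\<^sup>+s. f (s *\<^sub>R b + (\<Sum>j\<in>Basis - {b}. a j *\<^sub>R j)) \<partial>lborel \<partial>Pi\<^sub>M (Basis - {b}) (\<lambda>_. lborel))"
  proof -
    have "(\<Sum>j\<in>insert b (Basis - {b}). (a(b := s)) j *\<^sub>R j) = s *\<^sub>R b + (\<Sum>j\<in>Basis - {b}. a j *\<^sub>R j)" for a s
    proof -
      have "(\<Sum>j\<in>Basis - {b}. (a(b := s)) j *\<^sub>R j) = (\<Sum>j\<in>Basis - {b}. a j *\<^sub>R j)"
        by (rule sum.cong) auto
      then show ?thesis by (subst sum.insert) auto
    qed
    then show ?thesis by simp
  qed
  finally show ?thesis .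
qed

lemma borel_measurable_line_int_funpow [measurable]:
  "\<phi> \<in> borel_measurable borel \<Longrightarrow> (line_int ^^ n) \<phi> \<in> borel_measurable borel"
  by (induction n) auto

text \<open>Each coordinate adds half a square to the argument and so costs one line integral. The
  centre \<open>c\<close> drops out by translation invariance, which covers both factors of a
  convolution.\<close>

lemma nn_integral_PiM_line_int:
  assumes "finite J" and [measurable]: "\<phi> \<in> borel_measurable borel"
  shows "(\<integral>\<^sup>+a. \<phi> (t + (\<Sum>j\<in>J. (a j - c j)\<^sup>2) / 2) \<partial>Pi\<^sub>M J (\<lambda>_. lborel)) = (line_int ^^ card J) \<phi> t"
  using assms(1)
proof (induction J arbitrary: t rule: finite_induct)
  case empty
  then show ?case by (simp add: nn_integral_count_space_finite PiM_empty)
next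
  case (insert i J)
  have "(\<integral>\<^sup>+a. \<phi> (t + (\<Sum>j\<in>insert i J. (a j - c j)\<^sup>2) / 2) \<partial>Pi\<^sub>M (insert i J) (\<lambda>_. lborel))
    = (\<integral>\<^sup>+s. \<integral>\<^sup>+a. \<phi> (t + (\<Sum>j\<in>insert i J. ((a(i := s)) j - c j)\<^sup>2) / 2) \<partial>Pi\<^sub>M J (\<lambda>_. lborel) \<partial>lborel)"
    by (rule lborel_product.product_nn_integral_insert_rev) (use insert in auto)
  also have "\<dots> = (\<integral>\<^sup>+s. \<integral>\<^sup>+a. \<phi> ((t + (s - c i)\<^sup>2 / 2) + (\<Sum>j\<in>J. (a j - c j)\<^sup>2) / 2) \<partial>Pi\<^sub>M J (\<lambda>_. lborel) \<partial>lborel)"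
  proof -
    have "(\<Sum>j\<in>J. ((a(i := s)) j - c j)\<^sup>2) = (\<Sum>j\<in>J. (a j - c j)\<^sup>2)" for a s
      using insert by (intro sum.cong) auto
    then show ?thesis using insert by (simp add: add_divide_distrib add.assoc)
  qed
  also have "\<dots> = (\<integral>\<^sup>+s. (line_int ^^ card J) \<phi> (t + (s - c i)\<^sup>2 / 2) \<partial>lborel)"
    using insert by simp
  also have "\<dots> = line_int ((line_int ^^ card J) \<phi>) t"
    unfolding line_int_def[of "(line_int ^^ card J) \<phi>"]
    by (rule nn_integral_lborel_shift(2)[of "\<lambda>s. (line_int ^^ card J) \<phi> (t + s\<^sup>2 / 2)" "c i"]) measurable
  finally show ?case using insert by simp
qed

lemma line_int_cmult:
  assumes [measurable]: "\<phi> \<in> borel_measurable borel"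
  shows "line_int (\<lambda>t. c * \<phi> t) = (\<lambda>t. c * line_int \<phi> t)"
  unfolding line_int_def by (intro ext nn_integral_cmult) measurable

lemma norm_slice:
  fixes b :: "'a::euclidean_space"
  assumes b: "b \<in> Basis"
  shows "(norm (s *\<^sub>R b + (\<Sum>j\<in>Basis - {b}. a j *\<^sub>R j) - y))\<^sup>2 = (s - y \<bullet> b)\<^sup>2 + (\<Sum>j\<in>Basis - {b}. (a j - y \<bullet> j)\<^sup>2)"
proof -
  let ?x = "s *\<^sub>R b + (\<Sum>j\<in>Basis - {b}. a j *\<^sub>R j)"
  have comp: "(\<Sum>j\<in>Basis - {b}. a j *\<^sub>R j) \<bullet> i = (if i = b then 0 else a i)" if "i \<in> Basis" for i
    using that by (auto simp: inner_sum_left inner_Basis if_distrib sum.delta cong: if_cong)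
  have "(norm (?x - y))\<^sup>2 = (\<Sum>i\<in>Basis. ((?x - y) \<bullet> i)\<^sup>2)"
    unfolding power2_norm_eq_inner by (subst euclidean_inner) (simp add: power2_eq_square)
  also have "\<dots> = ((?x - y) \<bullet> b)\<^sup>2 + (\<Sum>i\<in>Basis - {b}. ((?x - y) \<bullet> i)\<^sup>2)"
    using b by (simp add: sum.remove)
  also have "(?x - y) \<bullet> b = s - y \<bullet> b"
    using b comp[OF b] by (simp add: inner_add_left inner_diff_left)
  also have "(\<Sum>i\<in>Basis - {b}. ((?x - y) \<bullet> i)\<^sup>2) = (\<Sum>j\<in>Basis - {b}. (a j - y \<bullet> j)\<^sup>2)"
    using b comp by (intro sum.cong) (auto simp: inner_add_left inner_diff_left inner_Basis)
  finally show ?thesis .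
qed

lemma norm_slice0:
  fixes b :: "'a::euclidean_space"
  assumes b: "b \<in> Basis"
  shows "(norm (s *\<^sub>R b + (\<Sum>j\<in>Basis - {b}. a j *\<^sub>R j)))\<^sup>2 = s\<^sup>2 + (\<Sum>j\<in>Basis - {b}. (a j)\<^sup>2)"
  using norm_slice[OF b, of s a 0] by simp

lemma inner_slice:
  fixes b :: "'a::euclidean_space"
  assumes b: "b \<in> Basis"
  shows "(s *\<^sub>R b + (\<Sum>j\<in>Basis - {b}. a j *\<^sub>R j)) \<bullet> b = s"
  using b by (auto simp: inner_add_left inner_sum_left inner_Basis if_distrib sum.delta cong: if_cong)

section \<open>Autoconvolutions of radial functions\<close>

definition radial_autoconv :: "(real \<Rightarrow> ennreal) \<Rightarrow> 'a::euclidean_space \<Rightarrow> ennreal" where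
  "radial_autoconv p x = (\<integral>\<^sup>+y. p ((norm y)\<^sup>2 / 2) * p ((norm (x - y))\<^sup>2 / 2) \<partial>lborel)"

lemma radial_autoconv_cong_norm:
  fixes x y :: "'a::euclidean_space"
  assumes [measurable]: "p \<in> borel_measurable borel" and "norm x = norm y"
  shows "radial_autoconv p x = radial_autoconv p y"
proof -
  obtain T :: "'a \<Rightarrow> 'a" where T: "linear T" "\<And>z. norm (T z) = norm z" "\<And>z. T (T z) = z" "T x = y"
    using reflection_exists[OF assms(2)] by blast
  have "radial_autoconv p y = (\<integral>\<^sup>+z. p ((norm (T z))\<^sup>2 / 2) * p ((norm (y - T z))\<^sup>2 / 2) \<partial>lborel)"
    unfolding radial_autoconv_def
    by (rule nn_integral_lborel_isometry[OF _ T(1-3), symmetric]) measurable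
  also have "\<dots> = radial_autoconv p x"
    unfolding radial_autoconv_def T(2) T(4)[symmetric] linear_diff[OF T(1), symmetric] ..
  finally show ?thesis ..
qed

text \<open>Integrating out the hyperplane orthogonal to \<open>b\<close> commutes with convolution,
  and on a radial function it amounts to n line integrals of the profile. A one-dimensional
  convolution remains on the axis.\<close>

lemma radial_autoconv_line_int:
  fixes b :: "'a::euclidean_space"
  assumes [measurable]: "p \<in> borel_measurable borel" "\<psi> \<in> borel_measurable borel"
    and b: "b \<in> Basis"
    and \<psi>: "\<And>x::'a. radial_autoconv p x = \<psi> ((norm x)\<^sup>2 / 2)"
  defines "n \<equiv> DIM('a) - 1"
  shows "(line_int ^^ n) \<psi> (r\<^sup>2 / 2) = (\<integral>\<^sup>+s. (line_int ^^ n) p (s\<^sup>2 / 2) * (line_int ^^ n) p ((r - s)\<^sup>2 / 2) \<partial>lborel)"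
proof -
  let ?J = "Basis - {b}" let ?M = "Pi\<^sub>M ?J (\<lambda>_. lborel :: real measure)"
  have card: "card ?J = n" unfolding n_def using b by simp
  interpret M: sigma_finite_measure ?M
    by (rule lborel_product.sigma_finite) auto
  interpret pair_sigma_finite lborel ?M ..
  define q where "q = (line_int ^^ n) p"
  have [measurable]: "q \<in> borel_measurable borel" unfolding q_def by (rule borel_measurable_line_int_funpow) measurable
  have "(line_int ^^ n) \<psi> (r\<^sup>2 / 2) = (\<integral>\<^sup>+a. \<psi> (r\<^sup>2 / 2 + (\<Sum>j\<in>?J. (a j - 0)\<^sup>2) / 2) \<partial>?M)"
    using nn_integral_PiM_line_int[of ?J \<psi> "r\<^sup>2 / 2" "\<lambda>_. 0"] by (simp add: card)
  also have "\<dots> = (\<integral>\<^sup>+a. radial_autoconv p (r *\<^sub>R b + (\<Sum>j\<in>?J. a j *\<^sub>R j)) \<partial>?M)"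
    unfolding \<psi> norm_slice0[OF b] by (simp add: add_divide_distrib)
  also have "\<dots> = (\<integral>\<^sup>+a. (\<integral>\<^sup>+y. p ((norm y)\<^sup>2 / 2) * p ((r - y \<bullet> b)\<^sup>2 / 2 + (\<Sum>j\<in>?J. (a j - y \<bullet> j)\<^sup>2) / 2) \<partial>lborel) \<partial>?M)"
    unfolding radial_autoconv_def norm_slice[OF b] by (simp add: add_divide_distrib)
  also have "\<dots> = (\<integral>\<^sup>+y. (\<integral>\<^sup>+a. p ((norm y)\<^sup>2 / 2) * p ((r - y \<bullet> b)\<^sup>2 / 2 + (\<Sum>j\<in>?J. (a j - y \<bullet> j)\<^sup>2) / 2) \<partial>?M) \<partial>lborel)"
    by (rule Fubini') measurable
  \<comment> \<open>For fixed y the hyperplane integral of the shifted factor sees y only through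
    its coordinate along \<open>b\<close>.\<close>
  also have "\<dots> = (\<integral>\<^sup>+y. p ((norm y)\<^sup>2 / 2) * q ((r - y \<bullet> b)\<^sup>2 / 2) \<partial>lborel)"
  proof (rule nn_integral_cong)
    fix y
    show "(\<integral>\<^sup>+a. p ((norm y)\<^sup>2 / 2) * p ((r - y \<bullet> b)\<^sup>2 / 2 + (\<Sum>j\<in>?J. (a j - y \<bullet> j)\<^sup>2) / 2) \<partial>?M)
      = p ((norm y)\<^sup>2 / 2) * q ((r - y \<bullet> b)\<^sup>2 / 2)"
    proof -
      have qq: "(\<integral>\<^sup>+a. p ((r - y \<bullet> b)\<^sup>2 / 2 + (\<Sum>j\<in>?J. (a j - y \<bullet> j)\<^sup>2) / 2) \<partial>?M) = q ((r - y \<bullet> b)\<^sup>2 / 2)"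
        using nn_integral_PiM_line_int[OF _ assms(1), of ?J "(r - y \<bullet> b)\<^sup>2 / 2" "\<lambda>j. y \<bullet> j"] by (simp add: card q_def)
      show ?thesis unfolding qq[symmetric] by (rule nn_integral_cmult) measurable
    qed
  qed
  also have "\<dots> = (\<integral>\<^sup>+a. \<integral>\<^sup>+s. p (s\<^sup>2 / 2 + (\<Sum>j\<in>?J. (a j)\<^sup>2) / 2) * q ((r - s)\<^sup>2 / 2) \<partial>lborel \<partial>?M)"
    by (subst nn_integral_lborel_slice[OF _ b]) (auto simp: norm_slice0[OF b] inner_slice[OF b] add_divide_distrib)
  also have "\<dots> = (\<integral>\<^sup>+s. \<integral>\<^sup>+a. p (s\<^sup>2 / 2 + (\<Sum>j\<in>?J. (a j)\<^sup>2) / 2) * q ((r - s)\<^sup>2 / 2) \<partial>?M \<partial>lborel)"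
    by (rule Fubini') measurable
  also have "\<dots> = (\<integral>\<^sup>+s. q (s\<^sup>2 / 2) * q ((r - s)\<^sup>2 / 2) \<partial>lborel)"
  proof (rule nn_integral_cong)
    fix s
    have qq: "(\<integral>\<^sup>+a. p (s\<^sup>2 / 2 + (\<Sum>j\<in>?J. (a j)\<^sup>2) / 2) \<partial>?M) = q (s\<^sup>2 / 2)"
      using nn_integral_PiM_line_int[OF _ assms(1), of ?J "s\<^sup>2 / 2" "\<lambda>_. 0"] by (simp add: card q_def)
    show "(\<integral>\<^sup>+a. p (s\<^sup>2 / 2 + (\<Sum>j\<in>?J. (a j)\<^sup>2) / 2) * q ((r - s)\<^sup>2 / 2) \<partial>?M) = q (s\<^sup>2 / 2) * q ((r - s)\<^sup>2 / 2)"
      unfolding qq[symmetric] by (rule nn_integral_multc) measurable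
  qed
  finally show ?thesis unfolding q_def .
qed

text \<open>Beta (1/2) a = sqrt pi Gamma a / Gamma (a + 1/2), so the product of the Beta factors
  telescopes to one Gamma quotient and the square roots of pi collect to pi^(n/2).\<close>

lemma line_int_funpow_pos_pow:
  assumes "\<delta> > -1"
  shows "(line_int ^^ n) (\<lambda>t. ennreal (pos_pow (1 - 2 * t) \<delta>)) t =
    ennreal (pi powr (real n / 2) * Gamma (\<delta> + 1) / Gamma (\<delta> + real n / 2 + 1) * pos_pow (1 - 2 * t) (\<delta> + real n / 2))"
proof (induction n arbitrary: t)
  case 0
  have "Gamma (\<delta> + 1) > 0" using assms by (intro Gamma_real_pos) simp
  then show ?case by simp
next
  case (Suc n)
  define A where "A = pi powr (real n / 2) * Gamma (\<delta> + 1) / Gamma (\<delta> + real n / 2 + 1)"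
  have pos: "Gamma (\<delta> + 1) > 0" "Gamma (\<delta> + real n / 2 + 1) > 0" "Gamma (\<delta> + real n / 2 + 1 + 1/2) > 0"
    using assms by (intro Gamma_real_pos; simp add: add_pos_nonneg)+
  have A: "A \<ge> 0" unfolding A_def using pos by simp
  have IH: "(line_int ^^ n) (\<lambda>t. ennreal (pos_pow (1 - 2 * t) \<delta>)) = (\<lambda>t. ennreal A * ennreal (pos_pow (1 - 2 * t) (\<delta> + real n / 2)))"
    unfolding Suc.IH[abs_def] A_def[symmetric] using A by (auto simp: ennreal_mult')
  have "(line_int ^^ Suc n) (\<lambda>t. ennreal (pos_pow (1 - 2 * t) \<delta>)) t
    = ennreal A * line_int (\<lambda>t. ennreal (pos_pow (1 - 2 * t) (\<delta> + real n / 2))) t"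
    by (simp add: IH line_int_cmult)
  also have "\<dots> = ennreal (A * (Beta (1/2) (\<delta> + real n / 2 + 1) * pos_pow (1 - 2 * t) (\<delta> + real n / 2 + 1/2)))"
    using assms A by (subst line_int_pos_pow) (auto simp: ennreal_mult')
  also have "A * Beta (1/2) (\<delta> + real n / 2 + 1) = pi powr (real (Suc n) / 2) * Gamma (\<delta> + 1) / Gamma (\<delta> + real (Suc n) / 2 + 1)"
  proof -
    have e1: "pi powr (real (Suc n) / 2) = pi powr (real n / 2) * sqrt pi"
      by (simp add: add_divide_distrib powr_add powr_half_sqrt)
    have e2: "\<delta> + real (Suc n) / 2 + 1 = 1/2 + (\<delta> + real n / 2 + 1)" by (simp add: add_divide_distrib)
    show ?thesis
      unfolding A_def Beta_def e1 e2 Gamma_one_half_real using pos(2) by simp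
  qed
  then have "A * (Beta (1/2) (\<delta> + real n / 2 + 1) * pos_pow (1 - 2 * t) (\<delta> + real n / 2 + 1/2)) =
     pi powr (real (Suc n) / 2) * Gamma (\<delta> + 1) / Gamma (\<delta> + real (Suc n) / 2 + 1) * pos_pow (1 - 2 * t) (\<delta> + real (Suc n) / 2)"
  proof -
    assume e: "A * Beta (1/2) (\<delta> + real n / 2 + 1) = pi powr (real (Suc n) / 2) * Gamma (\<delta> + 1) / Gamma (\<delta> + real (Suc n) / 2 + 1)"
    have "\<delta> + real n / 2 + 1/2 = \<delta> + real (Suc n) / 2" by (simp add: add_divide_distrib)
    then show ?thesis unfolding e[symmetric] by (simp only: mult.assoc)
  qed
  finally show ?case .
qed

section \<open>The density of the profile of an autoconvolution\<close>

text \<open>The inverse of u -> u^\<delta>, so that \<open>\<tau>\<close> < u^\<delta> becomes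
  \<open>level \<delta> \<tau>\<close> < u. For \<delta> = 0 the value 0 turns this into u > 0, in
  accordance with \<open>pos_pow\<close>; this is the case l = k of a ball indicator.\<close>

definition level :: "real \<Rightarrow> real \<Rightarrow> real" where
  "level \<delta> \<tau> = (if \<delta> = 0 then 0 else \<tau> powr (1 / \<delta>))"

lemma level_nonneg: "0 \<le> level \<delta> \<tau>"
  unfolding level_def by simp

lemma borel_measurable_level [measurable]: "level \<delta> \<in> borel_measurable borel"
  unfolding level_def[abs_def] by measurable

text \<open>u^\<delta> is the length of the set of heights below it, and u \<le> 1 keeps these
  heights in (0, 1). Products of powers thus become averages of products of indicators.\<close>

lemma layer_cake_pos_pow:
  assumes "0 \<le> \<delta>" "u \<le> 1"
  shows "ennreal (pos_pow u \<delta>) = (\<integral>\<^sup>+\<tau>. indicator {0<..<1} \<tau> * of_bool (level \<delta> \<tau> < u) \<partial>lborel)"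
proof (cases "u > 0")
  case False
  then have "\<not> level \<delta> \<tau> < u" for \<tau> using level_nonneg[of \<delta> \<tau>] by linarith
  then show ?thesis using False by (simp add: pos_pow_def)
next
  case True
  show ?thesis
  proof (cases "\<delta> = 0")
    case True
    then show ?thesis using \<open>u > 0\<close> by (simp add: pos_pow_def level_def)
  next
    case False
    then have d: "\<delta> > 0" using assms by simp
    have iff: "level \<delta> \<tau> < u \<longleftrightarrow> \<tau> < u powr \<delta>" if "\<tau> > 0" for \<tau>
    proof -
      have "\<tau> = (\<tau> powr (1 / \<delta>)) powr \<delta>" using d that by (simp add: powr_powr)
      then show ?thesis
        using d that True False unfolding level_def
        by (metis not_less powr_less_mono2 powr_mono2 less_imp_le powr_ge_zero)
    qed
    have "u powr \<delta> \<le> 1" using assms True powr_mono2[of \<delta> u 1] by simp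
    then have "indicator {0<..<1} \<tau> * of_bool (level \<delta> \<tau> < u) = (indicator {0<..<u powr \<delta>} \<tau> :: ennreal)" for \<tau>
      using iff[of \<tau>] by (auto simp: indicator_def)
    then show ?thesis using True by (simp add: pos_pow_def)
  qed
qed

lemma emeasure_lborel_Ioo_real: "emeasure lborel {l<..<u} = ennreal (u - l)"
  by (cases "l \<le> u") (simp_all add: ennreal_neg)

text \<open>Both sides measure the overlap of two intervals, which shrinks at unit rate while r runs
  from the difference to the sum of the half-widths.\<close>

lemma interval_conv:
  fixes h h' r :: real
  assumes "0 \<le> h" "0 \<le> h'" "0 \<le> r"
  shows "(\<integral>\<^sup>+s. of_bool (\<bar>s\<bar> < h) * of_bool (\<bar>r - s\<bar> < h') \<partial>lborel)
    = (\<integral>\<^sup>+s. indicator {r<..} s * of_bool (\<bar>h - h'\<bar> < s \<and> s < h + h') \<partial>lborel)"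
proof -
  have "(\<integral>\<^sup>+s. of_bool (\<bar>s\<bar> < h) * of_bool (\<bar>r - s\<bar> < h') \<partial>lborel)
    = (\<integral>\<^sup>+s. indicator {max (-h) (r - h')<..<min h (r + h')} s \<partial>lborel)"
    by (intro nn_integral_cong) (auto simp: indicator_def abs_less_iff)
  \<comment> \<open>\<open>ennreal\<close> cuts negative lengths to 0, so disjoint intervals need no
    case of their own.\<close>
  also have "\<dots> = ennreal (min h (r + h') - max (-h) (r - h'))"
    by (simp only: nn_integral_indicator emeasure_lborel_Ioo_real borel_open open_greaterThanLessThan sets_lborel)
  also have "\<dots> = ennreal (h + h' - max r \<bar>h - h'\<bar>)"
  proof -
    have "min h (r + h') - max (-h) (r - h') = h + h' - max r \<bar>h - h'\<bar>"
      using assms by (simp add: min_def max_def abs_real_def)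
    then show ?thesis by simp
  qed
  also have "\<dots> = (\<integral>\<^sup>+s. indicator {max r \<bar>h - h'\<bar><..<h + h'} s \<partial>lborel)"
    by (simp only: nn_integral_indicator emeasure_lborel_Ioo_real borel_open open_greaterThanLessThan sets_lborel)
  also have "\<dots> = (\<integral>\<^sup>+s. indicator {r<..} s * of_bool (\<bar>h - h'\<bar> < s \<and> s < h + h') \<partial>lborel)"
    by (intro nn_integral_cong) (auto simp: indicator_def)
  finally show ?thesis .
qed

text \<open>On a line parallel to the axis at squared distance \<open>A\<close>, the set where (1 -
  s^2 - A)_+^\<delta> exceeds a height \<open>\<tau>\<close> in (0, 1) is an interval around 0 with
  this half-length; \<open>max 0\<close> makes it empty when the line misses the superlevel
  ball.\<close>

definition half_width :: "real \<Rightarrow> real \<Rightarrow> real \<Rightarrow> real" where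
  "half_width \<delta> A \<tau> = sqrt (max 0 (1 - level \<delta> \<tau> - A))"

lemma half_width_nonneg: "0 \<le> half_width \<delta> A \<tau>"
  unfolding half_width_def by simp

lemma borel_measurable_half_width [measurable (raw)]:
  assumes [measurable]: "f \<in> borel_measurable M" "g \<in> borel_measurable M"
  shows "(\<lambda>x. half_width \<delta> (f x) (g x)) \<in> borel_measurable M"
  unfolding half_width_def by measurable

lemma half_width_iff: "\<bar>s\<bar> < half_width \<delta> A \<tau> \<longleftrightarrow> level \<delta> \<tau> < 1 - s\<^sup>2 - A"
proof -
  have "\<bar>s\<bar> < sqrt (max 0 (1 - level \<delta> \<tau> - A)) \<longleftrightarrow> s\<^sup>2 < max 0 (1 - level \<delta> \<tau> - A)"
    by (metis real_sqrt_abs real_sqrt_less_iff)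
  then show ?thesis unfolding half_width_def by (auto simp: less_max_iff_disj)
qed

text \<open>The rate at which the autoconvolution along such a line decreases in the offset s. A
  pair of levels counts when the two intervals overlap without one containing the other.\<close>

definition lens_density :: "real \<Rightarrow> real \<Rightarrow> real \<Rightarrow> ennreal" where
  "lens_density \<delta> A s = (\<integral>\<^sup>+\<tau>. \<integral>\<^sup>+\<tau>'. indicator {0<..<1} \<tau> * indicator {0<..<1} \<tau>' *
     of_bool (\<bar>half_width \<delta> A \<tau> - half_width \<delta> A \<tau>'\<bar> < s \<and> s < half_width \<delta> A \<tau> + half_width \<delta> A \<tau>') \<partial>lborel \<partial>lborel)"

lemma borel_measurable_lens_density [measurable (raw)]:
  assumes [measurable]: "f \<in> borel_measurable M" "g \<in> borel_measurable M"
  shows "(\<lambda>x. lens_density \<delta> (f x) (g x)) \<in> borel_measurable M"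
proof -
  have [measurable]: "(\<lambda>(A, s). lens_density \<delta> A s) \<in> borel_measurable (borel \<Otimes>\<^sub>M borel)"
    unfolding lens_density_def by measurable
  show ?thesis
    using measurable_compose[of "\<lambda>x. (f x, g x)" M "borel \<Otimes>\<^sub>M borel" "\<lambda>(A, s). lens_density \<delta> A s" borel] by simp
qed

lemma half_width_pos_imp: "0 < half_width \<delta> A \<tau> \<Longrightarrow> A < 1"
  using level_nonneg[of \<delta> \<tau>] unfolding half_width_def by (auto simp: max_def split: if_splits)

lemma half_width_le_1: "0 \<le> A \<Longrightarrow> half_width \<delta> A \<tau> \<le> 1"
  using level_nonneg[of \<delta> \<tau>] unfolding half_width_def by (auto simp: max_def)

text \<open>The levels range over a unit square, whence the bound 1; lines with A \<ge> 1 miss the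
  open unit ball, whence 0.\<close>

lemma lens_density_le: "lens_density \<delta> A s \<le> of_bool (A < 1)"
proof -
  have "lens_density \<delta> A s \<le> (\<integral>\<^sup>+(\<tau>::real). \<integral>\<^sup>+(\<tau>'::real). indicator {0<..<1} \<tau> * indicator {0<..<1} \<tau>' * of_bool (A < 1) \<partial>lborel \<partial>lborel)"
  proof -
    have "of_bool (\<bar>half_width \<delta> A \<tau> - half_width \<delta> A \<tau>'\<bar> < s \<and> s < half_width \<delta> A \<tau> + half_width \<delta> A \<tau>') \<le> (of_bool (A < 1) :: ennreal)" for \<tau> \<tau>'
    proof (cases "\<bar>half_width \<delta> A \<tau> - half_width \<delta> A \<tau>'\<bar> < s \<and> s < half_width \<delta> A \<tau> + half_width \<delta> A \<tau>'")
      case True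
      then have "0 < half_width \<delta> A \<tau>" by linarith
      then show ?thesis using half_width_pos_imp by auto
    next
      case False
      then show ?thesis by (simp only: of_bool_eq zero_le)
    qed
    note bound = mult_left_mono[OF this zero_le]
    show ?thesis unfolding lens_density_def by (rule nn_integral_mono, rule nn_integral_mono, rule bound)
  qed
  also have "\<dots> = of_bool (A < 1)" by (simp add: nn_integral_multc nn_integral_cmult)
  finally show ?thesis .
qed

lemma lens_density_eq_0: "0 \<le> A \<Longrightarrow> 2 \<le> s \<Longrightarrow> lens_density \<delta> A s = 0"
proof -
  assume A: "0 \<le> A" and s: "2 \<le> s"
  have "\<not> s < half_width \<delta> A \<tau> + half_width \<delta> A \<tau>'" for \<tau> \<tau>'
    using half_width_le_1[OF A, of \<delta> \<tau>] half_width_le_1[OF A, of \<delta> \<tau>'] s by linarith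
  then show ?thesis unfolding lens_density_def by simp
qed

text \<open>Layer cake in both factors gives an average, over pairs of levels, of overlaps of two
  intervals. \<open>interval_conv\<close> writes each overlap as a tail integral, and the averaging
  is then pulled back inside.\<close>

lemma pos_pow_line_conv:
  assumes "0 \<le> \<delta>" "0 \<le> A" "0 \<le> r"
  shows "(\<integral>\<^sup>+s. ennreal (pos_pow (1 - s\<^sup>2 - A) \<delta>) * ennreal (pos_pow (1 - (r - s)\<^sup>2 - A) \<delta>) \<partial>lborel)
    = (\<integral>\<^sup>+s. indicator {r<..} s * lens_density \<delta> A s \<partial>lborel)"
proof -
  let ?i = "\<lambda>\<tau>. indicator {0<..<1::real} \<tau> :: ennreal"
  let ?h = "half_width \<delta> A"
  have le: "1 - u\<^sup>2 - A \<le> 1" for u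
    using assms(2) zero_le_power2[of u] by linarith
  have cake: "ennreal (pos_pow (1 - s\<^sup>2 - A) \<delta>) = (\<integral>\<^sup>+\<tau>. ?i \<tau> * of_bool (\<bar>s\<bar> < ?h \<tau>) \<partial>lborel)" for s
    unfolding half_width_iff using assms(1) le by (rule layer_cake_pos_pow)
  have "(\<integral>\<^sup>+s. ennreal (pos_pow (1 - s\<^sup>2 - A) \<delta>) * ennreal (pos_pow (1 - (r - s)\<^sup>2 - A) \<delta>) \<partial>lborel)
    = (\<integral>\<^sup>+s. \<integral>\<^sup>+\<tau>. \<integral>\<^sup>+\<tau>'. (?i \<tau> * of_bool (\<bar>s\<bar> < ?h \<tau>)) * (?i \<tau>' * of_bool (\<bar>r - s\<bar> < ?h \<tau>')) \<partial>lborel \<partial>lborel \<partial>lborel)"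
    unfolding cake by (simp add: nn_integral_cmult nn_integral_multc)
  also have "\<dots> = (\<integral>\<^sup>+\<tau>. \<integral>\<^sup>+s. \<integral>\<^sup>+\<tau>'. (?i \<tau> * of_bool (\<bar>s\<bar> < ?h \<tau>)) * (?i \<tau>' * of_bool (\<bar>r - s\<bar> < ?h \<tau>')) \<partial>lborel \<partial>lborel \<partial>lborel)"
    by (rule lborel_pair.Fubini') measurable
  also have "\<dots> = (\<integral>\<^sup>+\<tau>. \<integral>\<^sup>+\<tau>'. \<integral>\<^sup>+s. (?i \<tau> * of_bool (\<bar>s\<bar> < ?h \<tau>)) * (?i \<tau>' * of_bool (\<bar>r - s\<bar> < ?h \<tau>')) \<partial>lborel \<partial>lborel \<partial>lborel)"
    by (rule nn_integral_cong, rule lborel_pair.Fubini') measurable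
  also have "\<dots> = (\<integral>\<^sup>+\<tau>. \<integral>\<^sup>+\<tau>'. \<integral>\<^sup>+s. indicator {r<..} s * (?i \<tau> * ?i \<tau>' * of_bool (\<bar>?h \<tau> - ?h \<tau>'\<bar> < s \<and> s < ?h \<tau> + ?h \<tau>')) \<partial>lborel \<partial>lborel \<partial>lborel)"
  proof (rule nn_integral_cong, rule nn_integral_cong)
    fix \<tau> \<tau>'
    have "(\<integral>\<^sup>+s. (?i \<tau> * of_bool (\<bar>s\<bar> < ?h \<tau>)) * (?i \<tau>' * of_bool (\<bar>r - s\<bar> < ?h \<tau>')) \<partial>lborel)
      = (\<integral>\<^sup>+s. (?i \<tau> * ?i \<tau>') * (of_bool (\<bar>s\<bar> < ?h \<tau>) * of_bool (\<bar>r - s\<bar> < ?h \<tau>')) \<partial>lborel)"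
      by (simp add: ac_simps)
    also have "\<dots> = (?i \<tau> * ?i \<tau>') * (\<integral>\<^sup>+s. of_bool (\<bar>s\<bar> < ?h \<tau>) * of_bool (\<bar>r - s\<bar> < ?h \<tau>') \<partial>lborel)"
      by (rule nn_integral_cmult) measurable
    also have "\<dots> = (?i \<tau> * ?i \<tau>') * (\<integral>\<^sup>+s. indicator {r<..} s * of_bool (\<bar>?h \<tau> - ?h \<tau>'\<bar> < s \<and> s < ?h \<tau> + ?h \<tau>') \<partial>lborel)"
      using assms by (subst interval_conv) (auto simp: half_width_nonneg)
    also have "\<dots> = (\<integral>\<^sup>+s. (?i \<tau> * ?i \<tau>') * (indicator {r<..} s * of_bool (\<bar>?h \<tau> - ?h \<tau>'\<bar> < s \<and> s < ?h \<tau> + ?h \<tau>')) \<partial>lborel)"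
      by (rule nn_integral_cmult[symmetric]) measurable
    finally show "(\<integral>\<^sup>+s. (?i \<tau> * of_bool (\<bar>s\<bar> < ?h \<tau>)) * (?i \<tau>' * of_bool (\<bar>r - s\<bar> < ?h \<tau>')) \<partial>lborel)
      = (\<integral>\<^sup>+s. indicator {r<..} s * (?i \<tau> * ?i \<tau>' * of_bool (\<bar>?h \<tau> - ?h \<tau>'\<bar> < s \<and> s < ?h \<tau> + ?h \<tau>')) \<partial>lborel)"
      by (simp add: ac_simps)
  qed
  also have "\<dots> = (\<integral>\<^sup>+\<tau>. \<integral>\<^sup>+s. \<integral>\<^sup>+\<tau>'. indicator {r<..} s * (?i \<tau> * ?i \<tau>' * of_bool (\<bar>?h \<tau> - ?h \<tau>'\<bar> < s \<and> s < ?h \<tau> + ?h \<tau>')) \<partial>lborel \<partial>lborel \<partial>lborel)"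
    by (rule nn_integral_cong, rule lborel_pair.Fubini') measurable
  also have "\<dots> = (\<integral>\<^sup>+s. \<integral>\<^sup>+\<tau>. \<integral>\<^sup>+\<tau>'. indicator {r<..} s * (?i \<tau> * ?i \<tau>' * of_bool (\<bar>?h \<tau> - ?h \<tau>'\<bar> < s \<and> s < ?h \<tau> + ?h \<tau>')) \<partial>lborel \<partial>lborel \<partial>lborel)"
    by (rule lborel_pair.Fubini') measurable
  also have "\<dots> = (\<integral>\<^sup>+s. indicator {r<..} s * lens_density \<delta> A s \<partial>lborel)"
    unfolding lens_density_def by (simp add: nn_integral_cmult)
  finally show ?thesis .
qed

text \<open>The line densities are integrated over all lines parallel to the axis. Only lines
  through the unit ball contribute and these fit into a cube of side 2, hence the bound; the 2 from
  which on \<open>\<theta>\<close> vanishes is the sum of the two radii.\<close>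

lemma radial_autoconv_density:
  fixes b :: "'a::euclidean_space"
  assumes b: "b \<in> Basis" and \<delta>: "0 \<le> \<delta>"
  obtains \<theta> B where "\<theta> \<in> borel_measurable borel" "\<And>s. 0 \<le> \<theta> s" "\<And>s. \<theta> s \<le> B" "\<And>s. 2 \<le> s \<Longrightarrow> \<theta> s = 0"
    "\<And>r. 0 \<le> r \<Longrightarrow> radial_autoconv (\<lambda>t. ennreal (pos_pow (1 - 2 * t) \<delta>)) (r *\<^sub>R b)
       = (\<integral>\<^sup>+s. indicator {r<..} s * ennreal (\<theta> s) \<partial>lborel)"
proof -
  let ?J = "Basis - {b}" let ?M = "Pi\<^sub>M ?J (\<lambda>_. lborel :: real measure)"
  interpret M: sigma_finite_measure ?M
    by (rule lborel_product.sigma_finite) auto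
  interpret pair_sigma_finite lborel ?M ..
  let ?A = "\<lambda>a. \<Sum>j\<in>?J. (a j)\<^sup>2"
  have [measurable]: "?A \<in> borel_measurable ?M" by measurable
  define \<Theta> where "\<Theta> s = (\<integral>\<^sup>+a. lens_density \<delta> (?A a) s \<partial>?M)" for s
  have [measurable]: "\<Theta> \<in> borel_measurable borel" unfolding \<Theta>_def by measurable
  have bound: "\<Theta> s \<le> ennreal (2 ^ card ?J)" for s
  proof -
    have "\<Theta> s \<le> (\<integral>\<^sup>+a. (\<Prod>j\<in>?J. indicator {-1<..<1} (a j)) \<partial>?M)"
      unfolding \<Theta>_def
    proof (intro nn_integral_mono order_trans[OF lens_density_le])
      fix a :: "'a \<Rightarrow> real"
      show "of_bool (?A a < 1) \<le> (\<Prod>j\<in>?J. indicator {-1<..<1} (a j) :: ennreal)"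
      proof (cases "?A a < 1")
        case True
        have "a j \<in> {-1<..<1}" if "j \<in> ?J" for j
        proof -
          have "(a j)\<^sup>2 \<le> ?A a" using that by (intro member_le_sum) auto
          then have "\<bar>a j\<bar> < 1" using True abs_square_less_1[of "a j"] by linarith
          then show ?thesis by (simp add: abs_less_iff)
        qed
        then show ?thesis by (simp add: indicator_def)
      qed simp
    qed
    also have "\<dots> = (\<Prod>j\<in>?J. \<integral>\<^sup>+s. indicator {-1<..<1} (s::real) \<partial>lborel)"
      by (rule lborel_product.product_nn_integral_prod) auto
    also have "\<dots> = ennreal (2 ^ card ?J)" by (simp flip: ennreal_power)
    finally show ?thesis .
  qed
  have zero: "\<Theta> s = 0" if "2 \<le> s" for s
    unfolding \<Theta>_def using lens_density_eq_0[OF _ that] by (simp add: sum_nonneg)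
  define \<theta> where "\<theta> s = enn2real (\<Theta> s)" for s
  have [measurable]: "\<theta> \<in> borel_measurable borel" unfolding \<theta>_def by measurable
  have \<theta>: "ennreal (\<theta> s) = \<Theta> s" for s
    unfolding \<theta>_def using le_less_trans[OF bound[of s] ennreal_less_top] by simp
  have rep: "radial_autoconv (\<lambda>t. ennreal (pos_pow (1 - 2 * t) \<delta>)) (r *\<^sub>R b)
       = (\<integral>\<^sup>+s. indicator {r<..} s * ennreal (\<theta> s) \<partial>lborel)" if "0 \<le> r" for r
  proof -
    have bb: "r *\<^sub>R b - (s *\<^sub>R b + v) = - ((s - r) *\<^sub>R b + v)" for s v by (simp add: algebra_simps)
    have "radial_autoconv (\<lambda>t. ennreal (pos_pow (1 - 2 * t) \<delta>)) (r *\<^sub>R b)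
      = (\<integral>\<^sup>+y. ennreal (pos_pow (1 - (norm y)\<^sup>2) \<delta>) * ennreal (pos_pow (1 - (norm (r *\<^sub>R b - y))\<^sup>2) \<delta>) \<partial>lborel)"
      unfolding radial_autoconv_def by simp
    also have "\<dots> = (\<integral>\<^sup>+a. \<integral>\<^sup>+s. ennreal (pos_pow (1 - s\<^sup>2 - ?A a) \<delta>) * ennreal (pos_pow (1 - (r - s)\<^sup>2 - ?A a) \<delta>) \<partial>lborel \<partial>?M)"
      by (subst nn_integral_lborel_slice[OF _ b])
        (auto simp: bb norm_slice0[OF b] diff_diff_eq power2_commute simp del: minus_add_distrib)
    also have "\<dots> = (\<integral>\<^sup>+a. \<integral>\<^sup>+s. indicator {r<..} s * lens_density \<delta> (?A a) s \<partial>lborel \<partial>?M)"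
      by (rule nn_integral_cong, intro pos_pow_line_conv \<delta> that sum_nonneg) auto
    also have "\<dots> = (\<integral>\<^sup>+s. \<integral>\<^sup>+a. indicator {r<..} s * lens_density \<delta> (?A a) s \<partial>?M \<partial>lborel)"
      by (rule Fubini') measurable
    also have "\<dots> = (\<integral>\<^sup>+s. indicator {r<..} s * ennreal (\<theta> s) \<partial>lborel)"
      unfolding \<theta> \<Theta>_def by (rule nn_integral_cong, rule nn_integral_cmult) measurable
    finally show ?thesis .
  qed
  have "\<theta> s \<le> 2 ^ card ?J" for s
    using bound[of s] unfolding \<theta>[symmetric] by (simp add: ennreal_le_iff)
  then show ?thesis using zero rep by (intro that[of \<theta> "2 ^ card ?J"]) (auto simp: \<theta>_def)
qed

section \<open>Half-order derivatives of tails\<close>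

text \<open>\<open>\<theta>\<close> stands for minus the derivative of the profile r -> (P * P)(r
  b), up to a constant. Boundedness is all the regularity that is kept.\<close>

locale tail_density =
  fixes \<theta> :: "real \<Rightarrow> real" and B :: real
  assumes density_measurable [measurable]: "\<theta> \<in> borel_measurable borel"
    and density_nonneg: "0 \<le> \<theta> s"
    and density_le: "\<theta> s \<le> B"
    and density_zero: "2 \<le> s \<Longrightarrow> \<theta> s = 0"
begin

definition tail :: "real \<Rightarrow> real" where
  "tail r = (\<integral>s. indicator {r<..} s * \<theta> s \<partial>lborel)"

definition ker :: "real \<Rightarrow> real \<Rightarrow> real" where
  "ker x s = indicator {sqrt (2 * x)<..} s * (s\<^sup>2 - 2 * x) powr (-1/2)"

text \<open>Minus the formal derivative of \<open>root_mean\<close>, from differentiating sqrt (s^2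
  - 2 t) under the integral. For x > 0 the singularity of the kernel at s = sqrt (2 x) is
  integrable, so a bounded \<open>\<theta>\<close> suffices; at x = 0 the kernel is 1 / s and the
  integral may diverge.\<close>

definition chi :: "real \<Rightarrow> real" where
  "chi x = (\<integral>s. 2 * \<theta> s * ker x s \<partial>lborel)"

text \<open>The closed form of one line integral of the tail in f-form, as
  \<open>line_int_tail\<close> shows.\<close>

definition root_mean :: "real \<Rightarrow> real" where
  "root_mean t = (\<integral>s. 2 * \<theta> s * (indicator {sqrt (2 * t)<..} s * sqrt (s\<^sup>2 - 2 * t)) \<partial>lborel)"

lemma bound_nonneg: "0 \<le> B"
  using density_nonneg[of 0] density_le[of 0] by simp

lemma borel_measurable_ker [measurable]: "ker x \<in> borel_measurable borel"
  unfolding ker_def by measurable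

lemma ker_nonneg: "0 \<le> ker x s"
  unfolding ker_def by simp

lemma integrable_density_mult:
  assumes [measurable]: "f \<in> borel_measurable borel" and "0 \<le> r" and "0 \<le> C" and f: "\<And>s. r < s \<Longrightarrow> s < 2 \<Longrightarrow> \<bar>f s\<bar> \<le> C"
  shows "integrable lborel (\<lambda>s. \<theta> s * (indicator {r<..} s * f s))"
proof (rule Bochner_Integration.integrable_bound)
  show "integrable lborel (\<lambda>s. B * C * indicator {0..2::real} s)" by simp
  show "AE s in lborel. norm (\<theta> s * (indicator {r<..} s * f s)) \<le> norm (B * C * indicator {0..2::real} s)"
  proof (rule AE_I2)
    fix s :: real
    consider "s \<le> r" | "s \<ge> 2" | "r < s" "s < 2" by linarith
    then show "norm (\<theta> s * (indicator {r<..} s * f s)) \<le> norm (B * C * indicator {0..2::real} s)"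
    proof cases
      case 3
      have "\<bar>\<theta> s * f s\<bar> \<le> B * C"
        unfolding abs_mult using density_nonneg[of s] density_le[of s] f[OF 3] bound_nonneg assms(3)
        by (intro mult_mono) auto
      then show ?thesis using 3 assms bound_nonneg by (auto simp: indicator_def)
    qed (auto simp: density_zero)
  qed
qed measurable

lemma tail_nn: "0 \<le> r \<Longrightarrow> (\<integral>\<^sup>+s. indicator {r<..} s * ennreal (\<theta> s) \<partial>lborel) = ennreal (tail r)"
proof -
  assume "0 \<le> r"
  then have "integrable lborel (\<lambda>s. indicator {r<..} s * \<theta> s)"
    using integrable_density_mult[of "\<lambda>_. 1" r 1] by (simp add: mult.commute)
  then have "(\<integral>\<^sup>+s. ennreal (indicator {r<..} s * \<theta> s) \<partial>lborel) = ennreal (tail r)"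
    unfolding tail_def using density_nonneg by (intro nn_integral_eq_integral) auto
  moreover have "ennreal (indicator {r<..} s * \<theta> s) = indicator {r<..} s * ennreal (\<theta> s)" for s
    by (simp add: indicator_def)
  ultimately show ?thesis by simp
qed

lemma tail_nonneg: "0 \<le> tail r"
  unfolding tail_def using density_nonneg by simp

lemma tail_zero: "2 \<le> r \<Longrightarrow> tail r = 0"
proof -
  assume "2 \<le> r"
  then have "indicator {r<..} s * \<theta> s = 0" for s using density_zero[of s] by (auto simp: indicator_def)
  then show ?thesis unfolding tail_def by (intro integral_eq_zero_AE) simp
qed

lemma root_mean_zero: "2 \<le> t \<Longrightarrow> root_mean t = 0"
proof -
  assume t: "2 \<le> t"
  have "2 = sqrt (2\<^sup>2)" by simp
  also have "\<dots> \<le> sqrt (2 * t)" using t by (intro real_sqrt_le_mono) simp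
  finally have "2 * \<theta> s * (indicator {sqrt (2 * t)<..} s * sqrt (s\<^sup>2 - 2 * t)) = 0" for s
    using density_zero[of s] by (auto simp: indicator_def)
  then show ?thesis unfolding root_mean_def by (intro integral_eq_zero_AE) simp
qed

lemma chi_nonneg: "0 \<le> chi x"
  unfolding chi_def using density_nonneg ker_nonneg by (intro Bochner_Integration.integral_nonneg) auto

lemma root_mean_nonneg: "0 \<le> root_mean t"
  unfolding root_mean_def
proof (rule Bochner_Integration.integral_nonneg)
  fix s
  have "0 \<le> indicator {sqrt (2 * t)<..} s * sqrt (s\<^sup>2 - 2 * t)"
  proof (cases "sqrt (2 * t) < s")
    case True
    then have "2 * t \<le> s\<^sup>2" using sqrt_le_D[of "2 * t" s] by simp
    then show ?thesis by simp
  qed simp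
  then show "0 \<le> 2 * \<theta> s * (indicator {sqrt (2 * t)<..} s * sqrt (s\<^sup>2 - 2 * t))"
    using density_nonneg[of s] by simp
qed

text \<open>The weight s turns the kernel into the derivative of sqrt (s^2 - 2 x).\<close>

lemma ker_integral:
  assumes x: "0 < x" and R: "sqrt (2 * x) \<le> R"
  shows "has_bochner_integral lborel (\<lambda>s. indicator {..R} s * (s * ker x s)) (sqrt (R\<^sup>2 - 2 * x))"
proof -
  let ?f = "\<lambda>s. s * (s\<^sup>2 - 2 * x) powr (-1/2)"
  let ?a = "sqrt (2 * x)"
  have a: "?a > 0" "?a\<^sup>2 = 2 * x" using x by auto
  have "(?f has_integral (sqrt (R\<^sup>2 - 2 * x) - sqrt (?a\<^sup>2 - 2 * x))) {?a..R}"
  \<comment> \<open>The antiderivative is continuous up to the left end, but its derivative blows up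
    there, so differentiability is used only inside.\<close>
  proof (rule fundamental_theorem_of_calculus_interior[OF R])
    show "continuous_on {?a..R} (\<lambda>s. sqrt (s\<^sup>2 - 2 * x))" by (intro continuous_intros)
    fix s assume s: "s \<in> {?a<..<R}"
    then have "?a\<^sup>2 < s\<^sup>2" using a by (intro power_strict_mono) auto
    then have "s\<^sup>2 - 2 * x > 0" using a by simp
    then show "((\<lambda>s. sqrt (s\<^sup>2 - 2 * x)) has_vector_derivative ?f s) (at s)"
      unfolding has_real_derivative_iff_has_vector_derivative[symmetric]
      by (auto intro!: derivative_eq_intros simp: powr_minus powr_half_sqrt field_simps)
  qed
  then have "(?f has_integral sqrt (R\<^sup>2 - 2 * x)) {?a..R}" using a by simp
  moreover have fpos: "0 \<le> ?f s" if "s \<in> {?a..R}" for s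
  proof -
    have "0 \<le> s" using that a(1) by (meson atLeastAtMost_iff less_imp_le order_trans)
    then show ?thesis by simp
  qed
  ultimately have nn: "(\<integral>\<^sup>+s. ennreal (indicator {?a..R} s * ?f s) \<partial>lborel) = ennreal (sqrt (R\<^sup>2 - 2 * x))"
    by (intro nn_integral_has_integral_lebesgue) auto
  have eq: "indicator {?a..R} s * ?f s = indicator {..R} s * (s * ker x s)" for s
  proof (cases "s = ?a")
    case True
    then show ?thesis using a by (simp add: ker_def)
  qed (auto simp: ker_def indicator_def)
  have R2: "2 * x \<le> R\<^sup>2" using R by (rule sqrt_le_D)
  have nonneg: "0 \<le> indicator {?a..R} s * ?f s" for s using fpos[of s] by (simp add: indicator_def)
  have "has_bochner_integral lborel (\<lambda>s. indicator {?a..R} s * ?f s) (sqrt (R\<^sup>2 - 2 * x))"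
    using nn R2 nonneg by (intro has_bochner_integral_nn_integral) auto
  then show ?thesis unfolding eq .
qed

text \<open>On the support s exceeds sqrt (2 x), so inserting the weight that makes the kernel
  explicitly integrable costs only a factor 1 / sqrt (2 x).\<close>

lemma ker_le: "0 < x \<Longrightarrow> ker x s \<le> (s * ker x s) / sqrt (2 * x)"
proof -
  assume "0 < x"
  have "ker x s * sqrt (2 * x) \<le> s * ker x s"
    by (cases "sqrt (2 * x) < s") (auto simp: ker_def mult.commute[of _ "sqrt _"] intro!: mult_right_mono)
  then show ?thesis using \<open>0 < x\<close> by (simp add: pos_le_divide_eq)
qed

lemma integrable_ker:
  assumes x: "0 < x"
  shows "integrable lborel (\<lambda>s. 2 * \<theta> s * ker x s)"
proof (rule Bochner_Integration.integrable_bound)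
  let ?R = "max 2 (sqrt (2 * x))"
  show "integrable lborel (\<lambda>s. 2 * B / sqrt (2 * x) * (indicator {..?R} s * (s * ker x s)))"
    using ker_integral[OF x, of ?R] by (intro integrable_mult_right) (auto simp: has_bochner_integral_iff)
  show "AE s in lborel. norm (2 * \<theta> s * ker x s) \<le> norm (2 * B / sqrt (2 * x) * (indicator {..?R} s * (s * ker x s)))"
  proof (rule AE_I2)
    fix s
    show "norm (2 * \<theta> s * ker x s) \<le> norm (2 * B / sqrt (2 * x) * (indicator {..?R} s * (s * ker x s)))"
    proof (cases "s \<le> ?R")
      case True
      have "\<theta> s * ker x s \<le> B * ((s * ker x s) / sqrt (2 * x))"
        using density_nonneg density_le ker_nonneg ker_le[OF x] bound_nonneg by (intro mult_mono) auto
      then have "2 * \<theta> s * ker x s \<le> 2 * B / sqrt (2 * x) * (indicator {..?R} s * (s * ker x s))"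
        using True by (simp add: mult.assoc)
      moreover have "0 \<le> 2 * \<theta> s * ker x s" using density_nonneg[of s] ker_nonneg[of x s] by simp
      ultimately show ?thesis unfolding real_norm_def by linarith
    next
      case False
      then show ?thesis using density_zero[of s] by simp
    qed
  qed
qed measurable

lemma chi_nn:
  assumes x: "0 < x"
  shows "ennreal (chi x) = (\<integral>\<^sup>+s. ennreal (2 * \<theta> s * ker x s) \<partial>lborel)"
  unfolding chi_def using integrable_ker[OF x] density_nonneg ker_nonneg
  by (intro nn_integral_eq_integral[symmetric]) auto

text \<open>The kernel difference has a known sign on each side of sqrt (2 y): below it only the
  kernel of x is present, above it the kernel of y is the larger. The weighted integral of its
  modulus is therefore explicit and at most 2 sqrt (2 y - 2 x).\<close>

lemma chi_modulus:
  assumes x: "0 < x" and xy: "x < y"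
  shows "\<bar>chi x - chi y\<bar> \<le> 4 * B / sqrt (2 * x) * sqrt (2 * y - 2 * x)"
proof -
  have y: "0 < y" using assms by simp
  define R where "R = max 2 (sqrt (2 * y))"
  have sxy: "sqrt (2 * x) \<le> sqrt (2 * y)" using xy by simp
  have R: "2 \<le> R" "sqrt (2 * y) \<le> R" "sqrt (2 * x) \<le> R" unfolding R_def using sxy by (auto simp: le_max_iff_disj)
  \<comment> \<open>For s \<le> R this is s times the modulus of the kernel difference, in terms
    that \<open>ker_integral\<close> evaluates; the part below sqrt (2 y) is counted twice because
    the last term removes it once.\<close>
  let ?g = "\<lambda>s. 2 * (indicator {..sqrt (2 * y)} s * (s * ker x s)) + indicator {..R} s * (s * ker y s) - indicator {..R} s * (s * ker x s)"
  have g: "has_bochner_integral lborel ?g (2 * sqrt ((sqrt (2 * y))\<^sup>2 - 2 * x) + sqrt (R\<^sup>2 - 2 * y) - sqrt (R\<^sup>2 - 2 * x))"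
    by (intro has_bochner_integral_diff has_bochner_integral_add has_bochner_integral_mult_right ker_integral x y R sxy)
  have pt: "\<bar>2 * \<theta> s * ker x s - 2 * \<theta> s * ker y s\<bar> \<le> 2 * B / sqrt (2 * x) * ?g s" for s
  proof (cases "s \<le> R")
    case False
    then have "\<theta> s = 0" "\<not> s \<le> sqrt (2 * y)" using R density_zero[of s] by auto
    then show ?thesis using False by simp
  next
    case True
    have mono: "ker x s \<le> ker y s" if "sqrt (2 * y) < s"
    proof -
      have "2 * y < s\<^sup>2" using that y by (metis real_less_rsqrt real_sqrt_less_iff real_sqrt_abs abs_of_pos less_trans real_sqrt_gt_0_iff zero_less_mult_iff zero_less_numeral)
      moreover have "sqrt (2 * x) < s" using that sxy by linarith
      ultimately show ?thesis unfolding ker_def using that xy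
        by (simp add: powr_mono2')
    qed
    have eq: "?g s = s * \<bar>ker x s - ker y s\<bar>"
    proof (cases "sqrt (2 * y) < s")
      case True
      then show ?thesis using mono \<open>s \<le> R\<close> by (simp add: algebra_simps)
    next
      case False
      then have "ker y s = 0" by (simp add: ker_def)
      then show ?thesis using False \<open>s \<le> R\<close> ker_nonneg[of x s] by simp
    qed
    have le: "\<bar>ker x s - ker y s\<bar> \<le> (s * \<bar>ker x s - ker y s\<bar>) / sqrt (2 * x)"
    proof (cases "sqrt (2 * x) < s")
      case True
      have "\<bar>ker x s - ker y s\<bar> * sqrt (2 * x) \<le> s * \<bar>ker x s - ker y s\<bar>"
        using mult_right_mono[of "sqrt (2 * x)" s "\<bar>ker x s - ker y s\<bar>"] True by (simp add: mult.commute)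
      then show ?thesis using x by (simp add: pos_le_divide_eq)
    next
      case False
      then have "\<not> sqrt (2 * y) < s" using sxy by linarith
      then have "ker x s = 0" "ker y s = 0" using False by (simp_all add: ker_def)
      then show ?thesis by simp
    qed
    have "\<bar>2 * \<theta> s * ker x s - 2 * \<theta> s * ker y s\<bar> = 2 * (\<theta> s * \<bar>ker x s - ker y s\<bar>)"
      using density_nonneg[of s] by (simp add: abs_mult flip: right_diff_distrib)
    also have "\<dots> \<le> 2 * (B * ((s * \<bar>ker x s - ker y s\<bar>) / sqrt (2 * x)))"
      using density_nonneg density_le le bound_nonneg by (intro mult_left_mono mult_mono) auto
    finally show ?thesis unfolding eq by simp
  qed
  have eq: "chi x - chi y = (\<integral>s. 2 * \<theta> s * ker x s - 2 * \<theta> s * ker y s \<partial>lborel)"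
    unfolding chi_def using integrable_ker x y by simp
  have le: "\<bar>chi x - chi y\<bar> \<le> (\<integral>s. 2 * B / sqrt (2 * x) * ?g s \<partial>lborel)"
    unfolding eq
  proof (rule order_trans[OF integral_abs_bound], rule integral_mono)
    show "integrable lborel (\<lambda>s. 2 * B / sqrt (2 * x) * ?g s)"
      by (rule integrable_mult_right) (rule g[unfolded has_bochner_integral_iff, THEN conjunct1])
    show "integrable lborel (\<lambda>s. \<bar>2 * \<theta> s * ker x s - 2 * \<theta> s * ker y s\<bar>)"
      using integrable_ker[OF x] integrable_ker[OF y] by simp
  qed (rule pt)
  also have "(\<integral>s. 2 * B / sqrt (2 * x) * ?g s \<partial>lborel) = 2 * B / sqrt (2 * x) * (2 * sqrt ((sqrt (2 * y))\<^sup>2 - 2 * x) + sqrt (R\<^sup>2 - 2 * y) - sqrt (R\<^sup>2 - 2 * x))"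
    by (rule has_bochner_integral_integral_eq[OF has_bochner_integral_mult_right[OF g]])
  also have "\<dots> \<le> 2 * B / sqrt (2 * x) * (2 * sqrt (2 * y - 2 * x))"
    using bound_nonneg x y xy by (intro mult_left_mono) auto
  finally show ?thesis by simp
qed

lemma continuous_on_chi: "continuous_on {0<..} chi"
proof (rule continuous_at_imp_continuous_on, rule ballI)
  fix x :: real assume "x \<in> {0<..}"
  then have x: "x > 0" by simp
  have "((\<lambda>y. \<bar>chi y - chi x\<bar>) \<longlongrightarrow> 0) (at x)"
  proof (rule tendsto_sandwich[of "\<lambda>_. 0"])
    have "eventually (\<lambda>y. y > x / 2) (at x)"
      using order_tendstoD(1)[OF tendsto_ident_at, of "x/2" x UNIV] x by simp
    then show "eventually (\<lambda>y. \<bar>chi y - chi x\<bar> \<le> 4 * B / sqrt x * sqrt (2 * \<bar>y - x\<bar>)) (at x)"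
    proof eventually_elim
      case (elim y)
      define a b where "a = min x y" "b = max x y"
      have a: "x / 2 \<le> a" "0 < a" using x elim unfolding a_b_def by auto
      show ?case
      proof (cases "x = y")
        case False
        then have "a < b" unfolding a_b_def by auto
        then have "\<bar>chi a - chi b\<bar> \<le> 4 * B / sqrt (2 * a) * sqrt (2 * b - 2 * a)"
          by (rule chi_modulus[OF a(2)])
        also have "\<dots> \<le> 4 * B / sqrt x * sqrt (2 * b - 2 * a)"
          using a bound_nonneg x \<open>a < b\<close> by (intro mult_right_mono divide_left_mono) auto
        also have "2 * b - 2 * a = 2 * \<bar>y - x\<bar>" unfolding a_b_def by (simp add: min_def max_def)
        also have "\<bar>chi a - chi b\<bar> = \<bar>chi y - chi x\<bar>" unfolding a_b_def by (simp add: min_def max_def abs_minus_commute)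
        finally show ?thesis .
      qed simp
    qed
    have "((\<lambda>y. 4 * B / sqrt x * sqrt (2 * \<bar>y - x\<bar>)) \<longlongrightarrow> 4 * B / sqrt x * sqrt (2 * \<bar>x - x\<bar>)) (at x)"
      by (intro tendsto_intros)
    then show "((\<lambda>y. 4 * B / sqrt x * sqrt (2 * \<bar>y - x\<bar>)) \<longlongrightarrow> 0) (at x)" by simp
  qed auto
  then have "((\<lambda>y. chi y - chi x) \<longlongrightarrow> 0) (at x)" by (rule tendsto_rabs_zero_cancel)
  then show "isCont chi x" unfolding isCont_def by (simp add: LIM_zero_iff)
qed

lemma borel_measurable_chi [measurable]: "chi \<in> borel_measurable borel"
proof -
  have "chi = (\<lambda>x. \<integral>s. 2 * \<theta> s * (of_bool (sqrt (2 * x) < s) * (s\<^sup>2 - 2 * x) powr (-1/2)) \<partial>lborel)"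
    unfolding chi_def[abs_def] ker_def by (intro ext Bochner_Integration.integral_cong) (auto simp: indicator_def)
  moreover have "(\<lambda>x. \<integral>s. 2 * \<theta> s * (of_bool (sqrt (2 * x) < s) * (s\<^sup>2 - 2 * x) powr (-1/2)) \<partial>lborel) \<in> borel_measurable borel"
    by measurable
  ultimately show ?thesis by (simp only:)
qed

lemma sqrt_less_iff:
  assumes "0 \<le> x"
  shows "sqrt (2 * x) < s \<longleftrightarrow> 0 < s \<and> x < s\<^sup>2 / 2"
proof -
  have "0 < s \<and> 2 * x < s\<^sup>2" if "sqrt (2 * x) < s"
  proof -
    have "0 < s" using that real_sqrt_ge_zero[of "2 * x"] assms by linarith
    moreover have "(sqrt (2 * x))\<^sup>2 < s\<^sup>2" using that assms by (intro power_strict_mono) auto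
    ultimately show ?thesis using assms by simp
  qed
  moreover have "sqrt (2 * x) < s" if "0 < s" "2 * x < s\<^sup>2"
    using that by (intro real_less_lsqrt) auto
  ultimately show ?thesis by auto
qed

text \<open>Fubini and the Beta integral over t < x < s^2 / 2 merge the two powers. The exponents
  (1, 1/2), (1/2, 1) and (1/2, 1/2) give the three relations between \<open>chi\<close>,
  \<open>root_mean\<close> and \<open>tail\<close>.\<close>

lemma half_beta_swap:
  assumes "0 < p" "0 < q" "0 \<le> t"
  shows "(\<integral>\<^sup>+x. indicator {t<..} x * (ennreal ((x - t) powr (p - 1)) *
      (\<integral>\<^sup>+s. of_bool (sqrt (2 * x) < s) * ennreal (\<theta> s * (s\<^sup>2 / 2 - x) powr (q - 1)) \<partial>lborel)) \<partial>lborel)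
    = (\<integral>\<^sup>+s. indicator {sqrt (2 * t)<..} s * ennreal (\<theta> s * (Beta p q * (s\<^sup>2 / 2 - t) powr (p + q - 1))) \<partial>lborel)"
proof -
  let ?F = "\<lambda>x s. indicator {t<..} x * (ennreal ((x - t) powr (p - 1)) *
      (of_bool (sqrt (2 * x) < s) * ennreal (\<theta> s * (s\<^sup>2 / 2 - x) powr (q - 1))))"
  have "(\<integral>\<^sup>+x. indicator {t<..} x * (ennreal ((x - t) powr (p - 1)) *
      (\<integral>\<^sup>+s. of_bool (sqrt (2 * x) < s) * ennreal (\<theta> s * (s\<^sup>2 / 2 - x) powr (q - 1)) \<partial>lborel)) \<partial>lborel)
    = (\<integral>\<^sup>+x. (\<integral>\<^sup>+s. ?F x s \<partial>lborel) \<partial>lborel)"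
    by (intro nn_integral_cong) (simp add: nn_integral_cmult)
  also have "\<dots> = (\<integral>\<^sup>+s. (\<integral>\<^sup>+x. ?F x s \<partial>lborel) \<partial>lborel)"
    by (rule lborel_pair.Fubini') measurable
  also have "\<dots> = (\<integral>\<^sup>+s. indicator {sqrt (2 * t)<..} s * ennreal (\<theta> s * (Beta p q * (s\<^sup>2 / 2 - t) powr (p + q - 1))) \<partial>lborel)"
  proof (rule nn_integral_cong)
    fix s
    show "(\<integral>\<^sup>+x. ?F x s \<partial>lborel) = indicator {sqrt (2 * t)<..} s * ennreal (\<theta> s * (Beta p q * (s\<^sup>2 / 2 - t) powr (p + q - 1)))"
    proof (cases "sqrt (2 * t) < s")
      case True
      then have s: "0 < s" "t < s\<^sup>2 / 2" using sqrt_less_iff[OF assms(3)] by auto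
      have "(\<integral>\<^sup>+x. ?F x s \<partial>lborel) = (\<integral>\<^sup>+x. ennreal (\<theta> s) * (indicator {t<..<s\<^sup>2 / 2} x * ennreal ((x - t) powr (p - 1) * (s\<^sup>2 / 2 - x) powr (q - 1))) \<partial>lborel)"
      proof (rule nn_integral_cong)
        fix x
        show "?F x s = ennreal (\<theta> s) * (indicator {t<..<s\<^sup>2 / 2} x * ennreal ((x - t) powr (p - 1) * (s\<^sup>2 / 2 - x) powr (q - 1)))"
        proof (cases "t < x")
          case True
          then have "sqrt (2 * x) < s \<longleftrightarrow> x < s\<^sup>2 / 2" using sqrt_less_iff[of x s] s assms by simp
          then show ?thesis using True density_nonneg[of s]
            by (auto simp: indicator_def ennreal_mult' ennreal_mult'' ac_simps)
        qed simp
      qed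
      also have "\<dots> = ennreal (\<theta> s) * ennreal (Beta p q * (s\<^sup>2 / 2 - t) powr (p + q - 1))"
        using nn_integral_Beta[OF s(2) assms(1,2)] by (subst nn_integral_cmult) auto
      finally show ?thesis using True density_nonneg[of s] by (simp add: ennreal_mult')
    next
      case False
      have "?F x s = 0" for x
      proof (cases "t < x")
        case True
        then have "\<not> sqrt (2 * x) < s" using False real_sqrt_le_mono[of "2 * t" "2 * x"] by linarith
        then show ?thesis by simp
      qed simp
      then have "(\<integral>\<^sup>+x. ?F x s \<partial>lborel) = 0" by (simp only: nn_integral_const mult_zero_left)
      then show ?thesis using False by simp
    qed
  qed
  finally show ?thesis .
qed

lemma chi_nn_half:
  assumes "0 < x"
  shows "ennreal (chi x) = ennreal (sqrt 2) * (\<integral>\<^sup>+s. of_bool (sqrt (2 * x) < s) * ennreal (\<theta> s * (s\<^sup>2 / 2 - x) powr (1/2 - 1)) \<partial>lborel)"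
proof -
  have "ennreal (2 * \<theta> s * ker x s) = ennreal (sqrt 2) * (of_bool (sqrt (2 * x) < s) * ennreal (\<theta> s * (s\<^sup>2 / 2 - x) powr (1/2 - 1)))" for s
  proof (cases "sqrt (2 * x) < s")
    case True
    then have "x < s\<^sup>2 / 2" using sqrt_less_iff[of x s] assms by simp
    moreover from this have "(s\<^sup>2 - 2 * x) powr (-1/2) = 2 powr (-1/2) * (s\<^sup>2 / 2 - x) powr (-1/2)"
      using powr_mult[of 2 "s\<^sup>2 / 2 - x" "-1/2"] by (simp add: algebra_simps)
    moreover have "2 * 2 powr (-1/2) = sqrt 2" by (simp add: powr_minus powr_half_sqrt field_simps)
    ultimately have "2 * \<theta> s * ker x s = sqrt 2 * (\<theta> s * (s\<^sup>2 / 2 - x) powr (1/2 - 1))"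
      using True by (simp add: ker_def)
    then have eq: "ennreal (2 * \<theta> s * ker x s) = ennreal (sqrt 2) * ennreal (\<theta> s * (s\<^sup>2 / 2 - x) powr (1/2 - 1))"
      by (simp only: ennreal_mult' real_sqrt_ge_zero zero_le_numeral)
    show ?thesis unfolding eq using True by simp
  qed (simp add: ker_def)
  then show ?thesis unfolding chi_nn[OF assms] by (simp add: nn_integral_cmult)
qed

lemma root_mean_nn:
  assumes "0 \<le> t"
  shows "ennreal (root_mean t) = (\<integral>\<^sup>+s. indicator {sqrt (2 * t)<..} s * ennreal (2 * \<theta> s * sqrt (s\<^sup>2 - 2 * t)) \<partial>lborel)"
proof -
  let ?f = "\<lambda>s. 2 * \<theta> s * (indicator {sqrt (2 * t)<..} s * sqrt (s\<^sup>2 - 2 * t))"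
  have pos: "2 * t < s\<^sup>2" if "sqrt (2 * t) < s" for s using sqrt_less_iff[OF assms, of s] that by simp
  have nonneg: "0 \<le> ?f s" for s using pos[of s] density_nonneg[of s] by (auto simp: indicator_def less_imp_le)
  have bnd: "\<bar>2 * sqrt (s\<^sup>2 - 2 * t)\<bar> \<le> 4" if "sqrt (2 * t) < s" "s < 2" for s
  proof -
    have "0 < s" using that(1) sqrt_less_iff[OF assms] by simp
    then have "s\<^sup>2 \<le> 2\<^sup>2" using that by (intro power_mono) auto
    then have "sqrt (s\<^sup>2 - 2 * t) \<le> sqrt (2\<^sup>2)" using assms by (intro real_sqrt_le_mono) linarith
    then show ?thesis using pos[OF that(1)] by simp
  qed
  have "integrable lborel (\<lambda>s. \<theta> s * (indicator {sqrt (2 * t)<..} s * (2 * sqrt (s\<^sup>2 - 2 * t))))"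
    using bnd assms by (intro integrable_density_mult[where C=4]) auto
  then have "integrable lborel ?f" by (simp add: ac_simps)
  then have "ennreal (root_mean t) = (\<integral>\<^sup>+s. ennreal (?f s) \<partial>lborel)"
    unfolding root_mean_def using nonneg by (intro nn_integral_eq_integral[symmetric]) auto
  also have "\<dots> = (\<integral>\<^sup>+s. indicator {sqrt (2 * t)<..} s * ennreal (2 * \<theta> s * sqrt (s\<^sup>2 - 2 * t)) \<partial>lborel)"
    by (intro nn_integral_cong) (simp add: indicator_def)
  finally show ?thesis .
qed

lemma Beta_half_one: "Beta (1/2) 1 = (2::real)" "Beta 1 (1/2) = (2::real)" "Beta (1/2) (1/2) = pi"
proof -
  have G: "Gamma (1/2 + 1 :: real) = sqrt pi / 2" "Gamma (1 + 1/2 :: real) = sqrt pi / 2"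
    using Gamma_plus1[of "1/2 :: real"] nonpos_Ints_nonpos[of "1/2 :: real"] by (auto simp: Gamma_one_half_real)
  show "Beta (1/2) 1 = (2::real)" "Beta 1 (1/2) = (2::real)"
    unfolding Beta_def G Gamma_one_half_real by simp_all
  show "Beta (1/2) (1/2) = pi" by (simp add: Beta_def Gamma_one_half_real)
qed

lemma half_sqrt_scale: "0 \<le> u \<Longrightarrow> sqrt 2 * (2 * (u / 2) powr (1/2)) = 2 * sqrt u"
  by (simp add: powr_half_sqrt real_sqrt_divide)

text \<open>The case (1, 1/2): \<open>root_mean\<close> is the tail integral of \<open>chi\<close>,
  which makes it differentiable wherever \<open>chi\<close> is continuous.\<close>

lemma root_mean_eq_chi:
  assumes "0 \<le> t"
  shows "(\<integral>\<^sup>+x. indicator {t<..} x * ennreal (chi x) \<partial>lborel) = ennreal (root_mean t)"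
proof -
  have "(\<integral>\<^sup>+x. indicator {t<..} x * ennreal (chi x) \<partial>lborel) =
    (\<integral>\<^sup>+x. ennreal (sqrt 2) * (indicator {t<..} x * (ennreal ((x - t) powr (1 - 1)) *
      (\<integral>\<^sup>+s. of_bool (sqrt (2 * x) < s) * ennreal (\<theta> s * (s\<^sup>2 / 2 - x) powr (1/2 - 1)) \<partial>lborel))) \<partial>lborel)"
    using assms by (intro nn_integral_cong) (auto simp: chi_nn_half indicator_def)
  also have "\<dots> = ennreal (sqrt 2) * (\<integral>\<^sup>+s. indicator {sqrt (2 * t)<..} s * ennreal (\<theta> s * (Beta 1 (1/2) * (s\<^sup>2 / 2 - t) powr (1 + 1/2 - 1))) \<partial>lborel)"
    unfolding half_beta_swap[OF zero_less_one half_gt_zero[OF zero_less_one] assms, symmetric]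
    by (rule nn_integral_cmult) measurable
  also have "\<dots> = (\<integral>\<^sup>+s. ennreal (sqrt 2) * (indicator {sqrt (2 * t)<..} s * ennreal (\<theta> s * (Beta 1 (1/2) * (s\<^sup>2 / 2 - t) powr (1 + 1/2 - 1)))) \<partial>lborel)"
    by (rule nn_integral_cmult[symmetric]) measurable
  also have "\<dots> = ennreal (root_mean t)"
    unfolding root_mean_nn[OF assms]
  proof (rule nn_integral_cong)
    fix s
    show "ennreal (sqrt 2) * (indicator {sqrt (2 * t)<..} s * ennreal (\<theta> s * (Beta 1 (1/2) * (s\<^sup>2 / 2 - t) powr (1 + 1/2 - 1))))
      = indicator {sqrt (2 * t)<..} s * ennreal (2 * \<theta> s * sqrt (s\<^sup>2 - 2 * t))"
    proof (cases "sqrt (2 * t) < s")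
      case True
      then have "0 \<le> s\<^sup>2 - 2 * t" using sqrt_less_iff[OF assms, of s] by simp
      from half_sqrt_scale[OF this] have "sqrt 2 * (\<theta> s * (Beta 1 (1/2) * (s\<^sup>2 / 2 - t) powr (1 + 1/2 - 1))) = 2 * \<theta> s * sqrt (s\<^sup>2 - 2 * t)"
        by (simp add: Beta_half_one diff_divide_distrib mult.left_commute)
      then have "ennreal (sqrt 2) * ennreal (\<theta> s * (Beta 1 (1/2) * (s\<^sup>2 / 2 - t) powr (1 + 1/2 - 1))) = ennreal (2 * \<theta> s * sqrt (s\<^sup>2 - 2 * t))"
        by (simp only: ennreal_mult'[symmetric] real_sqrt_ge_zero zero_le_numeral)
      then show ?thesis using True by simp
    qed simp
  qed
  finally show ?thesis .
qed

lemma line_int_tail: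
  assumes [measurable]: "\<psi> \<in> borel_measurable borel"
    and \<psi>: "\<And>t. 0 \<le> t \<Longrightarrow> \<psi> t = ennreal (tail (sqrt (2 * t)))" and "0 \<le> t"
  shows "line_int \<psi> t = ennreal (root_mean t)"
proof -
  have "line_int \<psi> t = (\<integral>\<^sup>+x. indicator {t<..} x * (ennreal (sqrt 2 * (x - t) powr (-1/2)) * \<psi> x) \<partial>lborel)"
    by (rule line_int_Abel) measurable
  also have "\<dots> = (\<integral>\<^sup>+x. ennreal (sqrt 2) * (indicator {t<..} x * (ennreal ((x - t) powr (1/2 - 1)) *
      (\<integral>\<^sup>+s. of_bool (sqrt (2 * x) < s) * ennreal (\<theta> s * (s\<^sup>2 / 2 - x) powr (1 - 1)) \<partial>lborel))) \<partial>lborel)"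
  proof (rule nn_integral_cong)
    fix x
    show "indicator {t<..} x * (ennreal (sqrt 2 * (x - t) powr (-1/2)) * \<psi> x) = ennreal (sqrt 2) * (indicator {t<..} x * (ennreal ((x - t) powr (1/2 - 1)) *
      (\<integral>\<^sup>+s. of_bool (sqrt (2 * x) < s) * ennreal (\<theta> s * (s\<^sup>2 / 2 - x) powr (1 - 1)) \<partial>lborel)))"
    proof (cases "t < x")
      case True
      then have x: "0 \<le> x" using assms by simp
      have "(\<integral>\<^sup>+s. of_bool (sqrt (2 * x) < s) * ennreal (\<theta> s * (s\<^sup>2 / 2 - x) powr (1 - 1)) \<partial>lborel)
        = (\<integral>\<^sup>+s. indicator {sqrt (2 * x)<..} s * ennreal (\<theta> s) \<partial>lborel)"
        using sqrt_less_iff[OF x] by (intro nn_integral_cong) (simp add: indicator_def)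
      also have "\<dots> = \<psi> x" using tail_nn[of "sqrt (2 * x)"] \<psi>[OF x] x by simp
      finally show ?thesis using True by (simp add: ennreal_mult' mult.assoc)
    qed simp
  qed
  also have "\<dots> = ennreal (sqrt 2) * (\<integral>\<^sup>+s. indicator {sqrt (2 * t)<..} s * ennreal (\<theta> s * (Beta (1/2) 1 * (s\<^sup>2 / 2 - t) powr (1/2 + 1 - 1))) \<partial>lborel)"
    unfolding half_beta_swap[OF half_gt_zero[OF zero_less_one] zero_less_one assms(3), symmetric]
    by (rule nn_integral_cmult) measurable
  also have "\<dots> = (\<integral>\<^sup>+s. ennreal (sqrt 2) * (indicator {sqrt (2 * t)<..} s * ennreal (\<theta> s * (Beta (1/2) 1 * (s\<^sup>2 / 2 - t) powr (1/2 + 1 - 1)))) \<partial>lborel)"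
    by (rule nn_integral_cmult[symmetric]) measurable
  also have "\<dots> = ennreal (root_mean t)"
    unfolding root_mean_nn[OF assms(3)]
  proof (rule nn_integral_cong)
    fix s
    show "ennreal (sqrt 2) * (indicator {sqrt (2 * t)<..} s * ennreal (\<theta> s * (Beta (1/2) 1 * (s\<^sup>2 / 2 - t) powr (1/2 + 1 - 1))))
      = indicator {sqrt (2 * t)<..} s * ennreal (2 * \<theta> s * sqrt (s\<^sup>2 - 2 * t))"
    proof (cases "sqrt (2 * t) < s")
      case True
      then have "0 \<le> s\<^sup>2 - 2 * t" using sqrt_less_iff[OF assms(3), of s] by simp
      from half_sqrt_scale[OF this] have "sqrt 2 * (\<theta> s * (Beta (1/2) 1 * (s\<^sup>2 / 2 - t) powr (1/2 + 1 - 1))) = 2 * \<theta> s * sqrt (s\<^sup>2 - 2 * t)"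
        by (simp add: Beta_half_one diff_divide_distrib mult.left_commute)
      then have "ennreal (sqrt 2) * ennreal (\<theta> s * (Beta (1/2) 1 * (s\<^sup>2 / 2 - t) powr (1/2 + 1 - 1))) = ennreal (2 * \<theta> s * sqrt (s\<^sup>2 - 2 * t))"
        by (simp only: ennreal_mult'[symmetric] real_sqrt_ge_zero zero_le_numeral)
      then show ?thesis using True by simp
    qed simp
  qed
  finally show ?thesis .
qed

text \<open>The case (1/2, 1/2), where the power of s^2 / 2 - t becomes 0 and only the tail is left:
  half-order integration of \<open>chi\<close> returns the profile, the inversion needed for
  half-integer k.\<close>

lemma Abel_chi:
  assumes "0 \<le> t"
  shows "(\<integral>\<^sup>+x. indicator {t<..} x * ennreal ((x - t) powr (-1/2) * chi x) \<partial>lborel) = ennreal (sqrt 2 * pi * tail (sqrt (2 * t)))"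
proof -
  have "(\<integral>\<^sup>+x. indicator {t<..} x * ennreal ((x - t) powr (-1/2) * chi x) \<partial>lborel) =
    (\<integral>\<^sup>+x. ennreal (sqrt 2) * (indicator {t<..} x * (ennreal ((x - t) powr (1/2 - 1)) *
      (\<integral>\<^sup>+s. of_bool (sqrt (2 * x) < s) * ennreal (\<theta> s * (s\<^sup>2 / 2 - x) powr (1/2 - 1)) \<partial>lborel))) \<partial>lborel)"
  proof (rule nn_integral_cong)
    fix x
    show "indicator {t<..} x * ennreal ((x - t) powr (-1/2) * chi x) = ennreal (sqrt 2) * (indicator {t<..} x * (ennreal ((x - t) powr (1/2 - 1)) *
      (\<integral>\<^sup>+s. of_bool (sqrt (2 * x) < s) * ennreal (\<theta> s * (s\<^sup>2 / 2 - x) powr (1/2 - 1)) \<partial>lborel)))"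
    proof (cases "t < x")
      case True
      then have "ennreal ((x - t) powr (-1/2) * chi x) = ennreal ((x - t) powr (-1/2)) * ennreal (chi x)"
        by (simp add: ennreal_mult')
      then show ?thesis using True assms by (simp add: chi_nn_half mult.left_commute)
    qed simp
  qed
  also have "\<dots> = ennreal (sqrt 2) * (\<integral>\<^sup>+s. indicator {sqrt (2 * t)<..} s * ennreal (\<theta> s * (Beta (1/2) (1/2) * (s\<^sup>2 / 2 - t) powr (1/2 + 1/2 - 1))) \<partial>lborel)"
    unfolding half_beta_swap[OF half_gt_zero[OF zero_less_one] half_gt_zero[OF zero_less_one] assms, symmetric]
    by (rule nn_integral_cmult) measurable
  also have "(\<integral>\<^sup>+s. indicator {sqrt (2 * t)<..} s * ennreal (\<theta> s * (Beta (1/2) (1/2) * (s\<^sup>2 / 2 - t) powr (1/2 + 1/2 - 1))) \<partial>lborel)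
    = (\<integral>\<^sup>+s. ennreal pi * (indicator {sqrt (2 * t)<..} s * ennreal (\<theta> s)) \<partial>lborel)"
  proof (rule nn_integral_cong)
    fix s
    show "indicator {sqrt (2 * t)<..} s * ennreal (\<theta> s * (Beta (1/2) (1/2) * (s\<^sup>2 / 2 - t) powr (1/2 + 1/2 - 1)))
      = ennreal pi * (indicator {sqrt (2 * t)<..} s * ennreal (\<theta> s))"
    proof (cases "sqrt (2 * t) < s")
      case True
      then have "\<theta> s * (Beta (1/2) (1/2) * (s\<^sup>2 / 2 - t) powr (1/2 + 1/2 - 1)) = pi * \<theta> s"
        using sqrt_less_iff[OF assms, of s] by (simp add: Beta_half_one)
      then have eq: "ennreal (\<theta> s * (Beta (1/2) (1/2) * (s\<^sup>2 / 2 - t) powr (1/2 + 1/2 - 1))) = ennreal pi * ennreal (\<theta> s)"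
        by (simp only: ennreal_mult' pi_ge_zero)
      have "indicator {sqrt (2 * t)<..} s = (1 :: ennreal)" using True by simp
      then show ?thesis unfolding eq by simp
    qed simp
  qed
  also have "\<dots> = ennreal pi * ennreal (tail (sqrt (2 * t)))"
    using tail_nn[of "sqrt (2 * t)"] assms by (subst nn_integral_cmult) auto
  finally show ?thesis using tail_nonneg by (simp add: mult.assoc flip: ennreal_mult')
qed

lemma continuous_on_root_mean: "continuous_on {0..} root_mean"
proof -
  \<comment> \<open>For t \<ge> 0 this moves the dependence on t from the indicator into a
    continuous square root, so the integrand is continuous in t for every s.\<close>
  define h where "h t s = 2 * \<theta> s * (indicator {0<..} s * sqrt (max 0 (s\<^sup>2 - 2 * t)))" for t s
  have h: "root_mean t = (\<integral>s. h t s \<partial>lborel)" if "0 \<le> t" for t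
    unfolding root_mean_def
  proof (intro Bochner_Integration.integral_cong refl)
    fix s
    show "2 * \<theta> s * (indicator {sqrt (2 * t)<..} s * sqrt (s\<^sup>2 - 2 * t)) = h t s"
      using sqrt_less_iff[OF that, of s] by (cases "0 < s"; cases "t < s\<^sup>2 / 2") (simp_all add: h_def)
  qed
  show ?thesis
    unfolding continuous_on_sequentially comp_def
  proof (intro allI ballI impI, elim conjE)
    fix x and a :: real
    assume a: "a \<in> {0..}" and x: "\<forall>n. x n \<in> {0..}" and lim: "x \<longlonglongrightarrow> a"
    have "(\<lambda>n. \<integral>s. h (x n) s \<partial>lborel) \<longlonglongrightarrow> (\<integral>s. h a s \<partial>lborel)"
    proof (rule integral_dominated_convergence[where w="\<lambda>s. 4 * B * indicator {0..2} s"])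
      show "AE s in lborel. (\<lambda>n. h (x n) s) \<longlonglongrightarrow> h a s"
        unfolding h_def by (intro AE_I2 tendsto_intros lim)
      show "AE s in lborel. norm (h (x n) s) \<le> 4 * B * indicator {0..2} s" for n
      proof (rule AE_I2)
        fix s :: real
        consider "s \<le> 0" | "s \<ge> 2" | "0 < s" "s < 2" by linarith
        then show "norm (h (x n) s) \<le> 4 * B * indicator {0..2} s"
        proof cases
          case 3
          have "s\<^sup>2 \<le> 2\<^sup>2" using 3 by (intro power_mono) auto
          moreover have "0 \<le> x n" using x by simp
          ultimately have "sqrt (max 0 (s\<^sup>2 - 2 * x n)) \<le> sqrt (2\<^sup>2)" by (intro real_sqrt_le_mono) auto
          then have "\<theta> s * sqrt (max 0 (s\<^sup>2 - 2 * x n)) \<le> B * 2"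
            using density_nonneg density_le bound_nonneg by (intro mult_mono) auto
          then show ?thesis using 3 density_nonneg[of s] by (simp add: h_def abs_mult)
        qed (auto simp: h_def density_zero bound_nonneg)
      qed
    qed (auto simp: h_def)
    then show "(\<lambda>n. root_mean (x n)) \<longlonglongrightarrow> root_mean a"
      using a x by (simp add: h)
  qed
qed

lemma root_mean_deriv:
  assumes t: "0 < t"
  shows "(root_mean has_real_derivative - chi t) (at t)"
proof -
  \<comment> \<open>A window around t bounded away from 0, where \<open>chi\<close> need not be
    bounded.\<close>
  define a X where "a = t / 2" "X = t + 1"
  have a: "0 < a" "a < t" "t < X" unfolding a_X_def using t by auto
  have cont: "continuous_on {a..y} chi" for y
    by (rule continuous_on_subset[OF continuous_on_chi]) (use a in auto)
  have eq: "root_mean y = root_mean a - integral {a..y} chi" if "y \<in> {a..X}" for y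
  proof -
    have ay: "a \<le> y" using that by simp
    have "ennreal (root_mean a) = (\<integral>\<^sup>+x. indicator {a<..} x * ennreal (chi x) \<partial>lborel)"
      using root_mean_eq_chi[of a] a by simp
    also have "\<dots> = (\<integral>\<^sup>+x. ennreal (indicator {a..y} x * chi x) + indicator {y<..} x * ennreal (chi x) \<partial>lborel)"
      using AE_lborel_singleton[of a] ay
      by (intro nn_integral_cong_AE) (auto elim!: eventually_mono simp: indicator_def)
    also have "\<dots> = (\<integral>\<^sup>+x. ennreal (indicator {a..y} x * chi x) \<partial>lborel) + (\<integral>\<^sup>+x. indicator {y<..} x * ennreal (chi x) \<partial>lborel)"
      by (rule nn_integral_add) auto
    also have "(\<integral>\<^sup>+x. ennreal (indicator {a..y} x * chi x) \<partial>lborel) = ennreal (integral {a..y} chi)"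
      by (rule nn_integral_has_integral_lebesgue[OF chi_nonneg integrable_integral[OF integrable_continuous_real[OF cont]]])
    also have "(\<integral>\<^sup>+x. indicator {y<..} x * ennreal (chi x) \<partial>lborel) = ennreal (root_mean y)"
      using root_mean_eq_chi[of y] a ay by simp
    finally have *: "ennreal (root_mean a) = ennreal (integral {a..y} chi) + ennreal (root_mean y)" .
    have "0 \<le> integral {a..y} chi"
      by (rule Henstock_Kurzweil_Integration.integral_nonneg[OF integrable_continuous_real[OF cont] chi_nonneg])
    then have "root_mean a = integral {a..y} chi + root_mean y"
      using * root_mean_nonneg[of a] root_mean_nonneg[of y] by (metis ennreal_inj ennreal_plus add_nonneg_nonneg)
    then show ?thesis by simp
  qed
  have "((\<lambda>y. integral {a..y} chi) has_real_derivative chi t) (at t within {a..X})"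
    by (rule integral_has_real_derivative[OF cont]) (use a in auto)
  then have "((\<lambda>y. root_mean a - integral {a..y} chi) has_real_derivative 0 - chi t) (at t within {a..X})"
    by (intro DERIV_diff) auto
  then have "((\<lambda>y. root_mean a - integral {a..y} chi) has_real_derivative - chi t) (at t within {a..X})" by simp
  then have "(root_mean has_real_derivative - chi t) (at t within {a..X})"
  proof (rule has_field_derivative_transform_within[where d=1])
    show "root_mean a - integral {a..y} chi = root_mean y" if "y \<in> {a..X}" for y
      by (rule eq[OF that, symmetric])
  qed (use a in auto)
  moreover have "at t within {a..X} = at t" using a by (intro at_within_interior) simp
  ultimately show ?thesis by simp
qed

end

section \<open>Evaluation of the generalized Wu function\<close>

lemma minus_one_power_cancel: "(-1) ^ m * ((-1) ^ m * z) = (z :: real)"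
  by (cases "even m") auto

text \<open>Every t \<ge> 0 is a limit point of [0, \<infinity>), including 0, where the derivative
  is one-sided. Hence the value chosen by \<open>rderiv\<close> is determined whenever a derivative
  exists.\<close>

lemma has_real_derivative_unique_Ici:
  assumes "(f has_real_derivative D) (at t within {0..})" "(f has_real_derivative E) (at t within {0..})" "0 \<le> t"
  shows "D = E"
proof -
  have "at t within {0..} \<noteq> bot"
  proof -
    have "t islimpt {t<..<t+1}" by (rule islimpt_greaterThanLessThan1) simp
    then have "t islimpt {0..}" by (rule islimpt_subset) (use assms in auto)
    then show ?thesis by (simp add: trivial_limit_within)
  qed
  then show ?thesis
    using assms(1,2) unfolding has_field_derivative_iff by (rule tendsto_unique)
qed

lemma rderiv_eq:
  assumes "(g has_real_derivative D) (at t within {0..})" "0 \<le> t" "\<And>s. 0 \<le> s \<Longrightarrow> f s = g s"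
  shows "rderiv f t = D"
proof -
  have f: "(f has_real_derivative D) (at t within {0..})"
    by (rule has_field_derivative_transform_within[OF assms(1) zero_less_one]) (use assms in auto)
  show ?thesis
    unfolding rderiv_def
    using someI[of "\<lambda>D. (f has_real_derivative D) (at t within {0..})", OF f] f
    by (intro has_real_derivative_unique_Ici[OF _ _ assms(2)])
qed

lemma rderiv_eq_interior:
  assumes "(g has_real_derivative D) (at t)" "0 < t" "\<And>s. 0 \<le> s \<Longrightarrow> f s = g s"
  shows "rderiv f t = D"
  using assms has_field_derivative_at_within by (intro rderiv_eq[where g=g]) auto

text \<open>The functions u 0, ..., u m form a ladder: one derivative descends one rung and
  contributes a sign.\<close>

lemma rderiv_funpow_chain:
  assumes der: "\<And>j t. j < m \<Longrightarrow> 0 \<le> t \<Longrightarrow> (u (Suc j) has_real_derivative - u j t) (at t within {0..})"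
    and F: "\<And>t. 0 \<le> t \<Longrightarrow> F t = u m t"
    and "i \<le> m" "0 \<le> t"
  shows "(rderiv ^^ i) F t = (-1) ^ i * u (m - i) t"
  using assms(3,4)
proof (induction i arbitrary: t)
  case 0
  then show ?case using F by simp
next
  case (Suc i)
  then have S: "m - i = Suc (m - Suc i)" by simp
  have "rderiv ((rderiv ^^ i) F) t = (-1) ^ i * (- u (m - Suc i) t)"
  proof (rule rderiv_eq)
    show "((\<lambda>t. (-1) ^ i * u (m - i) t) has_real_derivative (-1) ^ i * (- u (m - Suc i) t)) (at t within {0..})"
      unfolding S using Suc.prems by (intro DERIV_cmult der) auto
    show "(rderiv ^^ i) F s = (-1) ^ i * u (m - i) s" if "0 \<le> s" for s
      using Suc that by simp
  qed (use Suc in auto)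
  then show ?case by simp
qed

text \<open>The iterated integral from t to \<infinity> of a function vanishing beyond 2, written as
  a difference of integrals from 0 so that one differentiation formula serves t \<le> 2 and t >
  2.\<close>

primrec tail_iter :: "(real \<Rightarrow> real) \<Rightarrow> nat \<Rightarrow> real \<Rightarrow> real" where
  "tail_iter g 0 = g"
| "tail_iter g (Suc j) = (\<lambda>t. integral {0..2} (tail_iter g j) - integral {0..t} (tail_iter g j))"

text \<open>The bound 2 is the same in both variables: r = 2 corresponds to t = r^2 / 2 = 2.\<close>

locale tail_iteration =
  fixes g :: "real \<Rightarrow> real"
  assumes cont: "continuous_on {0..} g" and nonneg: "\<And>t. 0 \<le> t \<Longrightarrow> 0 \<le> g t" and zero: "\<And>t. 2 \<le> t \<Longrightarrow> g t = 0"
begin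

lemma tail_iter_aux:
  "continuous_on {0..} (tail_iter g j) \<and> (\<forall>t\<ge>2. tail_iter g j t = 0) \<and> (\<forall>t\<ge>0. 0 \<le> tail_iter g j t)"
  and tail_iter_deriv: "0 \<le> t \<Longrightarrow> (tail_iter g (Suc j) has_real_derivative - tail_iter g j t) (at t within {0..})"
  and tail_iter_nn: "0 \<le> t \<Longrightarrow> (\<integral>\<^sup>+x. indicator {t<..} x * ennreal (tail_iter g j x) \<partial>lborel) = ennreal (tail_iter g (Suc j) t)"
proof -
  \<comment> \<open>One rung of the ladder: the premise is the invariant of the induction below, and
    the conclusion contains what is needed to restore it.\<close>
  have step: "(0 \<le> t \<longrightarrow> (tail_iter g (Suc j) has_real_derivative - tail_iter g j t) (at t within {0..}))
     \<and> (2 \<le> t \<longrightarrow> tail_iter g (Suc j) t = 0) \<and> (0 \<le> t \<longrightarrow> 0 \<le> tail_iter g (Suc j) t)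
     \<and> (0 \<le> t \<longrightarrow> (\<integral>\<^sup>+x. indicator {t<..} x * ennreal (tail_iter g j x) \<partial>lborel) = ennreal (tail_iter g (Suc j) t))"
    if "continuous_on {0..} (tail_iter g j) \<and> (\<forall>t\<ge>2. tail_iter g j t = 0) \<and> (\<forall>t\<ge>0. 0 \<le> tail_iter g j t)" for t j
  proof -
    define v where "v = tail_iter g j"
    have v: "continuous_on {0..} v" "\<And>t. 2 \<le> t \<Longrightarrow> v t = 0" "\<And>t. 0 \<le> t \<Longrightarrow> 0 \<le> v t"
      using that unfolding v_def by auto
    have int: "v integrable_on {a..b}" if "0 \<le> a" for a b
      by (rule integrable_continuous_real[OF continuous_on_subset[OF v(1)]]) (use that in auto)
    have split: "integral {0..a} v + integral {a..b} v = integral {0..b} v" if "0 \<le> a" "a \<le> b" for a b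
      by (rule Henstock_Kurzweil_Integration.integral_combine[OF that int]) simp
    have pos: "0 \<le> integral {a..b} v" if "0 \<le> a" for a b
      by (rule Henstock_Kurzweil_Integration.integral_nonneg[OF int[OF that]]) (use v(3) that in auto)
    have tail: "integral {a..b} v = 0" if "2 \<le> a" for a b
    proof -
      have "integral {a..b} v = integral {a..b} (\<lambda>_. 0)"
        by (rule Henstock_Kurzweil_Integration.integral_cong) (use v(2) that in auto)
      then show ?thesis by simp
    qed
    have val: "tail_iter g (Suc j) t = (if t \<le> 2 then integral {t..2} v else 0)" if "0 \<le> t" for t
      using split[of t 2] split[of 2 t] tail[of 2 t] that by (auto simp: v_def[symmetric])
    have "(tail_iter g (Suc j) has_real_derivative - v t) (at t within {0..})" if t: "0 \<le> t"
    proof -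
      have "((\<lambda>y. integral {0..y} v) has_real_derivative v t) (at t within {0..t+1})"
        by (rule integral_has_real_derivative[OF continuous_on_subset[OF v(1)]]) (use t in auto)
      then have "((\<lambda>y. integral {0..2} v - integral {0..y} v) has_real_derivative 0 - v t) (at t within {0..t+1})"
        by (intro DERIV_diff) auto
      moreover have "at t within {0..t+1} = at t within {0..}"
        by (rule at_within_nhd[of t "{..<t+1}"]) auto
      ultimately show ?thesis by (simp add: v_def)
    qed
    moreover have "(\<integral>\<^sup>+x. indicator {t<..} x * ennreal (v x) \<partial>lborel) = ennreal (tail_iter g (Suc j) t)" if t: "0 \<le> t"
    proof (cases "t \<le> 2")
      case True
      have "(\<integral>\<^sup>+x. indicator {t<..} x * ennreal (v x) \<partial>lborel) = (\<integral>\<^sup>+x. ennreal (indicator {t..2} x * v x) \<partial>lborel)"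
        using AE_lborel_singleton[of t]
        by (intro nn_integral_cong_AE) (auto elim!: eventually_mono simp: indicator_def v(2))
      also have "\<dots> = ennreal (integral {t..2} v)"
        by (rule nn_integral_has_integral_lebesgue[OF _ integrable_integral[OF int[OF t]]]) (use v(3) t in auto)
      finally show ?thesis using val[OF t] True by simp
    next
      case False
      then have "indicator {t<..} x * ennreal (v x) = 0" for x using v(2)[of x] by (auto simp: indicator_def)
      then show ?thesis using val[OF t] False by (simp only: nn_integral_const mult_zero_left) simp
    qed
    moreover have "0 \<le> tail_iter g (Suc j) t" if "0 \<le> t" using val[OF that] pos[OF that] by simp
    moreover have "tail_iter g (Suc j) t = 0" if "2 \<le> t" using val[of t] that tail[of t 2] by auto
    ultimately show ?thesis unfolding v_def by blast
  qed
  show all: "continuous_on {0..} (tail_iter g j) \<and> (\<forall>t\<ge>2. tail_iter g j t = 0) \<and> (\<forall>t\<ge>0. 0 \<le> tail_iter g j t)" for j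
  proof (induction j)
    case 0
    then show ?case using cont nonneg zero by simp
  next
    case (Suc j)
    have "continuous_on {0..} (tail_iter g (Suc j))"
      using step[OF Suc] by (intro DERIV_continuous_on) auto
    then show ?case using step[OF Suc] by blast
  qed
  show "0 \<le> t \<Longrightarrow> (tail_iter g (Suc j) has_real_derivative - tail_iter g j t) (at t within {0..})"
    "0 \<le> t \<Longrightarrow> (\<integral>\<^sup>+x. indicator {t<..} x * ennreal (tail_iter g j x) \<partial>lborel) = ennreal (tail_iter g (Suc j) t)"
    using step[OF all, of t j] by blast+
qed

text \<open>Line integrals are taken in pairs, since a pair is 2 pi times an ordinary tail integral
  and preserves continuity on [0, \<infinity>).\<close>

lemma line_int_even:
  assumes [measurable]: "\<phi> \<in> borel_measurable borel" and \<phi>: "\<And>t. 0 \<le> t \<Longrightarrow> \<phi> t = ennreal (g t)"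
  shows "0 \<le> t \<Longrightarrow> (line_int ^^ (2 * j)) \<phi> t = ennreal ((2 * pi) ^ j * tail_iter g j t)"
proof (induction j arbitrary: t)
  case 0
  then show ?case using \<phi> by simp
next
  case (Suc j)
  let ?\<phi> = "(line_int ^^ (2 * j)) \<phi>"
  have [measurable]: "?\<phi> \<in> borel_measurable borel" by (rule borel_measurable_line_int_funpow) measurable
  have "(line_int ^^ (2 * Suc j)) \<phi> t = line_int (line_int ?\<phi>) t" by simp
  also have "\<dots> = ennreal (2 * pi) * (\<integral>\<^sup>+x. indicator {t<..} x * ?\<phi> x \<partial>lborel)"
    by (rule line_int_line_int) measurable
  also have "(\<integral>\<^sup>+x. indicator {t<..} x * ?\<phi> x \<partial>lborel) = (\<integral>\<^sup>+x. ennreal ((2 * pi) ^ j) * (indicator {t<..} x * ennreal (tail_iter g j x)) \<partial>lborel)"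
  proof (rule nn_integral_cong)
    fix x
    show "indicator {t<..} x * ?\<phi> x = ennreal ((2 * pi) ^ j) * (indicator {t<..} x * ennreal (tail_iter g j x))"
      using Suc.IH[of x] Suc.prems by (cases "t < x") (auto simp: ennreal_mult')
  qed
  also have "\<dots> = ennreal ((2 * pi) ^ j) * ennreal (tail_iter g (Suc j) t)"
  proof -
    \<comment> \<open>\<open>tail_iter g j\<close> is controlled only on [0, \<infinity>), so
      measurability is obtained for the product with the indicator.\<close>
    have "(\<lambda>x. indicator {t<..} x * ennreal (tail_iter g j x)) \<in> borel_measurable borel"
    proof -
      have "continuous_on {0..} (tail_iter g j)" using tail_iter_aux by blast
      then have "continuous_on {t<..} (tail_iter g j)" by (rule continuous_on_subset) (use Suc.prems in auto)
      then have "(\<lambda>x. indicator {t<..} x *\<^sub>R tail_iter g j x) \<in> borel_measurable borel"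
        by (intro borel_measurable_continuous_on_indicator) auto
      then have "(\<lambda>x. ennreal (indicator {t<..} x *\<^sub>R tail_iter g j x)) \<in> borel_measurable borel" by measurable
      moreover have "ennreal (indicator {t<..} x *\<^sub>R tail_iter g j x) = indicator {t<..} x * ennreal (tail_iter g j x)" for x
        by (simp add: indicator_def)
      ultimately show ?thesis by simp
    qed
    then show ?thesis using tail_iter_nn[OF Suc.prems] by (subst nn_integral_cmult) auto
  qed
  finally show ?case
    by (simp add: mult.assoc ennreal_mult'[symmetric] del: tail_iter.simps)
qed

text \<open>Each factor 2 pi coming from a pair of line integrals is matched by one derivative.\<close>

lemma rderiv_even:
  assumes \<phi>: "\<phi> \<in> borel_measurable borel" "\<And>t. 0 \<le> t \<Longrightarrow> \<phi> t = ennreal (g t)"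
    and F: "\<And>t. 0 \<le> t \<Longrightarrow> 0 \<le> F t" "\<And>t. 0 \<le> t \<Longrightarrow> (line_int ^^ (2 * m)) \<phi> t = ennreal (K * F t)" and K: "0 < K"
    and t: "0 \<le> t"
  shows "(rderiv ^^ m) F t = (-1) ^ m * ((2 * pi) ^ m / K * g t)"
proof -
  let ?c = "(2 * pi) ^ m / K"
  \<comment> \<open>Equality of the line integrals determines \<open>F\<close> pointwise on [0,
    \<infinity>); its differentiability is inherited from \<open>tail_iter\<close>.\<close>
  have val: "F t = ?c * tail_iter g m t" if "0 \<le> t" for t
  proof -
    have "ennreal (K * F t) = ennreal ((2 * pi) ^ m * tail_iter g m t)"
      using line_int_even[OF \<phi> that] F(2)[OF that] by simp
    moreover have "0 \<le> tail_iter g m t" using tail_iter_aux that by blast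
    ultimately have "K * F t = (2 * pi) ^ m * tail_iter g m t"
      using F(1)[OF that] K by (simp add: ennreal_inj)
    then show ?thesis using K by (simp add: field_simps)
  qed
  have "(rderiv ^^ m) F t = (-1) ^ m * (\<lambda>j t. ?c * tail_iter g j t) (m - m) t"
  proof (rule rderiv_funpow_chain[where m=m and u="\<lambda>j t. ?c * tail_iter g j t"])
    fix j and t :: real
    assume "0 \<le> t"
    then show "((\<lambda>t. ?c * tail_iter g (Suc j) t) has_real_derivative - (?c * tail_iter g j t)) (at t within {0..})"
      using DERIV_cmult[OF tail_iter_deriv[of t j], of ?c] by simp
  qed (use val t in auto)
  then show ?thesis by simp
qed

end

section \<open>Inverting fractional integration of integer and half-integer order\<close>

context tail_density
begin

lemma tail_lipschitz: "r \<le> r' \<Longrightarrow> 0 \<le> r \<Longrightarrow> \<bar>tail r - tail r'\<bar> \<le> B * \<bar>r - r'\<bar>"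
proof -
  assume r: "r \<le> r'" "0 \<le> r"
  have int: "integrable lborel (\<lambda>s. indicator {a<..} s * \<theta> s)" if "0 \<le> a" for a
    using integrable_density_mult[of "\<lambda>_. 1" a 1] that by (simp add: mult.commute)
  have "tail r - tail r' = (\<integral>s. indicator {r<..} s * \<theta> s - indicator {r'<..} s * \<theta> s \<partial>lborel)"
    unfolding tail_def using int r by simp
  also have "\<dots> = (\<integral>s. indicator {r<..r'} s * \<theta> s \<partial>lborel)"
    using r by (intro Bochner_Integration.integral_cong) (auto simp: indicator_def)
  finally have eq: "tail r - tail r' = (\<integral>s. indicator {r<..r'} s * \<theta> s \<partial>lborel)" .
  have "0 \<le> tail r - tail r'" unfolding eq using density_nonneg by (intro Bochner_Integration.integral_nonneg) auto
  moreover have "tail r - tail r' \<le> (\<integral>s. B * indicator {r<..r'} s \<partial>lborel)"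
    unfolding eq
  proof (rule integral_mono)
    show "integrable lborel (\<lambda>s. indicator {r<..r'} s * \<theta> s)"
    proof -
      have "(\<lambda>s. indicator {r<..r'} s * \<theta> s) = (\<lambda>s. indicator {r<..} s * \<theta> s - indicator {r'<..} s * \<theta> s)"
        using r by (auto simp: fun_eq_iff indicator_def)
      then show ?thesis using int[of r] int[of r'] r by simp
    qed
    show "integrable lborel (\<lambda>s. B * indicator {r<..r'} s)" using r by simp
    show "indicator {r<..r'} s * \<theta> s \<le> B * indicator {r<..r'} s" for s
      using density_le[of s] by (simp add: indicator_def)
  qed
  ultimately show ?thesis using r by simp
qed

lemma continuous_on_tail_sqrt: "continuous_on {0..} (\<lambda>t. tail (sqrt (2 * t)))"
proof -
  have "B-lipschitz_on {0..} tail"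
  proof (rule lipschitz_onI)
    fix r r' :: real assume "r \<in> {0..}" "r' \<in> {0..}"
    then show "dist (tail r) (tail r') \<le> B * dist r r'"
      unfolding dist_real_def using tail_lipschitz[of r r'] tail_lipschitz[of r' r]
      by (cases "r \<le> r'") (auto simp: abs_minus_commute)
  qed (rule bound_nonneg)
  then have "continuous_on {0..} tail" by (rule lipschitz_on_continuous_on)
  moreover have "continuous_on {0..} (\<lambda>t::real. sqrt (2 * t))" by (intro continuous_intros)
  ultimately show ?thesis by (rule continuous_on_compose2) auto
qed

lemma tail_iteration_tail: "tail_iteration (\<lambda>t. tail (sqrt (2 * t)))"
proof
  fix t :: real assume "2 \<le> t"
  then have "sqrt (2\<^sup>2) \<le> sqrt (2 * t)" by (intro real_sqrt_le_mono) simp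
  then show "tail (sqrt (2 * t)) = 0" by (intro tail_zero) simp
qed (auto intro: continuous_on_tail_sqrt tail_nonneg)

lemma tail_iteration_root_mean: "tail_iteration root_mean"
  by standard (auto intro: continuous_on_root_mean root_mean_nonneg root_mean_zero)

text \<open>For integer order the fractional remainder has order 0 and only the m derivatives act.
  The factor is (2 pi)^m / K because 2 m line integrals are (2 pi)^m times the integral of order
  m.\<close>

lemma Iop_even:
  assumes \<psi>: "\<psi> \<in> borel_measurable borel" "\<And>t. 0 \<le> t \<Longrightarrow> \<psi> t = ennreal (tail (sqrt (2 * t)))"
    and F: "\<And>t. 0 \<le> t \<Longrightarrow> 0 \<le> F t" "\<And>t. 0 \<le> t \<Longrightarrow> (line_int ^^ (2 * m)) \<psi> t = ennreal (K * F t)" and K: "0 < K"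
    and t: "0 \<le> t"
  shows "Iop (- real m) F t = (2 * pi) powr (real m) / K * tail (sqrt (2 * t))"
proof -
  interpret T: tail_iteration "\<lambda>t. tail (sqrt (2 * t))" by (rule tail_iteration_tail)
  \<comment> \<open>m = 0 falls into the branch of nonnegative orders in \<open>Iop\<close>, every
    other m into the second branch; both end in \<open>frac_int 0\<close>.\<close>
  have "Iop (- real m) F t = neg_deriv m F t"
    by (cases "m = 0") (simp_all add: Iop_def frac_int_def neg_deriv_def)
  also have "\<dots> = (2 * pi) ^ m / K * tail (sqrt (2 * t))"
  proof -
    have "(rderiv ^^ m) F t = (-1) ^ m * ((2 * pi) ^ m / K * tail (sqrt (2 * t)))"
      by (rule T.rderiv_even[OF \<psi> F K t])
    then show ?thesis unfolding neg_deriv_def by (simp only: minus_one_power_cancel)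
  qed
  finally show ?thesis by (subst powr_realpow) simp_all
qed

text \<open>One line integral turns the tail into \<open>root_mean\<close>; m derivatives undo the
  remaining pairs, one more gives \<open>chi\<close> up to sign, and the integral of order 1/2 leads
  back to the tail by \<open>Abel_chi\<close>.\<close>

lemma Iop_odd:
  assumes \<psi>: "\<psi> \<in> borel_measurable borel" "\<And>t. 0 \<le> t \<Longrightarrow> \<psi> t = ennreal (tail (sqrt (2 * t)))"
    and F: "\<And>t. 0 \<le> t \<Longrightarrow> 0 \<le> F t" "\<And>t. 0 \<le> t \<Longrightarrow> (line_int ^^ Suc (2 * m)) \<psi> t = ennreal (K * F t)" and K: "0 < K"
    and t: "0 \<le> t"
  shows "Iop (- (real m + 1/2)) F t = (2 * pi) powr (real m + 1/2) / K * tail (sqrt (2 * t))"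
proof -
  interpret T: tail_iteration root_mean by (rule tail_iteration_root_mean)
  define c where "c = (2 * pi) ^ m / K"
  have der: "(rderiv ^^ m) F t = (-1) ^ m * (c * root_mean t)" if "0 \<le> t" for t
    unfolding c_def
  proof (rule T.rderiv_even[where \<phi>="line_int \<psi>"])
    show "line_int \<psi> \<in> borel_measurable borel" using \<psi>(1) by measurable
    show "line_int \<psi> t = ennreal (root_mean t)" if "0 \<le> t" for t by (rule line_int_tail[OF \<psi> that])
    show "(line_int ^^ (2 * m)) (line_int \<psi>) t = ennreal (K * F t)" if "0 \<le> t" for t
      using F(2)[OF that] by (simp only: funpow_Suc_right comp_def)
  qed (use F K that in auto)
  \<comment> \<open>Stated for x > 0, where \<open>root_mean\<close> is known to be differentiable;
    the integral of order 1/2 at t \<ge> 0 evaluates the derivative only at x > t.\<close>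
  have nd: "neg_deriv (Suc m) F x = c * chi x" if "0 < x" for x
  proof -
    have "rderiv ((rderiv ^^ m) F) x = (-1) ^ m * (c * (- chi x))"
      using DERIV_cmult[OF DERIV_cmult[OF root_mean_deriv[OF that], of c], of "(-1) ^ m"] that der
      by (intro rderiv_eq_interior) auto
    then show ?thesis unfolding neg_deriv_def using minus_one_power_cancel[of m "c * chi x"] by simp
  qed
  \<comment> \<open>The ceiling rounds m + 1/2 up, so m + 1 derivatives are taken and an integral of
    order 1/2 is left.\<close>
  have ceil: "nat \<lceil>- (- (real m + 1/2))\<rceil> = Suc m"
  proof -
    have "\<lceil>real m + 1/2\<rceil> = int m + 1" by (rule ceiling_unique) auto
    then show ?thesis by (simp add: add.commute)
  qed
  have "Iop (- (real m + 1/2)) F t = frac_int (1/2) (neg_deriv (Suc m) F) t"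
    unfolding Iop_def ceil by simp
  also have "\<dots> = (\<integral>x. c / sqrt pi * (indicator {t<..} x * ((x - t) powr (-1/2) * chi x)) \<partial>lborel)"
  proof -
    have "frac_int (1/2) (neg_deriv (Suc m) F) t =
      (\<integral>x. indicator {t<..} x * ((x - t) powr (1/2 - 1) / Gamma (1/2) * neg_deriv (Suc m) F x) \<partial>lborel)"
      unfolding frac_int_def by simp
    also have "\<dots> = (\<integral>x. c / sqrt pi * (indicator {t<..} x * ((x - t) powr (-1/2) * chi x)) \<partial>lborel)"
    proof (rule Bochner_Integration.integral_cong[OF refl])
      fix x
      show "indicator {t<..} x * ((x - t) powr (1/2 - 1) / Gamma (1/2) * neg_deriv (Suc m) F x)
        = c / sqrt pi * (indicator {t<..} x * ((x - t) powr (-1/2) * chi x))"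
        using nd[of x] t by (cases "t < x") (simp_all add: Gamma_one_half_real)
    qed
    finally show ?thesis .
  qed
  also have "\<dots> = c / sqrt pi * (\<integral>x. indicator {t<..} x * ((x - t) powr (-1/2) * chi x) \<partial>lborel)"
    by (rule integral_mult_right_zero)
  also have "(\<integral>x. indicator {t<..} x * ((x - t) powr (-1/2) * chi x) \<partial>lborel) = sqrt 2 * pi * tail (sqrt (2 * t))"
  proof (rule has_bochner_integral_integral_eq, rule has_bochner_integral_nn_integral)
    have "ennreal (indicator {t<..} x * ((x - t) powr (-1/2) * chi x)) = indicator {t<..} x * ennreal ((x - t) powr (-1/2) * chi x)" for x
      by (simp add: indicator_def)
    then show "(\<integral>\<^sup>+x. ennreal (indicator {t<..} x * ((x - t) powr (-1/2) * chi x)) \<partial>lborel) = ennreal (sqrt 2 * pi * tail (sqrt (2 * t)))"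
      using Abel_chi[OF t] by (simp only:)
  qed (auto simp: chi_nonneg tail_nonneg)
  also have "c / sqrt pi * (sqrt 2 * pi * tail (sqrt (2 * t))) = (2 * pi) powr (real m + 1/2) / K * tail (sqrt (2 * t))"
  proof -
    have "pi / sqrt pi = sqrt pi" by (rule real_div_sqrt) simp
    then have "c / sqrt pi * (sqrt 2 * pi * T) = c * (sqrt 2 * sqrt pi) * T" for T
      by (simp add: field_simps)
    moreover have "(2 * pi) powr (real m + 1/2) = (2 * pi) ^ m * (sqrt 2 * sqrt pi)"
      by (simp add: powr_add powr_realpow powr_half_sqrt real_sqrt_mult)
    ultimately show ?thesis unfolding c_def by simp
  qed
  finally show ?thesis .
qed

end

lemma f_selfconv_nn:
  assumes "0 \<le> l"
  shows "(\<integral>\<^sup>+s. ennreal (f_trunc l \<bar>s\<bar> * f_trunc l \<bar>r - s\<bar>) \<partial>lborel) = ennreal (f_selfconv l r)"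
  unfolding f_selfconv_def
proof (rule nn_integral_eq_integral)
  have le1: "f_trunc l x \<le> 1" for x
    using assms powr_mono2[of l "1 - x\<^sup>2" 1] by (auto simp: f_trunc_def pos_pow_def)
  have nn: "0 \<le> f_trunc l x" for x by (simp add: f_trunc_def pos_pow_def)
  show "AE x in lborel. 0 \<le> f_trunc l \<bar>x\<bar> * f_trunc l \<bar>r - x\<bar>" using nn by simp
  show "integrable lborel (\<lambda>s. f_trunc l \<bar>s\<bar> * f_trunc l \<bar>r - s\<bar>)"
  proof (rule Bochner_Integration.integrable_bound)
    show "integrable lborel (\<lambda>s. indicator {-1..1::real} s :: real)" by simp
    show "(\<lambda>s. f_trunc l \<bar>s\<bar> * f_trunc l \<bar>r - s\<bar>) \<in> borel_measurable lborel"
      unfolding f_trunc_def by measurable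
    show "AE s in lborel. norm (f_trunc l \<bar>s\<bar> * f_trunc l \<bar>r - s\<bar>) \<le> norm (indicator {-1..1::real} s :: real)"
    proof (rule AE_I2)
      fix s :: real
      show "norm (f_trunc l \<bar>s\<bar> * f_trunc l \<bar>r - s\<bar>) \<le> norm (indicator {-1..1::real} s :: real)"
      proof (cases "s \<in> {-1..1}")
        case True
        then show ?thesis using mult_le_one[OF le1 nn le1, of "\<bar>s\<bar>" "\<bar>r - s\<bar>"] nn by (simp add: abs_mult)
      next
        case False
        then have "1 \<le> \<bar>s\<bar>" by auto
        then have "1 \<le> s\<^sup>2" using abs_le_square_iff[of 1 s] by simp
        then show ?thesis by (simp add: f_trunc_def pos_pow_def)
      qed
    qed
  qed
qed

lemma f_selfconv_nonneg: "0 \<le> f_selfconv l r"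
  unfolding f_selfconv_def
  by (intro Bochner_Integration.integral_nonneg) (simp add: f_trunc_def pos_pow_def)

text \<open>The exponent l - k of P is the one that 2 k line integrals raise to l. Parity of n = 2 k
  decides between \<open>Iop_even\<close> and \<open>Iop_odd\<close>.\<close>

lemma wu_eq_autoconv:
  fixes k l :: real and x :: "'a::euclidean_space"
  assumes hk: "2 * k \<in> \<nat>" and hl: "0 \<le> l" and hkl: "k \<le> l" and hdim: "real DIM('a) = 2 * k + 1"
  shows "has_bochner_integral lborel (\<lambda>y. P_ker l k (x - y) * P_ker l k y) (wu l k (norm x))"
proof -
  define \<delta> where "\<delta> = l - k"
  define n where "n = DIM('a) - 1"
  have n: "real n = 2 * k" unfolding n_def using hdim DIM_positive[where 'a='a] by (simp add: of_nat_diff)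
  have \<delta>: "0 \<le> \<delta>" using hkl by (simp add: \<delta>_def)
  define p where "p t = ennreal (pos_pow (1 - 2 * t) \<delta>)" for t
  have [measurable]: "p \<in> borel_measurable borel" unfolding p_def by measurable
  obtain b :: 'a where b: "b \<in> Basis" using nonempty_Basis by blast
  obtain \<theta> B where \<theta>: "\<theta> \<in> borel_measurable borel" "\<And>s. 0 \<le> \<theta> s" "\<And>s. \<theta> s \<le> B" "\<And>s. 2 \<le> s \<Longrightarrow> \<theta> s = 0"
    and rep: "\<And>r. 0 \<le> r \<Longrightarrow> radial_autoconv p (r *\<^sub>R b) = (\<integral>\<^sup>+s. indicator {r<..} s * ennreal (\<theta> s) \<partial>lborel)"
    using radial_autoconv_density[OF b \<delta>] unfolding p_def by blast
  interpret tail_density \<theta> B by standard (rule \<theta>; assumption?)+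
  \<comment> \<open>The f-form of the autoconvolution, read off along the axis \<open>b\<close>;
    rotation invariance extends it to the whole space.\<close>
  define \<psi> where "\<psi> t = radial_autoconv p (sqrt (2 * t) *\<^sub>R b)" for t
  have \<psi>m: "\<psi> \<in> borel_measurable borel" unfolding \<psi>_def radial_autoconv_def by measurable
  have \<psi>_tail: "\<psi> t = ennreal (tail (sqrt (2 * t)))" if "0 \<le> t" for t
    unfolding \<psi>_def using rep[of "sqrt (2 * t)"] tail_nn[of "sqrt (2 * t)"] that by simp
  have \<psi>_norm: "radial_autoconv p y = \<psi> ((norm y)\<^sup>2 / 2)" for y :: 'a
    unfolding \<psi>_def using b by (intro radial_autoconv_cong_norm) auto
  define \<kappa> where "\<kappa> = pi powr (real n / 2) * Gamma (\<delta> + 1) / Gamma (\<delta> + real n / 2 + 1)"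
  have "\<delta> + real n / 2 = l" unfolding n \<delta>_def by simp
  then have q: "(line_int ^^ n) p t = ennreal (\<kappa> * pos_pow (1 - 2 * t) l)" for t
    unfolding p_def[abs_def] using line_int_funpow_pos_pow[of \<delta> n t] \<delta> by (simp add: \<kappa>_def)
  have Gpos: "Gamma (\<delta> + 1) > 0" "Gamma (l + 1) > 0" using \<delta> hl by (auto intro!: Gamma_real_pos)
  have \<kappa>: "\<kappa> = pi powr k * Gamma (\<delta> + 1) / Gamma (l + 1)" unfolding \<kappa>_def n \<delta>_def by simp
  have \<kappa>pos: "\<kappa> > 0" unfolding \<kappa> using Gpos by simp
  define F where "F = fform (f_selfconv l)"
  have F0: "0 \<le> F t" for t unfolding F_def fform_def by (rule f_selfconv_nonneg)
  have conv: "(line_int ^^ n) \<psi> t = ennreal (\<kappa>\<^sup>2 * F t)" if "0 \<le> t" for t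
  proof -
    define r where "r = sqrt (2 * t)"
    have r: "t = r\<^sup>2 / 2" unfolding r_def using that by simp
    have "(line_int ^^ n) \<psi> t = (\<integral>\<^sup>+s. (line_int ^^ n) p (s\<^sup>2 / 2) * (line_int ^^ n) p ((r - s)\<^sup>2 / 2) \<partial>lborel)"
      unfolding r n_def by (rule radial_autoconv_line_int[OF _ \<psi>m b \<psi>_norm]) measurable
    also have "\<dots> = (\<integral>\<^sup>+s. ennreal (\<kappa>\<^sup>2) * ennreal (f_trunc l \<bar>s\<bar> * f_trunc l \<bar>r - s\<bar>) \<partial>lborel)"
    proof (rule nn_integral_cong)
      fix s
      have "ennreal (\<kappa> * u) * ennreal (\<kappa> * v) = ennreal (\<kappa>\<^sup>2) * ennreal (u * v)" if "0 \<le> u" "0 \<le> v" for u v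
        using that \<kappa>pos by (simp add: power2_eq_square ac_simps flip: ennreal_mult')
      from this[OF pos_pow_nonneg pos_pow_nonneg, of "1 - s\<^sup>2" l "1 - (r - s)\<^sup>2" l]
      show "(line_int ^^ n) p (s\<^sup>2 / 2) * (line_int ^^ n) p ((r - s)\<^sup>2 / 2) = ennreal (\<kappa>\<^sup>2) * ennreal (f_trunc l \<bar>s\<bar> * f_trunc l \<bar>r - s\<bar>)"
        unfolding q by (simp add: f_trunc_def)
    qed
    also have "\<dots> = ennreal (\<kappa>\<^sup>2) * ennreal (f_selfconv l r)"
      unfolding f_selfconv_nn[OF hl, symmetric] by (rule nn_integral_cmult) (simp add: f_trunc_def)
    finally show ?thesis by (simp add: F_def fform_def r_def ennreal_mult')
  qed
  have \<kappa>2: "0 < \<kappa>\<^sup>2" using \<kappa>pos by simp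
  have Iop: "Iop (-k) F t = (2 * pi) powr k / \<kappa>\<^sup>2 * tail (sqrt (2 * t))" if t: "0 \<le> t" for t
  proof (cases "even n")
    case True
    then obtain m where m: "n = 2 * m" by blast
    then have "k = real m" using n by simp
    then show ?thesis using Iop_even[OF \<psi>m \<psi>_tail F0 _ \<kappa>2 t, of m] conv by (simp add: m)
  next
    case False
    then obtain m where m: "n = Suc (2 * m)" using oddE by fastforce
    then have "k = real m + 1/2" using n by simp
    then show ?thesis using Iop_odd[OF \<psi>m \<psi>_tail F0 _ \<kappa>2 t, of m] conv by (simp only: m)
  qed
  define c where "c = Gamma (l + 1) / Gamma (l - k + 1) * (2 / pi) powr (k / 2)"
  have cpos: "c \<ge> 0" unfolding c_def using Gpos by (simp add: \<delta>_def)
  \<comment> \<open>The Gamma quotients of \<open>c\<close> and \<open>\<kappa>\<close> are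
    reciprocal, and the remaining powers combine to (2 pi)^k after squaring.\<close>
  have cc: "(2 * pi) powr k / \<kappa>\<^sup>2 = c\<^sup>2"
  proof -
    have "c * \<kappa> = (2 / pi) powr (k / 2) * pi powr k"
      unfolding c_def \<kappa> using Gpos by (simp add: \<delta>_def)
    then have "(c * \<kappa>)\<^sup>2 = ((2 / pi) powr (k / 2))\<^sup>2 * (pi powr k)\<^sup>2" by (simp add: power_mult_distrib)
    also have "\<dots> = (2 / pi) powr k * (pi powr k * pi powr k)"
      by (simp add: power2_eq_square flip: powr_add)
    also have "\<dots> = (2 * pi) powr k" by (simp add: powr_divide powr_mult)
    finally show ?thesis using \<kappa>pos by (simp add: power_mult_distrib field_simps)
  qed
  have wu: "wu l k (norm x) = c\<^sup>2 * tail (norm x)"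
    unfolding wu_def fform_inv_def F_def[symmetric] using Iop[of "(norm x)\<^sup>2 / 2"] cc by simp
  have Pnn: "0 \<le> P_ker l k y" for y :: 'a
    unfolding P_ker_def c_def[symmetric] using cpos pos_pow_nonneg by simp
  have "(\<integral>\<^sup>+y. ennreal (P_ker l k (x - y) * P_ker l k y) \<partial>lborel)
    = (\<integral>\<^sup>+y. ennreal (c\<^sup>2) * (p ((norm y)\<^sup>2 / 2) * p ((norm (x - y))\<^sup>2 / 2)) \<partial>lborel)"
  proof (rule nn_integral_cong)
    fix y
    have "ennreal ((c * u) * (c * v)) = ennreal (c\<^sup>2) * (ennreal v * ennreal u)" if "0 \<le> u" "0 \<le> v" for u v
      using that cpos by (simp add: power2_eq_square ac_simps flip: ennreal_mult')
    from this[OF pos_pow_nonneg pos_pow_nonneg, of "1 - (norm (x - y))\<^sup>2" \<delta> "1 - (norm y)\<^sup>2" \<delta>]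
    show "ennreal (P_ker l k (x - y) * P_ker l k y) = ennreal (c\<^sup>2) * (p ((norm y)\<^sup>2 / 2) * p ((norm (x - y))\<^sup>2 / 2))"
      unfolding P_ker_def c_def[symmetric] unfolding \<delta>_def[symmetric] p_def by simp
  qed
  also have "\<dots> = ennreal (c\<^sup>2) * radial_autoconv p x"
    unfolding radial_autoconv_def by (rule nn_integral_cmult) measurable
  also have "\<dots> = ennreal (wu l k (norm x))"
    unfolding \<psi>_norm wu using \<psi>_tail[of "(norm x)\<^sup>2 / 2"] by (simp add: ennreal_mult')
  finally show ?thesis
    by (intro has_bochner_integral_nn_integral) (auto simp: wu Pnn tail_nonneg, simp add: P_ker_def)
qed

section \<open>Fourier transform and injectivity of the convolution operator\<close>

lemma lborel_swap:
  fixes f :: "'a::euclidean_space \<Rightarrow> 'b::euclidean_space \<Rightarrow> 'c::{banach, second_countable_topology}"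
  assumes meas [measurable]: "(\<lambda>(x, y). f x y) \<in> borel_measurable (lborel \<Otimes>\<^sub>M lborel)"
    and A: "integrable lborel (A :: 'a \<Rightarrow> real)" and B: "integrable lborel (B :: 'b \<Rightarrow> real)"
    and le: "\<And>x y. norm (f x y) \<le> A x * B y"
  shows "(\<integral>x. \<integral>y. f x y \<partial>lborel \<partial>lborel) = (\<integral>y. \<integral>x. f x y \<partial>lborel \<partial>lborel)"
proof -
  have [measurable]: "A \<in> borel_measurable lborel" "B \<in> borel_measurable lborel" using A B by auto
  have "integrable (lborel \<Otimes>\<^sub>M lborel) (\<lambda>(x, y). A x * B y)"
    by (rule lborel_pair.Fubini_integrable) (use A B in \<open>auto simp: abs_mult\<close>)
  then have "integrable (lborel \<Otimes>\<^sub>M lborel) (\<lambda>(x, y). f x y)"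
    by (rule Bochner_Integration.integrable_bound) (auto intro!: AE_I2 order_trans[OF le])
  then show ?thesis by (rule lborel_pair.Fubini_integral[symmetric])
qed

text \<open>Non-integrable functions are covered, since their Bochner integral is 0 by
  convention.\<close>

lemma ennreal_norm_integral_le:
  fixes f :: "'a \<Rightarrow> 'b::{banach, second_countable_topology}"
  shows "ennreal (norm (\<integral>x. f x \<partial>M)) \<le> (\<integral>\<^sup>+x. ennreal (norm (f x)) \<partial>M)"
  by (cases "integrable M f") (auto simp: integral_norm_bound_ennreal not_integrable_integral_eq)

lemma integral_lborel_affine_zero:
  fixes f :: "'a::euclidean_space \<Rightarrow> real"
  assumes [measurable]: "f \<in> borel_measurable borel" and "c \<noteq> 0" and "(\<integral>x. f x \<partial>lborel) = 0"
  shows "(\<integral>x. f (t + c *\<^sub>R x) \<partial>lborel) = 0"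
proof -
  have "(\<integral>x. f x \<partial>lborel) = (\<integral>x. f x \<partial>density (distr lborel borel (\<lambda>x. t + c *\<^sub>R x)) (\<lambda>x. ennreal (\<bar>c\<bar> ^ DIM('a))))"
    using lborel_affine[OF assms(2), where t=t] by simp
  also have "\<dots> = \<bar>c\<bar> ^ DIM('a) * (\<integral>x. f (t + c *\<^sub>R x) \<partial>lborel)"
    by (subst integral_density) (auto simp: integral_distr)
  finally show ?thesis using assms by simp
qed

lemma integrable_lborel_shift:
  fixes f :: "'a::euclidean_space \<Rightarrow> real"
  assumes "integrable lborel f"
  shows "integrable lborel (\<lambda>x. f (x - c))" and "integrable lborel (\<lambda>x. f (c - x))"
proof -
  have [measurable]: "f \<in> borel_measurable borel" using assms by auto
  have fin: "(\<integral>\<^sup>+x. ennreal (norm (f x)) \<partial>lborel) < \<infinity>" using assms by (simp add: integrable_iff_bounded)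
  show "integrable lborel (\<lambda>x. f (x - c))"
    by (rule integrableI_bounded) (use fin nn_integral_lborel_shift(2)[of "\<lambda>x. ennreal (norm (f x))" c] in auto)
  show "integrable lborel (\<lambda>x. f (c - x))"
    by (rule integrableI_bounded) (use fin nn_integral_lborel_shift(3)[of "\<lambda>x. ennreal (norm (f x))" c] in auto)
qed

text \<open>\<open>\<sigma>\<close> is the inverse width, so the Fourier transform is a multiple of
  \<open>gauss (1 / \<sigma>)\<close>. The maximum is 1 rather than the mass.\<close>

definition gauss :: "real \<Rightarrow> 'a::euclidean_space \<Rightarrow> real" where
  "gauss \<sigma> x = exp (- (\<sigma> * norm x)\<^sup>2 / 2)"

lemma gauss_pos: "0 < gauss \<sigma> x"
  by (simp add: gauss_def)

lemma gauss_nonneg [simp]: "0 \<le> gauss \<sigma> x"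
  by (simp add: gauss_def)

lemma abs_gauss [simp]: "\<bar>gauss \<sigma> x\<bar> = gauss \<sigma> x"
  by simp

lemma gauss_le_1: "gauss \<sigma> x \<le> 1"
  by (simp add: gauss_def)

lemma borel_measurable_gauss [measurable]: "gauss \<sigma> \<in> borel_measurable borel"
  unfolding gauss_def[abs_def] by measurable

lemma borel_measurable_cis [measurable]: "cis \<in> borel_measurable borel"
  by (intro borel_measurable_continuous_onI continuous_intros)

lemma cis_sum: "finite S \<Longrightarrow> cis (sum h S) = (\<Prod>b\<in>S. cis (h b))"
  by (induction S rule: finite_induct) (auto simp flip: cis_mult)

text \<open>\<sigma> = 1 is the characteristic function of the standard normal law without its
  normalisation; the general case follows by scaling w.\<close>

lemma gauss_integral_real:
  assumes "0 < \<sigma>"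
  shows "integrable lborel (\<lambda>w::real. exp (- (\<sigma> * w)\<^sup>2 / 2) *\<^sub>R cis (w * t))"
    and "(\<integral>w. exp (- (\<sigma> * w)\<^sup>2 / 2) *\<^sub>R cis (w * t) \<partial>lborel) = of_real (sqrt (2 * pi) / \<sigma> * exp (- (t / \<sigma>)\<^sup>2 / 2))"
proof -
  have std: "integrable lborel (\<lambda>x::real. exp (- x\<^sup>2 / 2))"
  proof -
    have "integrable lborel (\<lambda>x. sqrt (2 * pi) * std_normal_density x)"
      using integrable_normal_density[of 1 0] by simp
    then show ?thesis by (simp add: normal_density_def)
  qed
  have int1: "integrable lborel (\<lambda>x::real. exp (- x\<^sup>2 / 2) *\<^sub>R cis (x * s))" for s
    by (rule Bochner_Integration.integrable_bound[OF std]) auto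
  have val1: "(\<integral>x. exp (- x\<^sup>2 / 2) *\<^sub>R cis (x * s) \<partial>lborel) = of_real (sqrt (2 * pi) * exp (- s\<^sup>2 / 2))" for s
  proof -
    have "of_real (exp (- s\<^sup>2 / 2)) = char std_normal_distribution s"
      by (simp add: char_std_normal_distribution)
    also have "\<dots> = (\<integral>x. std_normal_density x *\<^sub>R cis (s * x) \<partial>lborel)"
      unfolding char_def
      by (subst integral_density) (auto simp: cis_conv_exp mult.commute)
    also have "\<dots> = (\<integral>x. (1 / sqrt (2 * pi)) *\<^sub>R (exp (- x\<^sup>2 / 2) *\<^sub>R cis (x * s)) \<partial>lborel)"
      by (simp add: normal_density_def mult.commute)
    also have "\<dots> = (1 / sqrt (2 * pi)) *\<^sub>R (\<integral>x. exp (- x\<^sup>2 / 2) *\<^sub>R cis (x * s) \<partial>lborel)"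
      by (rule integral_scaleR_right)
    finally have "sqrt (2 * pi) *\<^sub>R of_real (exp (- s\<^sup>2 / 2)) = (\<integral>x. exp (- x\<^sup>2 / 2) *\<^sub>R cis (x * s) \<partial>lborel)"
      by simp
    then show ?thesis by (simp add: scaleR_conv_of_real)
  qed
  let ?f = "\<lambda>w. exp (- (\<sigma> * w)\<^sup>2 / 2) *\<^sub>R cis (w * t)"
  have f: "?f (0 + (1 / \<sigma>) * x) = exp (- x\<^sup>2 / 2) *\<^sub>R cis (x * (t / \<sigma>))" for x
    using assms by simp
  show "integrable lborel ?f"
    using int1[of "t / \<sigma>"] lborel_integrable_real_affine_iff[of "1 / \<sigma>" ?f 0] assms unfolding f by simp
  have "(\<integral>w. ?f w \<partial>lborel) = \<bar>1 / \<sigma>\<bar> *\<^sub>R (\<integral>x. ?f (0 + (1 / \<sigma>) * x) \<partial>lborel)"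
    using assms by (intro lborel_integral_real_affine) auto
  also have "\<dots> = of_real (sqrt (2 * pi) / \<sigma> * exp (- (t / \<sigma>)\<^sup>2 / 2))"
    unfolding f val1 using assms by (simp add: scaleR_conv_of_real)
  finally show "(\<integral>w. ?f w \<partial>lborel) = of_real (sqrt (2 * pi) / \<sigma> * exp (- (t / \<sigma>)\<^sup>2 / 2))" .
qed

lemma gauss_fourier:
  fixes x :: "'a::euclidean_space"
  assumes "0 < \<sigma>"
  shows "integrable lborel (\<lambda>w. gauss \<sigma> w *\<^sub>R cis (w \<bullet> x))"
    and "(\<integral>w. gauss \<sigma> w *\<^sub>R cis (w \<bullet> x) \<partial>lborel) = of_real ((sqrt (2 * pi) / \<sigma>) ^ DIM('a) * gauss (1 / \<sigma>) x)"
proof -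
  let ?h = "\<lambda>b w::real. exp (- (\<sigma> * w)\<^sup>2 / 2) *\<^sub>R cis (w * (x \<bullet> b))"
  have prodexp: "(\<Prod>b\<in>(Basis::'a set). exp (- (s * (y b))\<^sup>2 / 2)) = exp (- (s\<^sup>2 * (\<Sum>b\<in>Basis. (y b)\<^sup>2)) / 2)"
    for s :: real and y :: "'a \<Rightarrow> real"
    by (subst exp_sum[symmetric]) (auto simp: sum_negf power_mult_distrib sum_distrib_left simp flip: sum_divide_distrib)
  have comp: "(\<Sum>b\<in>Basis. f b *\<^sub>R b) \<bullet> i = f i" if "i \<in> Basis" for f and i :: 'a
    using that by (simp add: inner_sum_left_Basis)
  have nrm: "(norm y)\<^sup>2 = (\<Sum>b\<in>Basis. (y \<bullet> b)\<^sup>2)" for y :: 'a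
    unfolding power2_norm_eq_inner by (subst euclidean_inner) (simp add: power2_eq_square)
  have eq: "gauss \<sigma> (\<Sum>b\<in>Basis. f b *\<^sub>R b) *\<^sub>R cis ((\<Sum>b\<in>Basis. f b *\<^sub>R b) \<bullet> x) = (\<Prod>b\<in>Basis. ?h b (f b))" for f :: "'a \<Rightarrow> real"
  proof -
    have "gauss \<sigma> (\<Sum>b\<in>Basis. f b *\<^sub>R b) = (\<Prod>b\<in>Basis. exp (- (\<sigma> * f b)\<^sup>2 / 2))"
      unfolding gauss_def prodexp by (simp add: power_mult_distrib nrm comp)
    moreover have "cis ((\<Sum>b\<in>Basis. f b *\<^sub>R b) \<bullet> x) = (\<Prod>b\<in>Basis. cis (f b * (x \<bullet> b)))"
      by (simp add: inner_sum_left inner_commute[of x] cis_sum)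
    ultimately show ?thesis by (simp add: scaleR_conv_of_real prod.distrib)
  qed
  have int: "integrable (Pi\<^sub>M Basis (\<lambda>_. lborel)) (\<lambda>f. \<Prod>b\<in>(Basis::'a set). ?h b (f b))"
    by (rule lborel_product.product_integrable_prod[OF finite_Basis gauss_integral_real(1)[OF assms]])
  have val: "(\<integral>f. (\<Prod>b\<in>(Basis::'a set). ?h b (f b)) \<partial>Pi\<^sub>M Basis (\<lambda>_. lborel)) = (\<Prod>b\<in>Basis. \<integral>w. ?h b w \<partial>lborel)"
    by (rule lborel_product.product_integral_prod[OF finite_Basis gauss_integral_real(1)[OF assms]])
  show "integrable lborel (\<lambda>w. gauss \<sigma> w *\<^sub>R cis (w \<bullet> x))"
    by (subst lborel_eq, subst integrable_distr_eq) (use int in \<open>auto simp: eq\<close>)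
  have "(\<integral>w. gauss \<sigma> w *\<^sub>R cis (w \<bullet> x) \<partial>lborel) = (\<integral>f. (\<Prod>b\<in>(Basis::'a set). ?h b (f b)) \<partial>Pi\<^sub>M Basis (\<lambda>_. lborel))"
    by (subst lborel_eq, subst integral_distr) (auto simp: eq)
  also have "\<dots> = of_real (\<Prod>b\<in>(Basis::'a set). sqrt (2 * pi) / \<sigma> * exp (- ((1 / \<sigma>) * (x \<bullet> b))\<^sup>2 / 2))"
    unfolding val gauss_integral_real(2)[OF assms] by (simp add: of_real_prod)
  also have "(\<Prod>b\<in>(Basis::'a set). sqrt (2 * pi) / \<sigma> * exp (- ((1 / \<sigma>) * (x \<bullet> b))\<^sup>2 / 2)) = (sqrt (2 * pi) / \<sigma>) ^ DIM('a) * gauss (1 / \<sigma>) x"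
    unfolding prod.distrib prodexp gauss_def nrm[symmetric] by (simp add: power_mult_distrib power_divide)
  finally show "(\<integral>w. gauss \<sigma> w *\<^sub>R cis (w \<bullet> x) \<partial>lborel) = of_real ((sqrt (2 * pi) / \<sigma>) ^ DIM('a) * gauss (1 / \<sigma>) x)" .
qed

lemma integrable_gauss: "0 < \<sigma> \<Longrightarrow> integrable lborel (gauss \<sigma> :: 'a::euclidean_space \<Rightarrow> real)"
  using integrable_norm[OF gauss_fourier(1)[of \<sigma> "0::'a"]] by (simp add: gauss_pos less_imp_le)

text \<open>Without normalising constant, so convolutions become products with no extra
  factor.\<close>

definition ft :: "('a::euclidean_space \<Rightarrow> real) \<Rightarrow> 'a \<Rightarrow> complex" where
  "ft u w = (\<integral>x. u x *\<^sub>R cis (x \<bullet> w) \<partial>lborel)"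

lemma borel_measurable_ft [measurable]:
  assumes [measurable]: "u \<in> borel_measurable borel"
  shows "ft u \<in> borel_measurable borel"
  unfolding ft_def[abs_def] by measurable

lemma norm_ft_le: "cmod (ft u w) \<le> (\<integral>x. \<bar>u x\<bar> \<partial>lborel)"
  unfolding ft_def by (rule order_trans[OF integral_norm_bound]) simp

text \<open>Fubini moves the transform from \<open>u\<close> to the Gaussian. This takes the place
  of Fourier inversion: Gaussian means of \<open>u\<close> are read off from
  \<open>ft u\<close>.\<close>

lemma gauss_pairing:
  fixes u :: "'a::euclidean_space \<Rightarrow> real"
  assumes u: "integrable lborel u" and "0 < \<sigma>"
  shows "(\<integral>w. gauss \<sigma> w *\<^sub>R (ft u w * cis (- (a \<bullet> w))) \<partial>lborel)
    = of_real ((sqrt (2 * pi) / \<sigma>) ^ DIM('a) * (\<integral>x. u x * gauss (1 / \<sigma>) (x - a) \<partial>lborel))"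
proof -
  have [measurable]: "u \<in> borel_measurable borel" using u by auto
  let ?F = "\<lambda>w x. (gauss \<sigma> w * u x) *\<^sub>R cis (w \<bullet> (x - a))"
  have "(\<integral>w. gauss \<sigma> w *\<^sub>R (ft u w * cis (- (a \<bullet> w))) \<partial>lborel) = (\<integral>w. \<integral>x. ?F w x \<partial>lborel \<partial>lborel)"
  proof (rule Bochner_Integration.integral_cong[OF refl])
    fix w
    have "?F w x = (gauss \<sigma> w *\<^sub>R cis (- (a \<bullet> w))) * (u x *\<^sub>R cis (x \<bullet> w))" for x
    proof -
      have "cis (w \<bullet> (x - a)) = cis (- (a \<bullet> w)) * cis (x \<bullet> w)"
        by (simp add: cis_mult inner_diff_right inner_commute)
      then show ?thesis by (simp add: scaleR_conv_of_real)
    qed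
    then have "(\<integral>x. ?F w x \<partial>lborel) = (gauss \<sigma> w *\<^sub>R cis (- (a \<bullet> w))) * ft u w"
      unfolding ft_def by (simp only: integral_mult_right_zero)
    then show "gauss \<sigma> w *\<^sub>R (ft u w * cis (- (a \<bullet> w))) = (\<integral>x. ?F w x \<partial>lborel)"
      by (simp add: mult.commute)
  qed
  also have "\<dots> = (\<integral>x. \<integral>w. ?F w x \<partial>lborel \<partial>lborel)"
  proof (rule lborel_swap[OF _ integrable_gauss[OF assms(2)] integrable_abs[OF u]])
    show "norm (?F w x) \<le> gauss \<sigma> w * \<bar>u x\<bar>" for w x
      by (simp add: abs_mult gauss_pos less_imp_le)
  qed measurable
  also have "\<dots> = (\<integral>x. of_real ((sqrt (2 * pi) / \<sigma>) ^ DIM('a) * (u x * gauss (1 / \<sigma>) (x - a))) \<partial>lborel)"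
  proof (rule Bochner_Integration.integral_cong[OF refl])
    fix x
    have "(\<integral>w. ?F w x \<partial>lborel) = (\<integral>w. of_real (u x) * (gauss \<sigma> w *\<^sub>R cis (w \<bullet> (x - a))) \<partial>lborel)"
      by (simp add: scaleR_conv_of_real ac_simps)
    also have "\<dots> = of_real (u x) * (\<integral>w. gauss \<sigma> w *\<^sub>R cis (w \<bullet> (x - a)) \<partial>lborel)"
      by (rule integral_mult_right_zero)
    finally show "(\<integral>w. ?F w x \<partial>lborel) = of_real ((sqrt (2 * pi) / \<sigma>) ^ DIM('a) * (u x * gauss (1 / \<sigma>) (x - a)))"
      unfolding gauss_fourier(2)[OF assms(2)] by (simp add: ac_simps)
  qed
  finally show ?thesis by (simp only: integral_complex_of_real integral_mult_right_zero)
qed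

text \<open>The Gaussian weight makes all integrals absolutely convergent. Expanding one factor of
  |ft u|^2 and using \<open>gauss_pairing\<close> leaves a double integral of u(a) u(x) against a
  Gaussian in x - a, which is at most the Gaussian mass times the squared norm of
  \<open>u\<close>.\<close>

lemma weighted_plancherel:
  fixes u :: "'a::euclidean_space \<Rightarrow> real"
  assumes u: "integrable lborel u" and u2: "sq_integrable u" and "0 < \<sigma>"
  shows "integrable lborel (\<lambda>w. gauss \<sigma> w * (cmod (ft u w))\<^sup>2)"
    and "(\<integral>w. gauss \<sigma> w * (cmod (ft u w))\<^sup>2 \<partial>lborel)
      \<le> (sqrt (2 * pi) / \<sigma>) ^ DIM('a) * (\<integral>x. gauss (1 / \<sigma>) (x :: 'a) \<partial>lborel) * (\<integral>x. (u x)\<^sup>2 \<partial>lborel)"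
proof -
  have [measurable]: "u \<in> borel_measurable borel" using u by auto
  define C where "C = (sqrt (2 * pi) / \<sigma>) ^ DIM('a)"
  define L where "L = (\<integral>x. \<bar>u x\<bar> \<partial>lborel)"
  have L: "0 \<le> L" unfolding L_def by simp
  have C: "0 \<le> C" unfolding C_def using assms by simp
  let ?g = "gauss (1 / \<sigma>) :: 'a \<Rightarrow> real"
  show int: "integrable lborel (\<lambda>w. gauss \<sigma> w * (cmod (ft u w))\<^sup>2)"
  proof (rule Bochner_Integration.integrable_bound)
    show "integrable lborel (\<lambda>w::'a. gauss \<sigma> w * L\<^sup>2)" using integrable_gauss[OF assms(3), where 'a='a] by simp
    show "AE w in lborel. norm (gauss \<sigma> w * (cmod (ft u w))\<^sup>2) \<le> norm (gauss \<sigma> w * L\<^sup>2)"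
      using norm_ft_le[of u] L unfolding L_def[symmetric]
      by (intro AE_I2) (auto simp: abs_mult gauss_pos less_imp_le intro!: mult_left_mono power_mono)
  qed measurable
  let ?F = "\<lambda>w a. (gauss \<sigma> w * u a) *\<^sub>R (ft u w * cis (- (a \<bullet> w)))"
  have "of_real (\<integral>w. gauss \<sigma> w * (cmod (ft u w))\<^sup>2 \<partial>lborel) = (\<integral>w. \<integral>a. ?F w a \<partial>lborel \<partial>lborel)"
  proof -
    have "of_real (gauss \<sigma> w * (cmod (ft u w))\<^sup>2) = (\<integral>a. ?F w a \<partial>lborel)" for w
    proof -
      have "cnj (ft u w) = (\<integral>a. cnj (u a *\<^sub>R cis (a \<bullet> w)) \<partial>lborel)"
        unfolding ft_def by (rule Bochner_Integration.integral_cnj[symmetric])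
      also have "\<dots> = (\<integral>a. u a *\<^sub>R cis (- (a \<bullet> w)) \<partial>lborel)" by (simp add: cis_cnj)
      finally have cnj: "cnj (ft u w) = (\<integral>a. u a *\<^sub>R cis (- (a \<bullet> w)) \<partial>lborel)" .
      have "of_real (gauss \<sigma> w * (cmod (ft u w))\<^sup>2) = of_real (gauss \<sigma> w) * (ft u w * cnj (ft u w))"
        by (simp only: of_real_mult complex_norm_square)
      also have "\<dots> = (\<integral>a. (of_real (gauss \<sigma> w) * ft u w) * (u a *\<^sub>R cis (- (a \<bullet> w))) \<partial>lborel)"
        unfolding cnj by (simp only: integral_mult_right_zero mult.assoc)
      also have "\<dots> = (\<integral>a. ?F w a \<partial>lborel)" by (simp add: scaleR_conv_of_real ac_simps)
      finally show ?thesis .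
    qed
    then show ?thesis by (simp flip: integral_complex_of_real)
  qed
  also have "\<dots> = (\<integral>a. \<integral>w. ?F w a \<partial>lborel \<partial>lborel)"
  proof (rule lborel_swap[OF _ integrable_mult_right[OF integrable_gauss[OF assms(3)], of L] integrable_abs[OF u]])
    fix w a
    show "norm (?F w a) \<le> L * gauss \<sigma> w * \<bar>u a\<bar>"
      using mult_left_mono[OF norm_ft_le[of u w], of "gauss \<sigma> w * \<bar>u a\<bar>"] gauss_pos[of \<sigma> w]
      unfolding L_def[symmetric] by (simp add: abs_mult norm_mult ac_simps)
  qed measurable
  also have "\<dots> = (\<integral>a. of_real (C * (u a * (\<integral>x. u x * ?g (x - a) \<partial>lborel))) \<partial>lborel)"
  proof (rule Bochner_Integration.integral_cong[OF refl])
    fix a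
    have "(\<integral>w. ?F w a \<partial>lborel) = (\<integral>w. of_real (u a) * (gauss \<sigma> w *\<^sub>R (ft u w * cis (- (a \<bullet> w)))) \<partial>lborel)"
      by (simp add: scaleR_conv_of_real ac_simps)
    also have "\<dots> = of_real (u a) * (\<integral>w. gauss \<sigma> w *\<^sub>R (ft u w * cis (- (a \<bullet> w))) \<partial>lborel)"
      by (rule integral_mult_right_zero)
    finally show "(\<integral>w. ?F w a \<partial>lborel) = of_real (C * (u a * (\<integral>x. u x * ?g (x - a) \<partial>lborel)))"
      unfolding gauss_pairing[OF u assms(3)] C_def by (simp add: ac_simps)
  qed
  finally have eq: "(\<integral>w. gauss \<sigma> w * (cmod (ft u w))\<^sup>2 \<partial>lborel) = C * (\<integral>a. \<integral>x. u a * (u x * ?g (x - a)) \<partial>lborel \<partial>lborel)"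
    by (simp flip: of_real_mult)
  define Q where "Q = (\<integral>\<^sup>+x. ennreal (?g x) \<partial>lborel)"
  define U where "U = (\<integral>\<^sup>+x. ennreal ((u x)\<^sup>2) \<partial>lborel)"
  have gsym: "?g (x - a) = ?g (a - x)" for x a by (simp add: gauss_def norm_minus_commute)
  have "ennreal (norm (\<integral>a. \<integral>x. u a * (u x * ?g (x - a)) \<partial>lborel \<partial>lborel))
    \<le> (\<integral>\<^sup>+a. \<integral>\<^sup>+x. ennreal (norm (u a * (u x * ?g (x - a)))) \<partial>lborel \<partial>lborel)"
    by (rule order_trans[OF ennreal_norm_integral_le], rule nn_integral_mono, rule ennreal_norm_integral_le)
  \<comment> \<open>From 2 |u a| |u x| \<le> u(a)^2 + u(x)^2: in each term one variable now occurs
    only in the Gaussian and can be integrated out.\<close>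
  also have "\<dots> \<le> (\<integral>\<^sup>+a. \<integral>\<^sup>+x. ennreal (1/2) * (ennreal ((u a)\<^sup>2) * ennreal (?g (x - a)) + ennreal ((u x)\<^sup>2) * ennreal (?g (x - a))) \<partial>lborel \<partial>lborel)"
  proof (rule nn_integral_mono, rule nn_integral_mono)
    fix a x
    have expand: "ennreal (h * (A * g + B * g)) = ennreal h * (ennreal A * ennreal g + ennreal B * ennreal g)"
      if "0 \<le> h" "0 \<le> A" "0 \<le> B" "0 \<le> g" for h A B g :: real
      using that by (simp add: ennreal_mult ennreal_plus)
    have "\<bar>u a\<bar> * \<bar>u x\<bar> \<le> 1/2 * ((u a)\<^sup>2 + (u x)\<^sup>2)"
      using sum_squares_bound[of "\<bar>u a\<bar>" "\<bar>u x\<bar>"] by simp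
    then have "norm (u a * (u x * ?g (x - a))) \<le> 1/2 * ((u a)\<^sup>2 + (u x)\<^sup>2) * ?g (x - a)"
      using gauss_pos[of "1/\<sigma>" "x - a"] by (simp add: abs_mult flip: mult.assoc)
    also have "\<dots> = 1/2 * ((u a)\<^sup>2 * ?g (x - a) + (u x)\<^sup>2 * ?g (x - a))" by (simp add: algebra_simps)
    finally show "ennreal (norm (u a * (u x * ?g (x - a)))) \<le> ennreal (1/2) * (ennreal ((u a)\<^sup>2) * ennreal (?g (x - a)) + ennreal ((u x)\<^sup>2) * ennreal (?g (x - a)))"
      using gauss_pos[of "1/\<sigma>" "x - a"] by (subst expand[symmetric]) (auto intro: ennreal_leI)
  qed
  also have "\<dots> = (\<integral>\<^sup>+a. ennreal (1/2) * (ennreal ((u a)\<^sup>2) * Q + (\<integral>\<^sup>+x. ennreal ((u x)\<^sup>2) * ennreal (?g (x - a)) \<partial>lborel)) \<partial>lborel)"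
    unfolding Q_def using nn_integral_lborel_shift(2)[of "\<lambda>x. ennreal (?g x)"]
    by (simp add: nn_integral_cmult nn_integral_add)
  also have "\<dots> = ennreal (1/2) * (U * Q + (\<integral>\<^sup>+a. \<integral>\<^sup>+x. ennreal ((u x)\<^sup>2) * ennreal (?g (x - a)) \<partial>lborel \<partial>lborel))"
    unfolding U_def by (simp add: nn_integral_cmult nn_integral_add nn_integral_multc)
  also have "(\<integral>\<^sup>+a. \<integral>\<^sup>+x. ennreal ((u x)\<^sup>2) * ennreal (?g (x - a)) \<partial>lborel \<partial>lborel) = (\<integral>\<^sup>+x. \<integral>\<^sup>+a. ennreal ((u x)\<^sup>2) * ennreal (?g (x - a)) \<partial>lborel \<partial>lborel)"
    by (rule lborel_pair.Fubini') measurable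
  also have "\<dots> = U * Q"
    unfolding Q_def U_def using nn_integral_lborel_shift(3)[of "\<lambda>x. ennreal (?g x)"]
    by (simp add: nn_integral_cmult nn_integral_multc)
  also have "ennreal (1/2) * (U * Q + U * Q) = U * Q"
  proof -
    have "ennreal (1/2) * ennreal 2 = ennreal (1/2 * 2)" by (rule ennreal_mult'[symmetric]) simp
    then have "ennreal (1/2) * 2 = 1" by simp
    then show ?thesis by (metis mult.assoc mult_1 mult_2)
  qed
  also have "U * Q = ennreal ((\<integral>x. (u x)\<^sup>2 \<partial>lborel) * (\<integral>x. ?g x \<partial>lborel))"
  proof -
    have "Q = ennreal (\<integral>x. ?g x \<partial>lborel)" unfolding Q_def
      using integrable_gauss[of "1/\<sigma>"] assms by (intro nn_integral_eq_integral) (auto simp: gauss_pos less_imp_le)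
    then show ?thesis unfolding U_def sq_nn_integral[OF u2] by (simp add: ennreal_mult')
  qed
  finally have "norm (\<integral>a. \<integral>x. u a * (u x * ?g (x - a)) \<partial>lborel \<partial>lborel) \<le> (\<integral>x. (u x)\<^sup>2 \<partial>lborel) * (\<integral>x. ?g x \<partial>lborel)"
    by (subst (asm) ennreal_le_iff) (auto intro!: mult_nonneg_nonneg Bochner_Integration.integral_nonneg simp: gauss_pos less_imp_le)
  then have "(\<integral>a. \<integral>x. u a * (u x * ?g (x - a)) \<partial>lborel \<partial>lborel) \<le> (\<integral>x. (u x)\<^sup>2 \<partial>lborel) * (\<integral>x. ?g x \<partial>lborel)"
    by simp
  from mult_left_mono[OF this C]
  show "(\<integral>w. gauss \<sigma> w * (cmod (ft u w))\<^sup>2 \<partial>lborel)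
      \<le> (sqrt (2 * pi) / \<sigma>) ^ DIM('a) * (\<integral>x. ?g x \<partial>lborel) * (\<integral>x. (u x)\<^sup>2 \<partial>lborel)"
    unfolding eq C_def by (simp add: ac_simps)
qed

text \<open>Combined with |y| \<le> 1 + y^2, this makes square-integrable functions integrable over
  bounded sets.\<close>

lemma integrable_mono_square:
  fixes g :: "'a::euclidean_space \<Rightarrow> real"
  assumes g: "sq_integrable g" and h: "integrable lborel h" and le: "\<And>x. \<bar>f x\<bar> \<le> \<bar>h x\<bar> + (g x)\<^sup>2"
    and [measurable]: "f \<in> borel_measurable borel"
  shows "integrable lborel (f :: 'a \<Rightarrow> real)"
proof (rule Bochner_Integration.integrable_bound)
  show "integrable lborel (\<lambda>x. \<bar>h x\<bar> + (g x)\<^sup>2)"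
    using h sq_integrableD(2)[OF g] by simp
  show "AE x in lborel. norm (f x) \<le> norm (\<bar>h x\<bar> + (g x)\<^sup>2)" using le by simp
qed measurable

lemma abs_le_one_plus_square: "\<bar>x::real\<bar> \<le> 1 + x\<^sup>2"
proof -
  have "0 \<le> (\<bar>x\<bar> - 1/2)\<^sup>2" by simp
  also have "\<dots> = x\<^sup>2 - \<bar>x\<bar> + 1/4" by (simp add: power2_eq_square algebra_simps)
  finally show ?thesis by linarith
qed

lemma integrable_indicator_cball: "integrable lborel (indicator (cball c r :: 'a::euclidean_space set) :: 'a \<Rightarrow> real)"
  by (intro integrable_real_indicator emeasure_lborel_cball_finite) auto

lemma integrable_restrict_cball:
  fixes g :: "'a::euclidean_space \<Rightarrow> real"
  assumes g: "sq_integrable g"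
  shows "integrable lborel (\<lambda>x. indicator (cball c r) x * g x)"
proof -
  have [measurable]: "g \<in> borel_measurable borel" "cball c r \<in> sets borel"
    using sq_integrableD(1)[OF g] by auto
  show ?thesis
  proof (rule integrable_mono_square[OF g integrable_indicator_cball[of c r]])
  show "\<bar>indicator (cball c r) x * g x\<bar> \<le> \<bar>indicator (cball c r) x\<bar> + (g x)\<^sup>2" for x
    using abs_le_one_plus_square[of "g x"] by (simp add: indicator_def)
  qed measurable
qed

lemma sq_integrable_restrict:
  fixes g :: "'a::euclidean_space \<Rightarrow> real"
  assumes g: "sq_integrable g" and [measurable]: "S \<in> sets borel"
  shows "sq_integrable (\<lambda>x. indicator S x * g x)"
proof -
  have [measurable]: "g \<in> borel_measurable borel" using sq_integrableD(1)[OF g] .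
  have "integrable lborel (\<lambda>x. (indicator S x * g x)\<^sup>2)"
    by (rule Bochner_Integration.integrable_bound[OF sq_integrableD(2)[OF g]])
      (auto intro!: AE_I2 simp: indicator_def)
  then show ?thesis unfolding sq_integrable_def by simp
qed

text \<open>Expand the exponential and integrate termwise. The support gives |x . w| \<le> |w|, so
  the n-th term is dominated by |p x| q^n / n! with q = |z| |w|, and the power series in z converges
  everywhere.\<close>

lemma entire_exp_transform:
  fixes p :: "'a::euclidean_space \<Rightarrow> real"
  assumes p: "integrable lborel p" and supp: "\<And>x. 1 \<le> norm x \<Longrightarrow> p x = 0"
  shows "(\<lambda>z::complex. \<integral>x. p x *\<^sub>R exp (z * of_real (x \<bullet> w)) \<partial>lborel) holomorphic_on UNIV"
proof -
  have [measurable]: "p \<in> borel_measurable borel" using p by auto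
  let ?f = "\<lambda>z::complex. \<integral>x. p x *\<^sub>R exp (z * of_real (x \<bullet> w)) \<partial>lborel"
  define a :: "nat \<Rightarrow> complex" where "a n = (\<integral>x. p x *\<^sub>R (of_real (x \<bullet> w) ^ n /\<^sub>R fact n) \<partial>lborel)" for n
  have sums: "(\<lambda>n. a n * (z - 0) ^ n) sums ?f z" for z :: complex
  proof -
    let ?t = "\<lambda>n x. p x *\<^sub>R ((z * of_real (x \<bullet> w)) ^ n /\<^sub>R fact n) :: complex"
    define q where "q = cmod z * norm w"
    have bnd: "norm (?t n x) \<le> \<bar>p x\<bar> * (q ^ n / fact n)" for n x
    proof (cases "norm x < 1")
      case True
      have "\<bar>x \<bullet> w\<bar> \<le> norm x * norm w" by (rule Cauchy_Schwarz_ineq2)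
      also have "\<dots> \<le> 1 * norm w" using True by (intro mult_right_mono) auto
      finally have "cmod (z * of_real (x \<bullet> w)) \<le> q"
        unfolding q_def norm_mult norm_of_real by (intro mult_left_mono) auto
      then have "norm ((z * of_real (x \<bullet> w)) ^ n) \<le> q ^ n" unfolding norm_power by (intro power_mono) auto
      then have "norm ((z * of_real (x \<bullet> w)) ^ n /\<^sub>R fact n :: complex) \<le> q ^ n / fact n"
        by (simp add: divide_right_mono divide_inverse_commute norm_mult)
      then show ?thesis unfolding norm_scaleR by (intro mult_left_mono) auto
    next
      case False
      then show ?thesis using supp[of x] by simp
    qed
    have int: "integrable lborel (?t n)" for n
    proof (rule Bochner_Integration.integrable_bound)
      show "integrable lborel (\<lambda>x. \<bar>p x\<bar> * (q ^ n / fact n))" using p by simp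
      show "AE x in lborel. norm (?t n x) \<le> norm (\<bar>p x\<bar> * (q ^ n / fact n))"
        by (intro AE_I2 order_trans[OF bnd]) (simp only: real_norm_def abs_ge_self)
    qed measurable
    have "(\<lambda>n. \<integral>x. ?t n x \<partial>lborel) sums (\<integral>x. (\<Sum>n. ?t n x) \<partial>lborel)"
    proof (rule sums_integral[OF int])
      have sm: "summable (\<lambda>n. L * (q ^ n / fact n))" for L :: real
        using summable_mult[OF summable_exp[of q], of L] by (simp add: field_simps)
      show "AE x in lborel. summable (\<lambda>n. norm (?t n x))"
        by (intro AE_I2 summable_comparison_test'[OF sm, of 0]) (use bnd in auto)
      show "summable (\<lambda>n. \<integral>x. norm (?t n x) \<partial>lborel)"
      proof (rule summable_comparison_test'[OF sm[of "\<integral>x. \<bar>p x\<bar> \<partial>lborel"], of 0])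
        fix n
        have "norm (\<integral>x. norm (?t n x) \<partial>lborel) = (\<integral>x. norm (?t n x) \<partial>lborel)" by simp
        also have "\<dots> \<le> (\<integral>x. \<bar>p x\<bar> * (q ^ n / fact n) \<partial>lborel)"
          by (rule integral_mono[OF integrable_norm[OF int] _ bnd]) (use p in simp)
        also have "\<dots> = (\<integral>x. \<bar>p x\<bar> \<partial>lborel) * (q ^ n / fact n)" by (rule integral_mult_left_zero)
        finally show "norm (\<integral>x. norm (?t n x) \<partial>lborel) \<le> (\<integral>x. \<bar>p x\<bar> \<partial>lborel) * (q ^ n / fact n)" .
      qed
    qed
    also have "(\<integral>x. (\<Sum>n. ?t n x) \<partial>lborel) = ?f z"
    proof (rule Bochner_Integration.integral_cong[OF refl])
      fix x
      have "(\<lambda>n. (z * of_real (x \<bullet> w)) ^ n /\<^sub>R fact n) sums exp (z * of_real (x \<bullet> w))" by (rule exp_converges)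
      then have "(\<lambda>n. ?t n x) sums (p x *\<^sub>R exp (z * of_real (x \<bullet> w)))" by (rule sums_scaleR_right)
      then show "(\<Sum>n. ?t n x) = p x *\<^sub>R exp (z * of_real (x \<bullet> w))" by (rule sums_unique[symmetric])
    qed
    finally have "(\<lambda>n. \<integral>x. ?t n x \<partial>lborel) sums ?f z" .
    moreover have "(\<integral>x. ?t n x \<partial>lborel) = a n * (z - 0) ^ n" for n
    proof -
      have e: "?t n x = (p x *\<^sub>R (of_real (x \<bullet> w) ^ n /\<^sub>R fact n)) * z ^ n" for x
        by (simp add: power_mult_distrib)
      show ?thesis unfolding e a_def integral_mult_left_zero by simp
    qed
    ultimately show ?thesis by (simp only:)
  qed
  have "?f field_differentiable at z" for z
  proof -
    have "?f holomorphic_on ball 0 (norm z + 1)"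
      by (rule power_series_holomorphic) (rule sums)
    then show ?thesis
      by (rule holomorphic_on_imp_differentiable_at) auto
  qed
  then show ?thesis unfolding holomorphic_on_def by (simp add: field_differentiable_at_within)
qed

text \<open>Along each ray the transform extends to an entire function that does not vanish at 0, so it has
  countably many zeros there; averaging over dilations turns this into a statement on Lebesgue measure.\<close>

lemma AE_ft_nonzero:
  fixes p :: "'a::euclidean_space \<Rightarrow> real"
  assumes p: "integrable lborel p" and supp: "\<And>x. 1 \<le> norm x \<Longrightarrow> p x = 0" and pos: "(\<integral>x. p x \<partial>lborel) \<noteq> 0"
  shows "AE w in lborel. ft p w \<noteq> 0"
proof -
  have [measurable]: "p \<in> borel_measurable borel" using p by auto
  define Z where "Z = {w. ft p w = 0}"
  have [measurable]: "Z \<in> sets borel" unfolding Z_def by measurable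
  have ray: "countable {s::real. s *\<^sub>R w \<in> Z}" for w
  proof -
    let ?f = "\<lambda>z::complex. \<integral>x. p x *\<^sub>R exp (z * of_real (x \<bullet> w)) \<partial>lborel :: complex"
    have val: "?f (\<i> * of_real s) = ft p (s *\<^sub>R w)" for s
      unfolding ft_def by (simp add: cis_conv_exp mult.assoc)
    show "countable {s. s *\<^sub>R w \<in> Z}"
    proof (cases "\<exists>s. s *\<^sub>R w \<in> Z")
      case True
      then obtain s where s: "ft p (s *\<^sub>R w) = 0" unfolding Z_def by blast
      \<comment> \<open>A zero on the ray would force a constant value 0, against the value at 0,
        which is the nonzero integral of \<open>p\<close>.\<close>
      have "\<not> ?f constant_on UNIV"
      proof
        assume "?f constant_on UNIV"
        then obtain c where c: "\<And>z. ?f z = c" unfolding constant_on_def by auto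
        then have "c = 0" using c[of "\<i> * of_real s"] val[of s] s by simp
        moreover have "?f 0 = of_real (\<integral>x. p x \<partial>lborel)" by (simp add: scaleR_conv_of_real)
        ultimately show False using c[of 0] pos by simp
      qed
      then have "countable {z \<in> UNIV. ?f z = 0}"
        by (intro holomorphic_countable_zeros entire_exp_transform p supp) auto
      moreover have "(\<lambda>s::real. \<i> * of_real s) ` {s. s *\<^sub>R w \<in> Z} \<subseteq> {z \<in> UNIV. ?f z = 0}"
        unfolding Z_def using val by auto
      ultimately have "countable ((\<lambda>s::real. \<i> * of_real s :: complex) ` {s. s *\<^sub>R w \<in> Z})"
        by (rule countable_subset[rotated])
      then show ?thesis by (rule countable_image_inj_on) (auto intro!: inj_onI)
    next
      case False
      then have "{s. s *\<^sub>R w \<in> Z} = {}" by blast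
      then show ?thesis by simp
    qed
  qed
  have "(\<integral>\<^sup>+s. \<integral>\<^sup>+w. indicator {1..2} (s::real) * indicator Z (s *\<^sub>R w) \<partial>lborel \<partial>lborel)
    = (\<integral>\<^sup>+w. \<integral>\<^sup>+s. indicator {1..2} (s::real) * indicator Z (s *\<^sub>R w) \<partial>lborel \<partial>lborel)"
    by (rule lborel_pair.Fubini') measurable
  also have "\<dots> = (\<integral>\<^sup>+w. 0 \<partial>(lborel :: 'a measure))"
  proof (rule nn_integral_cong)
    fix w :: 'a
    have "(\<integral>\<^sup>+s. indicator {1..2} (s::real) * indicator Z (s *\<^sub>R w) \<partial>lborel) = (\<integral>\<^sup>+s. 0 \<partial>(lborel::real measure))"
    proof (rule nn_integral_cong_AE)
      show "AE s in lborel. indicator {1..2} (s::real) * indicator Z (s *\<^sub>R w) = (0::ennreal)"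
        by (rule AE_I'[OF countable_imp_null_set_lborel[OF ray[of w]]]) (auto simp: indicator_def)
    qed
    then show "(\<integral>\<^sup>+s. indicator {1..2} (s::real) * indicator Z (s *\<^sub>R w) \<partial>lborel) = 0" by simp
  qed
  finally have zero: "(\<integral>\<^sup>+s. \<integral>\<^sup>+w. indicator {1..2} (s::real) * indicator Z (s *\<^sub>R w) \<partial>lborel \<partial>lborel) = 0" by simp
  \<comment> \<open>Dilation changes the measure of Z by a power of s. If Z had positive measure, so
    would every preimage under dilation by s in [1, 2], and the double integral could not
    vanish.\<close>
  have scale: "ennreal (s ^ DIM('a)) * (\<integral>\<^sup>+w. indicator Z (s *\<^sub>R w) \<partial>lborel) = emeasure lborel Z" if "s \<in> {1..2}" for s :: real
    using nn_integral_lborel_affine[of "indicator Z" s 0] that by simp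
  have "emeasure lborel Z = 0"
  proof (rule ccontr)
    assume nz: "emeasure lborel Z \<noteq> 0"
    have pos: "(\<integral>\<^sup>+w. indicator Z (s *\<^sub>R w) \<partial>lborel) \<noteq> 0" if "s \<in> {1..2}" for s :: real
      using scale[OF that] nz by auto
    have "AE s in lborel. (\<integral>\<^sup>+w. indicator {1..2} (s::real) * indicator Z (s *\<^sub>R w) \<partial>lborel) = 0"
      using zero by (subst (asm) nn_integral_0_iff_AE) auto
    then have "AE s in lborel. s \<notin> {1..2::real}"
      by eventually_elim (use pos in \<open>auto simp: indicator_def split: if_splits\<close>)
    then have "{1..2::real} \<in> null_sets lborel" by (subst AE_iff_null_sets) auto
    then have "emeasure lborel {1..2::real} = 0" by (rule null_setsD1)
    then show False by (simp only: emeasure_lborel_Icc[of 1 "2::real"] one_le_numeral) simp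
  qed
  then have "Z \<in> null_sets lborel" by auto
  then show ?thesis by (rule AE_I') (auto simp: Z_def)
qed

text \<open>Both supports are bounded, so the integrand vanishes for |x| > R + 1; this gives the
  product bound under which the integrals may be swapped.\<close>

lemma ft_conv:
  fixes p g :: "'a::euclidean_space \<Rightarrow> real"
  assumes p: "integrable lborel p" and pb: "\<And>x. \<bar>p x\<bar> \<le> M" and supp: "\<And>x. 1 \<le> norm x \<Longrightarrow> p x = 0"
    and g: "integrable lborel g" and gsupp: "\<And>x. R < norm x \<Longrightarrow> g x = 0"
  shows "ft (conv p g) w = ft p w * ft g w"
proof -
  have [measurable]: "p \<in> borel_measurable borel" "g \<in> borel_measurable borel" using p g by auto
  let ?F = "\<lambda>x y. (p (x - y) * g y) *\<^sub>R cis (x \<bullet> w)"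
  have M: "0 \<le> M" using pb[of 0] by linarith
  have "ft (conv p g) w = (\<integral>x. \<integral>y. ?F x y \<partial>lborel \<partial>lborel)"
    unfolding ft_def conv_def by (intro Bochner_Integration.integral_cong refl) (simp add: scaleR_conv_of_real flip: integral_complex_of_real)
  also have "\<dots> = (\<integral>y. \<integral>x. ?F x y \<partial>lborel \<partial>lborel)"
  proof (rule lborel_swap[OF _ integrable_mult_right[OF integrable_indicator_cball[of 0 "R + 1"], of M] integrable_abs[OF g]])
    fix x y
    show "norm (?F x y) \<le> M * indicator (cball 0 (R + 1)) x * \<bar>g y\<bar>"
    proof (cases "norm (x - y) < 1 \<and> norm y \<le> R")
      case True
      then have "norm x \<le> R + 1" using norm_triangle_ineq[of "x - y" y] by simp
      then show ?thesis using pb[of "x - y"] by (simp add: abs_mult mult_right_mono)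
    next
      case False
      then have "p (x - y) * g y = 0" using supp[of "x - y"] gsupp[of y] by auto
      then have "norm (?F x y) = 0" by (simp only: scaleR_zero_left norm_zero)
      moreover have "0 \<le> M * indicator (cball 0 (R + 1)) x * \<bar>g y\<bar>" using M by simp
      ultimately show ?thesis by linarith
    qed
  qed measurable
  also have "\<dots> = (\<integral>y. ft p w * (g y *\<^sub>R cis (y \<bullet> w)) \<partial>lborel)"
  proof (rule Bochner_Integration.integral_cong[OF refl])
    fix y
    have shift: "(\<integral>x. f (x - y) \<partial>lborel) = (\<integral>x. f x \<partial>lborel)" if [measurable]: "f \<in> borel_measurable borel" for f :: "'a \<Rightarrow> complex"
    proof -
      have "(\<integral>x. f x \<partial>lborel) = (\<integral>x. f x \<partial>distr lborel borel ((+) (- y)))" by (simp add: lborel_distr_plus)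
      also have "\<dots> = (\<integral>x. f (- y + x) \<partial>lborel)" by (rule integral_distr) measurable
      finally show ?thesis by simp
    qed
    have "?F x y = (g y *\<^sub>R cis (y \<bullet> w)) * (p (x - y) *\<^sub>R cis ((x - y) \<bullet> w))" for x
    proof -
      have "cis (x \<bullet> w) = cis (y \<bullet> w) * cis ((x - y) \<bullet> w)" by (simp add: cis_mult inner_diff_left)
      then show ?thesis by (simp add: scaleR_conv_of_real)
    qed
    then have "(\<integral>x. ?F x y \<partial>lborel) = (g y *\<^sub>R cis (y \<bullet> w)) * (\<integral>x. p (x - y) *\<^sub>R cis ((x - y) \<bullet> w) \<partial>lborel)"
      by (simp only: integral_mult_right_zero)
    also have "(\<integral>x. p (x - y) *\<^sub>R cis ((x - y) \<bullet> w) \<partial>lborel) = ft p w"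
      unfolding ft_def by (rule shift) measurable
    finally show "(\<integral>x. ?F x y \<partial>lborel) = ft p w * (g y *\<^sub>R cis (y \<bullet> w))" by (simp add: mult.commute)
  qed
  also have "\<dots> = ft p w * ft g w" unfolding ft_def[of g] by (rule integral_mult_right_zero)
  finally show ?thesis .
qed

text \<open>Lebesgue differentiation along cubes that have x as a corner: almost every value of
  \<open>g\<close> is a limit of averages, all of which vanish.\<close>

lemma AE_zero_if_box_integrals_zero:
  fixes g :: "'a::euclidean_space \<Rightarrow> real"
  assumes [measurable]: "g \<in> borel_measurable borel"
    and int: "\<And>c e. integrable lborel (\<lambda>x. indicator (cbox c e) x * g x)"
    and zero: "\<And>c e. (\<integral>x. indicator (cbox c e) x * g x \<partial>lborel) = 0"
  shows "AE x in lborel. g x = 0"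
proof -
  have hk: "(g has_integral 0) (cbox c e)" for c e
  proof -
    have "((\<lambda>x. indicator (cbox c e) x * g x) has_integral 0) UNIV"
      using has_integral_integral_lborel[OF int[of c e]] zero[of c e] by simp
    moreover have "(\<lambda>x. indicator (cbox c e) x * g x) = (\<lambda>x. if x \<in> cbox c e then g x else 0)"
      by (auto simp: indicator_def)
    ultimately show ?thesis by (simp only: has_integral_restrict_UNIV)
  qed
  obtain N where N: "negligible N" "\<And>x e. x \<notin> N \<Longrightarrow> 0 < e \<Longrightarrow> \<exists>d>0. \<forall>h. 0 < h \<and> h < d \<longrightarrow>
      norm (integral (cbox x (x + h *\<^sub>R One)) g /\<^sub>R h ^ DIM('a) - g x) < e"
    using integrable_ccontinuous_explicit[of g] hk by (metis has_integral_integrable)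
  have "g x = 0" if xN: "x \<notin> N" for x
  proof (rule ccontr)
    assume "g x \<noteq> 0"
    then obtain d where "d > 0" "\<forall>h. 0 < h \<and> h < d \<longrightarrow> norm (integral (cbox x (x + h *\<^sub>R One)) g /\<^sub>R h ^ DIM('a) - g x) < norm (g x)"
      using N(2)[OF xN, of "norm (g x)"] by auto
    then have "norm (integral (cbox x (x + (d/2) *\<^sub>R One)) g /\<^sub>R (d/2) ^ DIM('a) - g x) < norm (g x)" by simp
    then show False using integral_unique[OF hk] by simp
  qed
  then have "AE x in lebesgue. g x = 0"
    using N(1) by (intro AE_I'[of N]) (auto simp: negligible_iff_null_sets)
  then show ?thesis by (simp add: AE_completion_iff)
qed

lemma gauss_integral_pos: "0 < \<sigma> \<Longrightarrow> 0 < (\<integral>x. gauss \<sigma> (x :: 'a::euclidean_space) \<partial>lborel)"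
proof -
  assume "0 < \<sigma>"
  have "complex_of_real (\<integral>x. gauss \<sigma> (x :: 'a) \<partial>lborel) = (\<integral>w. gauss \<sigma> (w::'a) *\<^sub>R cis (w \<bullet> 0) \<partial>lborel)"
    by (simp add: scaleR_conv_of_real)
  also have "\<dots> = of_real ((sqrt (2 * pi) / \<sigma>) ^ DIM('a) * gauss (1 / \<sigma>) (0::'a))"
    by (rule gauss_fourier(2)[OF \<open>0 < \<sigma>\<close>])
  finally have "(\<integral>x. gauss \<sigma> (x :: 'a) \<partial>lborel) = (sqrt (2 * pi) / \<sigma>) ^ DIM('a)"
    by (simp only: of_real_eq_iff) (simp add: gauss_def)
  then show ?thesis using \<open>0 < \<sigma>\<close> by simp
qed

text \<open>The box integral is smeared with Gaussians of shrinking width. Each smeared value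
  vanishes by Fubini, and the values tend to the box integral times the mass of the
  Gaussian.\<close>

lemma box_integral_zero_if_gauss_zero:
  fixes g :: "'a::euclidean_space \<Rightarrow> real"
  assumes g: "sq_integrable g" and zero: "\<And>\<sigma> a. 0 < \<sigma> \<Longrightarrow> (\<integral>x. g x * gauss \<sigma> (x - a) \<partial>lborel) = 0"
  shows "(\<integral>x. indicator (cbox c e) x * g x \<partial>lborel) = 0"
proof -
  have [measurable]: "g \<in> borel_measurable borel" using sq_integrableD(1)[OF g] .
  let ?Q = "cbox c e"
  let ?i = "indicator ?Q :: 'a \<Rightarrow> real"
  have [measurable]: "?Q \<in> sets borel" by simp
  have iint: "integrable lborel ?i" by (intro integrable_real_indicator emeasure_lborel_cbox_finite) auto
  have g2: "integrable lborel (\<lambda>x. (g x)\<^sup>2)" using sq_integrableD(2)[OF g] .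
  define r where "r n = 1 / real (Suc n)" for n
  have r: "0 < r n" "r n \<le> 1" for n unfolding r_def by auto
  define K where "K = (\<integral>x. ?i x \<partial>lborel) + (\<integral>x. (g x)\<^sup>2 \<partial>lborel)"
  have shift_int: "integrable lborel (\<lambda>a. (g (a + v))\<^sup>2)" and shift_val: "(\<integral>a. (g (a + v))\<^sup>2 \<partial>lborel) = (\<integral>x. (g x)\<^sup>2 \<partial>lborel)" for v
  proof -
    show "integrable lborel (\<lambda>a. (g (a + v))\<^sup>2)" using integrable_lborel_shift(1)[OF g2, of "-v"] by simp
    have "(\<integral>x. (g x)\<^sup>2 \<partial>lborel) = (\<integral>x. (g x)\<^sup>2 \<partial>distr lborel borel ((+) v))" by (simp add: lborel_distr_plus)
    also have "\<dots> = (\<integral>x. (g (v + x))\<^sup>2 \<partial>lborel)" by (rule integral_distr) measurable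
    finally show "(\<integral>a. (g (a + v))\<^sup>2 \<partial>lborel) = (\<integral>x. (g x)\<^sup>2 \<partial>lborel)" by (simp add: add.commute)
  qed
  have pt: "\<bar>?i a * g y\<bar> \<le> ?i a + (g y)\<^sup>2" for a y
    using abs_le_one_plus_square[of "g y"] by (simp add: indicator_def)
  have Iint: "integrable lborel (\<lambda>a. ?i a * g (a + v))" and Ile: "(\<integral>a. \<bar>?i a * g (a + v)\<bar> \<partial>lborel) \<le> K" for v
  proof -
    show I: "integrable lborel (\<lambda>a. ?i a * g (a + v))"
      by (rule Bochner_Integration.integrable_bound[OF Bochner_Integration.integrable_add[OF iint shift_int[of v]]])
        (use pt in \<open>auto simp del: abs_mult\<close>)
    have "(\<integral>a. \<bar>?i a * g (a + v)\<bar> \<partial>lborel) \<le> (\<integral>a. ?i a + (g (a + v))\<^sup>2 \<partial>lborel)"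
      by (rule integral_mono[OF integrable_abs[OF I] Bochner_Integration.integrable_add[OF iint shift_int[of v]] pt])
    also have "\<dots> = K" unfolding K_def using iint shift_int shift_val by simp
    finally show "(\<integral>a. \<bar>?i a * g (a + v)\<bar> \<partial>lborel) \<le> K" .
  qed
  define J where "J n w = (\<integral>a. ?i a * g (a + r n *\<^sub>R w) \<partial>lborel)" for n w
  have [measurable]: "J n \<in> borel_measurable borel" for n unfolding J_def by measurable
  have J_le: "\<bar>J n w\<bar> \<le> K" for n w
    unfolding J_def by (rule order_trans[OF integral_abs_bound Ile])
  have J_zero: "(\<integral>w. gauss 1 w * J n w \<partial>lborel) = 0" for n
  proof -
    let ?F = "\<lambda>w a. gauss 1 w * (?i a * g (a + r n *\<^sub>R w))"
    \<comment> \<open>For fixed a the integral over w is, after an affine substitution, a Gaussian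
      mean of \<open>g\<close> around a with inverse width 1 / r n.\<close>
    have inner: "(\<integral>w. g (a + r n *\<^sub>R w) * gauss 1 w \<partial>lborel) = 0" for a
    proof -
      have "(\<integral>w. g (a + r n *\<^sub>R w) * gauss (1 / r n) (a + r n *\<^sub>R w - a) \<partial>lborel) = 0"
        by (rule integral_lborel_affine_zero[where f="\<lambda>x. g x * gauss (1 / r n) (x - a)"])
          (use r[of n] zero[of "1 / r n" a] in auto)
      moreover have "gauss (1 / r n) (a + r n *\<^sub>R w - a) = gauss 1 w" for w
        using r[of n] by (simp add: gauss_def)
      ultimately show ?thesis by (simp only:)
    qed
    have "integrable (lborel \<Otimes>\<^sub>M lborel) (\<lambda>(w, a). ?F w a)"
    proof (rule lborel_pair.Fubini_integrable)
      have eq: "(\<integral>a. norm (case (w, a) of (w, a) \<Rightarrow> ?F w a) \<partial>lborel) = gauss 1 w * (\<integral>a. \<bar>?i a * g (a + r n *\<^sub>R w)\<bar> \<partial>lborel)" for w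
        using gauss_pos[of 1 w] by (simp add: abs_mult)
      show "integrable lborel (\<lambda>w. \<integral>a. norm (case (w, a) of (w, a) \<Rightarrow> ?F w a) \<partial>lborel)"
        unfolding eq
      proof (rule Bochner_Integration.integrable_bound)
        show "integrable lborel (\<lambda>w::'a. gauss 1 w * K)" using integrable_gauss[of 1, where 'a='a] by simp
        show "AE w in lborel. norm (gauss 1 w * (\<integral>a. \<bar>?i a * g (a + r n *\<^sub>R w)\<bar> \<partial>lborel)) \<le> norm (gauss 1 w * K)"
        proof (rule AE_I2)
          fix w :: 'a
          let ?I = "\<integral>a. \<bar>?i a * g (a + r n *\<^sub>R w)\<bar> \<partial>lborel"
          have "0 \<le> ?I" by simp
          then have "\<bar>?I\<bar> \<le> \<bar>K\<bar>" using Ile[of "r n *\<^sub>R w"] by linarith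
          then show "norm (gauss 1 w * ?I) \<le> norm (gauss 1 w * K)"
            unfolding real_norm_def abs_mult[of "gauss 1 w"] by (intro mult_left_mono) auto
        qed
      qed measurable
      show "AE w in lborel. integrable lborel (\<lambda>a. case (w, a) of (w, a) \<Rightarrow> ?F w a)"
        using Iint by simp
    qed measurable
    from lborel_pair.Fubini_integral[OF this]
    have "(\<integral>w. \<integral>a. ?F w a \<partial>lborel \<partial>lborel) = (\<integral>a. \<integral>w. ?F w a \<partial>lborel \<partial>lborel)" by simp
    also have "(\<integral>a. \<integral>w. ?F w a \<partial>lborel \<partial>lborel) = 0"
    proof -
      have "?F w a = ?i a * (g (a + r n *\<^sub>R w) * gauss 1 w)" for w a by simp
      then have "(\<integral>w. ?F w a \<partial>lborel) = 0" for a using inner[of a] by (simp only: integral_mult_right_zero mult_zero_right)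
      then show ?thesis by simp
    qed
    finally show ?thesis unfolding J_def by simp
  qed
  define J0 where "J0 = (\<integral>x. ?i x * g x \<partial>lborel)"
  have J_lim: "(\<lambda>n. J n w) \<longlonglongrightarrow> J0" for w
  proof -
    \<comment> \<open>The shift is transferred to the indicator, which converges off the boundary of
      the box, while \<open>g\<close> is merely measurable.\<close>
    have J_eq: "J n w = (\<integral>x. ?i (x - r n *\<^sub>R w) * g x \<partial>lborel)" for n
    proof -
      have "(\<integral>x. ?i (x - r n *\<^sub>R w) * g x \<partial>lborel) = (\<integral>x. ?i (x - r n *\<^sub>R w) * g x \<partial>distr lborel borel ((+) (r n *\<^sub>R w)))"
        by (simp add: lborel_distr_plus)
      also have "\<dots> = (\<integral>x. ?i (r n *\<^sub>R w + x - r n *\<^sub>R w) * g (r n *\<^sub>R w + x) \<partial>lborel)" by (rule integral_distr) measurable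
      finally show ?thesis unfolding J_def by (simp add: add.commute)
    qed
    obtain s where s: "?Q \<subseteq> cball 0 s"
      using bounded_cbox[of c e] unfolding bounded_iff by (metis mem_cball_0 subsetI)
    have rlim: "(\<lambda>n. x - r n *\<^sub>R w) \<longlonglongrightarrow> x" for x
    proof -
      have "(\<lambda>n. x - r n *\<^sub>R w) \<longlonglongrightarrow> x - 0 *\<^sub>R w"
        unfolding r_def using LIMSEQ_inverse_real_of_nat by (intro tendsto_intros) (simp add: inverse_eq_divide)
      then show ?thesis by simp
    qed
    have "(\<lambda>n. \<integral>x. ?i (x - r n *\<^sub>R w) * g x \<partial>lborel) \<longlonglongrightarrow> (\<integral>x. ?i x * g x \<partial>lborel)"
    proof (rule integral_dominated_convergence[where w="\<lambda>x. \<bar>indicator (cball 0 (s + norm w)) x * g x\<bar>"])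
      show "integrable lborel (\<lambda>x. \<bar>indicator (cball 0 (s + norm w)) x * g x\<bar>)"
        by (rule integrable_abs[OF integrable_restrict_cball[OF g]])
      show "AE x in lborel. (\<lambda>n. ?i (x - r n *\<^sub>R w) * g x) \<longlonglongrightarrow> ?i x * g x"
      proof (rule AE_I'[OF null_sets_cbox_Diff_box[of c e]], rule subsetI, clarify)
        fix x assume nl: "\<not> (\<lambda>n. ?i (x - r n *\<^sub>R w) * g x) \<longlonglongrightarrow> ?i x * g x"
        have "(\<lambda>n. ?i (x - r n *\<^sub>R w)) \<longlonglongrightarrow> ?i x" if "x \<in> box c e \<or> x \<notin> ?Q"
          using that
        proof
          assume x: "x \<in> box c e"
          have "eventually (\<lambda>n. x - r n *\<^sub>R w \<in> box c e) sequentially"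
            by (rule topological_tendstoD[OF rlim open_box x])
          then have "eventually (\<lambda>n. ?i (x - r n *\<^sub>R w) = ?i x) sequentially"
            by eventually_elim (use x box_subset_cbox[of c e] in \<open>auto simp: indicator_def\<close>)
          then show ?thesis by (rule tendsto_eventually)
        next
          assume x: "x \<notin> ?Q"
          have "eventually (\<lambda>n. x - r n *\<^sub>R w \<in> - ?Q) sequentially"
            by (rule topological_tendstoD[OF rlim]) (use x in auto)
          then have "eventually (\<lambda>n. ?i (x - r n *\<^sub>R w) = ?i x) sequentially"
            by eventually_elim (use x in \<open>auto simp: indicator_def\<close>)
          then show ?thesis by (rule tendsto_eventually)
        qed
        then have "\<not> (x \<in> box c e \<or> x \<notin> ?Q)" using nl tendsto_mult_right by blast
        then show "x \<in> ?Q - box c e" by blast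
      qed
      show "AE x in lborel. norm (?i (x - r n *\<^sub>R w) * g x) \<le> \<bar>indicator (cball 0 (s + norm w)) x * g x\<bar>" for n
      proof (rule AE_I2)
        fix x
        show "norm (?i (x - r n *\<^sub>R w) * g x) \<le> \<bar>indicator (cball 0 (s + norm w)) x * g x\<bar>"
        proof (cases "x - r n *\<^sub>R w \<in> ?Q")
          case True
          then have "norm (x - r n *\<^sub>R w) \<le> s" using s by auto
          moreover have "norm (r n *\<^sub>R w) \<le> 1 * norm w"
            unfolding norm_scaleR using r[of n] by (intro mult_right_mono) auto
          ultimately have "norm x \<le> s + norm w" using norm_triangle_ineq[of "x - r n *\<^sub>R w" "r n *\<^sub>R w"] by simp
          then show ?thesis using True by (simp add: indicator_def)
        qed simp
      qed
    qed measurable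
    then show ?thesis unfolding J_eq J0_def .
  qed
  have "(\<lambda>n. \<integral>w. gauss 1 w * J n w \<partial>lborel) \<longlonglongrightarrow> (\<integral>w. gauss 1 (w :: 'a) * J0 \<partial>lborel)"
  proof (rule integral_dominated_convergence[where w="\<lambda>w. gauss 1 w * K"])
    show "integrable lborel (\<lambda>w::'a. gauss 1 w * K)" using integrable_gauss[of 1, where 'a='a] by simp
    show "AE w in lborel. (\<lambda>n. gauss 1 w * J n w) \<longlonglongrightarrow> gauss 1 w * J0"
      by (intro AE_I2 tendsto_intros J_lim)
    show "AE w in lborel. norm (gauss 1 w * J n w) \<le> gauss 1 w * K" for n
      using J_le by (intro AE_I2) (simp add: abs_mult mult_left_mono)
  qed measurable
  then have "(\<integral>w. gauss 1 (w::'a) * J0 \<partial>lborel) = 0"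
    unfolding J_zero by (simp add: LIMSEQ_const_iff)
  then have "(\<integral>w. gauss 1 (w::'a) \<partial>lborel) * J0 = 0" by simp
  then show ?thesis using gauss_integral_pos[of 1, where 'a='a] unfolding J0_def by simp
qed

section \<open>Injectivity of convolution with a bounded, compactly supported function\<close>

lemma integrable_bounded_support:
  fixes p :: "'a::euclidean_space \<Rightarrow> real"
  assumes [measurable]: "p \<in> borel_measurable borel" and b: "\<And>x. \<bar>p x\<bar> \<le> M" and supp: "\<And>x. 1 \<le> norm x \<Longrightarrow> p x = 0"
  shows "integrable lborel p"
proof (rule Bochner_Integration.integrable_bound)
  show "integrable lborel (\<lambda>x::'a. M * indicator (cball 0 1) x)"
    using integrable_indicator_cball[of "0::'a" 1] by simp
  have "0 \<le> M" using b[of 0] by linarith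
  then show "AE x in lborel. norm (p x) \<le> norm (M * indicator (cball 0 1) x)"
    using b supp by (intro AE_I2) (auto simp: indicator_def abs_le_iff intro: order_trans)
qed measurable

lemma sq_integrable_bounded_support:
  fixes p :: "'a::euclidean_space \<Rightarrow> real"
  assumes m [measurable]: "p \<in> borel_measurable borel" and b: "\<And>x. \<bar>p x\<bar> \<le> M" and supp: "\<And>x. 1 \<le> norm x \<Longrightarrow> p x = 0"
  shows "sq_integrable p"
proof -
  have "integrable lborel (\<lambda>x. (p x)\<^sup>2)"
  proof (rule integrable_bounded_support[where M="M\<^sup>2"])
    show "\<bar>(p x)\<^sup>2\<bar> \<le> M\<^sup>2" for x using power_mono[OF b[of x], of 2] by simp
  qed (use supp in auto)
  then show ?thesis unfolding sq_integrable_def by simp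
qed

lemma sq_integrable_reflect:
  fixes p :: "'a::euclidean_space \<Rightarrow> real"
  assumes "sq_integrable p"
  shows "sq_integrable (\<lambda>y. p (x - y))" and "(\<integral>y. (p (x - y))\<^sup>2 \<partial>lborel) = (\<integral>y. (p y)\<^sup>2 \<partial>lborel)"
proof -
  have [measurable]: "p \<in> borel_measurable borel" using sq_integrableD(1)[OF assms] .
  show s: "sq_integrable (\<lambda>y. p (x - y))"
    unfolding sq_integrable_def using integrable_lborel_shift(2)[OF sq_integrableD(2)[OF assms], of x] by simp
  have "(\<integral>\<^sup>+y. ennreal ((p (x - y))\<^sup>2) \<partial>lborel) = (\<integral>\<^sup>+y. ennreal ((p y)\<^sup>2) \<partial>lborel)"
    by (rule nn_integral_lborel_shift(3)[of "\<lambda>y. ennreal ((p y)\<^sup>2)"]) measurable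
  then show "(\<integral>y. (p (x - y))\<^sup>2 \<partial>lborel) = (\<integral>y. (p y)\<^sup>2 \<partial>lborel)"
    unfolding sq_nn_integral[OF s] sq_nn_integral[OF assms] by (simp add: ennreal_inj)
qed

lemma borel_measurable_conv [measurable]:
  assumes [measurable]: "p \<in> borel_measurable borel" "g \<in> borel_measurable borel"
  shows "conv p g \<in> borel_measurable borel"
  unfolding conv_def[abs_def] by measurable

text \<open>Truncating g to the ball of radius R only spoils the equation conv p g = 0 in a shell of bounded
  width around the sphere of radius R, where g carries little mass.\<close>

lemma conv_truncation_small:
  fixes p g :: "'a::euclidean_space \<Rightarrow> real"
  assumes pm: "p \<in> borel_measurable borel" and pb: "\<And>x. \<bar>p x\<bar> \<le> M" and supp: "\<And>x. 1 \<le> norm x \<Longrightarrow> p x = 0"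
    and g: "sq_integrable g" and zero: "\<And>x. conv p g x = 0"
  defines "h \<equiv> \<lambda>R. conv p (\<lambda>y. indicator (cball 0 R) y * g y)"
  shows "sq_integrable (h R)" and "integrable lborel (h R)"
    and "(\<lambda>n. \<integral>x. (h (real n) x)\<^sup>2 \<partial>lborel) \<longlonglongrightarrow> 0"
proof -
  have [measurable]: "p \<in> borel_measurable borel" "g \<in> borel_measurable borel" using pm sq_integrableD(1)[OF g] by auto
  have [measurable]: "cball (0::'a) r \<in> sets borel" "ball (0::'a) r \<in> sets borel" "- ball (0::'a) r \<in> sets borel" for r by auto
  have hm [measurable]: "h R \<in> borel_measurable borel" for R unfolding h_def by measurable
  have p2: "sq_integrable p" by (rule sq_integrable_bounded_support[OF pm pb supp])
  define K where "K = (\<integral>x. (p x)\<^sup>2 \<partial>lborel)"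
  have K: "0 \<le> K" unfolding K_def by simp
  \<comment> \<open>The margin 2 is the reach 1 of \<open>p\<close> used twice: an error at x
    requires |x| \<ge> R - 1, and it involves only y within distance 1 of x.\<close>
  define \<gamma> where "\<gamma> R y = indicator (- ball 0 (R - 2)) y * g y" for R y
  have \<gamma>: "sq_integrable (\<gamma> R)" for R unfolding \<gamma>_def[abs_def] by (rule sq_integrable_restrict[OF g]) measurable
  have [measurable]: "\<gamma> R \<in> borel_measurable borel" for R using sq_integrableD(1)[OF \<gamma>] .
  \<comment> \<open>For |x| < R - 1 the truncation does not change the convolution at x, which is 0.
    Otherwise Cauchy-Schwarz against \<open>p\<close> bounds it by the mass of
    \<open>\<gamma> R\<close> near x.\<close>
  have pt: "ennreal ((h R x)\<^sup>2) \<le> (\<integral>\<^sup>+y. ennreal K * (of_bool (norm (x - y) < 1) * ennreal ((\<gamma> R y)\<^sup>2)) \<partial>lborel)" for R x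
  proof (cases "norm x < R - 1")
    case True
    have "h R x = conv p g x"
      unfolding h_def conv_def
    proof (rule Bochner_Integration.integral_cong[OF refl])
      fix y
      show "p (x - y) * (indicator (cball 0 R) y * g y) = p (x - y) * g y"
      proof (cases "norm (x - y) < 1")
        case close: True
        then have "norm y \<le> R" using True norm_triangle_ineq4[of x "x - y"] by simp
        then show ?thesis by simp
      next
        case False
        then show ?thesis using supp[of "x - y"] by simp
      qed
    qed
    then show ?thesis using zero by simp
  next
    case False
    have sub: "sq_integrable (\<lambda>y. indicator (ball x 1 \<inter> cball 0 R) y * \<gamma> R y)"
      by (rule sq_integrable_restrict[OF \<gamma>]) auto
    have "h R x = (\<integral>y. p (x - y) * (indicator (ball x 1 \<inter> cball 0 R) y * \<gamma> R y) \<partial>lborel)"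
      unfolding h_def conv_def
    proof (rule Bochner_Integration.integral_cong[OF refl])
      fix y
      show "p (x - y) * (indicator (cball 0 R) y * g y) = p (x - y) * (indicator (ball x 1 \<inter> cball 0 R) y * \<gamma> R y)"
      proof (cases "norm (x - y) < 1")
        case close: True
        then have "R - 2 \<le> norm y" using False norm_triangle_ineq[of "x - y" y] by simp
        then show ?thesis using close by (simp add: \<gamma>_def indicator_def dist_norm)
      next
        case False
        then show ?thesis using supp[of "x - y"] by simp
      qed
    qed
    then have "(h R x)\<^sup>2 \<le> (\<integral>y. (p (x - y))\<^sup>2 \<partial>lborel) * (\<integral>y. (indicator (ball x 1 \<inter> cball 0 R) y * \<gamma> R y)\<^sup>2 \<partial>lborel)"
      using sq_integrable_cauchy_schwarz[OF sq_integrable_reflect(1)[OF p2, of x] sub] by simp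
    also have "(\<integral>y. (p (x - y))\<^sup>2 \<partial>lborel) = K" unfolding K_def by (rule sq_integrable_reflect(2)[OF p2])
    finally have "ennreal ((h R x)\<^sup>2) \<le> ennreal K * (\<integral>\<^sup>+y. ennreal ((indicator (ball x 1 \<inter> cball 0 R) y * \<gamma> R y)\<^sup>2) \<partial>lborel)"
      unfolding sq_nn_integral[OF sub] using K by (simp add: ennreal_leI flip: ennreal_mult')
    also have "\<dots> \<le> ennreal K * (\<integral>\<^sup>+y. of_bool (norm (x - y) < 1) * ennreal ((\<gamma> R y)\<^sup>2) \<partial>lborel)"
      by (intro mult_left_mono nn_integral_mono) (auto simp: indicator_def dist_norm)
    also have "\<dots> = (\<integral>\<^sup>+y. ennreal K * (of_bool (norm (x - y) < 1) * ennreal ((\<gamma> R y)\<^sup>2)) \<partial>lborel)"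
      by (rule nn_integral_cmult[symmetric]) measurable
    finally show ?thesis .
  qed
  define V where "V = measure lborel (ball (0::'a) 1)"
  have bound: "(\<integral>\<^sup>+x. ennreal ((h R x)\<^sup>2) \<partial>lborel) \<le> ennreal (K * V * (\<integral>y. (\<gamma> R y)\<^sup>2 \<partial>lborel))" for R
  proof -
    have "(\<integral>\<^sup>+x. ennreal ((h R x)\<^sup>2) \<partial>lborel) \<le> (\<integral>\<^sup>+x. \<integral>\<^sup>+y. ennreal K * (of_bool (norm (x - y) < 1) * ennreal ((\<gamma> R y)\<^sup>2)) \<partial>lborel \<partial>lborel)"
      by (rule nn_integral_mono) (rule pt)
    also have "\<dots> = (\<integral>\<^sup>+y. \<integral>\<^sup>+x. ennreal K * (of_bool (norm (x - y) < 1) * ennreal ((\<gamma> R y)\<^sup>2)) \<partial>lborel \<partial>lborel)"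
      by (rule lborel_pair.Fubini') measurable
    also have "\<dots> = (\<integral>\<^sup>+y. ennreal K * (ennreal V * ennreal ((\<gamma> R y)\<^sup>2)) \<partial>lborel)"
    proof (rule nn_integral_cong)
      fix y :: 'a
      have "(\<integral>\<^sup>+x. of_bool (norm (x - y) < 1) \<partial>lborel) = (\<integral>\<^sup>+x. of_bool (norm (x::'a) < 1) \<partial>lborel)"
        by (rule nn_integral_lborel_shift(2)[of "\<lambda>x. of_bool (norm x < 1)"]) measurable
      also have "\<dots> = (\<integral>\<^sup>+x. indicator (ball (0::'a) 1) x \<partial>lborel)"
        by (intro nn_integral_cong) (simp add: indicator_def)
      also have "\<dots> = ennreal V"
        unfolding V_def using emeasure_lborel_ball_finite[of "0::'a" 1] by (simp add: emeasure_eq_ennreal_measure less_top[symmetric])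
      finally have "(\<integral>\<^sup>+x. of_bool (norm (x - y) < 1) \<partial>lborel) = ennreal V" .
      then show "(\<integral>\<^sup>+x. ennreal K * (of_bool (norm (x - y) < 1) * ennreal ((\<gamma> R y)\<^sup>2)) \<partial>lborel) = ennreal K * (ennreal V * ennreal ((\<gamma> R y)\<^sup>2))"
        by (simp add: nn_integral_cmult nn_integral_multc)
    qed
    also have "\<dots> = ennreal K * (ennreal V * (\<integral>\<^sup>+y. ennreal ((\<gamma> R y)\<^sup>2) \<partial>lborel))"
      by (simp add: nn_integral_cmult)
    also have "\<dots> = ennreal (K * V * (\<integral>y. (\<gamma> R y)\<^sup>2 \<partial>lborel))"
      unfolding sq_nn_integral[OF \<gamma>] using K by (simp add: ennreal_mult' V_def mult.assoc)
    finally show ?thesis .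
  qed
  show hsq: "sq_integrable (h R)" for R
    unfolding sq_integrable_def
  proof (intro conjI integrableI_bounded)
    show "(\<integral>\<^sup>+x. ennreal (norm ((h R x)\<^sup>2)) \<partial>lborel) < \<infinity>"
      using le_less_trans[OF bound[of R]] by simp
  qed measurable
  show "integrable lborel (h R)"
  proof (rule integrable_mono_square[OF hsq[of R] integrable_indicator_cball[of 0 "R + 1"]])
    fix x
    show "\<bar>h R x\<bar> \<le> \<bar>indicator (cball 0 (R + 1)) x\<bar> + (h R x)\<^sup>2"
    proof (cases "norm x \<le> R + 1")
      case True
      then show ?thesis using abs_le_one_plus_square[of "h R x"] by simp
    next
      case False
      have "p (x - y) * (indicator (cball 0 R) y * g y) = 0" for y
      proof (cases "norm y \<le> R")
        case True
        then have "1 \<le> norm (x - y)" using False norm_triangle_ineq[of "x - y" y] by simp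
        then show ?thesis using supp by simp
      qed simp
      then have "h R x = 0" unfolding h_def conv_def by (simp only:) simp
      then show ?thesis by simp
    qed
  qed measurable
  have lim: "(\<lambda>n. \<integral>y. (\<gamma> (real n) y)\<^sup>2 \<partial>lborel) \<longlonglongrightarrow> (\<integral>y. 0 \<partial>(lborel :: 'a measure))"
  proof (rule integral_dominated_convergence[where w="\<lambda>y. (g y)\<^sup>2"])
    show "AE y in lborel. (\<lambda>n. (\<gamma> (real n) y)\<^sup>2) \<longlonglongrightarrow> 0"
    proof (rule AE_I2)
      fix y :: 'a
      obtain N :: nat where N: "norm y + 2 < real N" using reals_Archimedean2 by blast
      have "eventually (\<lambda>n. (\<gamma> (real n) y)\<^sup>2 = 0) sequentially"
        using eventually_ge_at_top[of N]
      proof eventually_elim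
        case (elim n)
        then have "norm y + 2 < real n" using N by (meson less_le_trans of_nat_le_iff)
        then show ?case by (simp add: \<gamma>_def)
      qed
      then show "(\<lambda>n. (\<gamma> (real n) y)\<^sup>2) \<longlonglongrightarrow> 0" by (rule tendsto_eventually)
    qed
    show "AE y in lborel. norm ((\<gamma> (real n) y)\<^sup>2) \<le> (g y)\<^sup>2" for n
      by (intro AE_I2) (simp add: \<gamma>_def indicator_def)
  qed (use sq_integrableD(2)[OF g] in auto)
  have "(\<lambda>n. K * V * (\<integral>y. (\<gamma> (real n) y)\<^sup>2 \<partial>lborel)) \<longlonglongrightarrow> 0"
    using tendsto_mult_left[OF lim, of "K * V"] by simp
  moreover have "(\<integral>x. (h R x)\<^sup>2 \<partial>lborel) \<le> K * V * (\<integral>y. (\<gamma> R y)\<^sup>2 \<partial>lborel)" for R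
    using bound[of R] K unfolding sq_nn_integral[OF hsq] by (subst (asm) ennreal_le_iff) (auto simp: V_def)
  ultimately show "(\<lambda>n. \<integral>x. (h (real n) x)\<^sup>2 \<partial>lborel) \<longlonglongrightarrow> 0"
    by (intro tendsto_sandwich[of "\<lambda>_. 0" "\<lambda>n. \<integral>x. (h (real n) x)\<^sup>2 \<partial>lborel" sequentially]) auto
qed

text \<open>Young's inequality with a free weight, used pointwise in place of Cauchy-Schwarz, so
  that only integrals already known to be finite occur.\<close>

lemma abs_le_weighted: "0 < t \<Longrightarrow> x \<le> (t * x\<^sup>2 + 1 / t) / 2" for x :: real
proof -
  assume t: "0 < t"
  have "0 \<le> (t * x - 1)\<^sup>2 / t" using t by simp
  also have "\<dots> = t * x\<^sup>2 - 2 * x + 1 / t" using t by (simp add: power2_eq_square field_simps)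
  finally show ?thesis by simp
qed

text \<open>Frequencies are split at |ft p| < \<eta>. Below, the Gaussian mass is small because
  \<open>ft p\<close> is nonzero almost everywhere; above, |ft (u n)| \<le> |ft (h n)| / \<eta>, and
  h n tends to 0 in L2. \<open>weighted_plancherel\<close> turns these L2 bounds into bounds on the
  frequency side.\<close>

lemma gauss_pairing_zero:
  fixes p g :: "'a::euclidean_space \<Rightarrow> real"
  assumes pm: "p \<in> borel_measurable borel" and pb: "\<And>x. \<bar>p x\<bar> \<le> M" and supp: "\<And>x. 1 \<le> norm x \<Longrightarrow> p x = 0"
    and pos: "(\<integral>x. p x \<partial>lborel) \<noteq> 0"
    and g: "sq_integrable g" and zero: "\<And>x. conv p g x = 0" and \<sigma>: "0 < \<sigma>"
  shows "(\<integral>x. g x * gauss (1 / \<sigma>) (x - a) \<partial>lborel) = 0"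
proof -
  have [measurable]: "p \<in> borel_measurable borel" "g \<in> borel_measurable borel" using pm sq_integrableD(1)[OF g] by auto
  have [measurable]: "cball (0::'a) r \<in> sets borel" for r by simp
  have p: "integrable lborel p" by (rule integrable_bounded_support[OF pm pb supp])
  define u where "u n x = indicator (cball 0 (real n)) x * g x" for n x
  define h where "h n = conv p (u n)" for n
  have u: "integrable lborel (u n)" "sq_integrable (u n)" for n
    unfolding u_def[abs_def] by (auto intro!: integrable_restrict_cball[OF g] sq_integrable_restrict[OF g])
  have h: "sq_integrable (h n)" "integrable lborel (h n)" "(\<lambda>n. \<integral>x. (h n x)\<^sup>2 \<partial>lborel) \<longlonglongrightarrow> 0" for n
    unfolding h_def u_def[abs_def] using conv_truncation_small[OF pm pb supp g zero] by auto
  have [measurable]: "u n \<in> borel_measurable borel" "h n \<in> borel_measurable borel" for n using u h by auto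
  have ft_h: "ft (h n) w = ft p w * ft (u n) w" for n w
    unfolding h_def by (rule ft_conv[OF p pb supp u(1)[of n], where R="real n"]) (simp_all add: u_def)
  define C where "C = (sqrt (2 * pi) / \<sigma>) ^ DIM('a)"
  have C: "0 < C" unfolding C_def using \<sigma> by simp
  define D where "D = C * (\<integral>x. gauss (1 / \<sigma>) (x :: 'a) \<partial>lborel)"
  have D: "0 < D" unfolding D_def using C gauss_integral_pos[of "1 / \<sigma>", where 'a='a] \<sigma> by simp
  define G where "G = (\<integral>w. gauss \<sigma> (w :: 'a) \<partial>lborel)"
  have G: "0 < G" unfolding G_def by (rule gauss_integral_pos[OF \<sigma>])
  define S where "S = (\<integral>x. (g x)\<^sup>2 \<partial>lborel)"
  have S: "0 \<le> S" unfolding S_def by simp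
  define I where "I n = (\<integral>x. u n x * gauss (1 / \<sigma>) (x - a) \<partial>lborel)" for n
  define A where "A \<eta> = {w. cmod (ft p w) < \<eta>}" for \<eta>
  have [measurable]: "A \<eta> \<in> sets borel" for \<eta> unfolding A_def by measurable
  define m where "m \<eta> = (\<integral>w. gauss \<sigma> w * indicator (A \<eta>) w \<partial>lborel)" for \<eta>
  have mint: "integrable lborel (\<lambda>w. gauss \<sigma> w * indicator (A \<eta>) w)" for \<eta>
    by (rule Bochner_Integration.integrable_bound[OF integrable_gauss[OF \<sigma>, where 'a='a]])
      (auto intro!: AE_I2 simp: indicator_def)
  \<comment> \<open>The weight t handles the frequencies in \<open>A \<eta>\<close>, the weight s
    the others. Either bound is nonnegative, so their sum is valid everywhere.\<close>
  have key: "C * \<bar>I n\<bar> \<le> (t * (D * S) + m \<eta> / t + (s * (D * (\<integral>x. (h n x)\<^sup>2 \<partial>lborel)) + G / s) / \<eta>) / 2"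
    if t: "0 < t" and s: "0 < s" and \<eta>: "0 < \<eta>" for n t s \<eta>
  proof -
    let ?U = "\<lambda>w. gauss \<sigma> w * (cmod (ft (u n) w))\<^sup>2" and ?V = "\<lambda>w. gauss \<sigma> w * (cmod (ft (h n) w))\<^sup>2"
    let ?R = "\<lambda>w. (t * ?U w + (gauss \<sigma> w * indicator (A \<eta>) w) / t + (s * ?V w + gauss \<sigma> w / s) / \<eta>) / 2"
    have Uint: "integrable lborel ?U" and Ule: "(\<integral>w. ?U w \<partial>lborel) \<le> D * S"
    proof -
      show "integrable lborel ?U" by (rule weighted_plancherel(1)[OF u \<sigma>])
      have "(\<integral>w. ?U w \<partial>lborel) \<le> D * (\<integral>x. (u n x)\<^sup>2 \<partial>lborel)"
        unfolding D_def C_def by (rule weighted_plancherel(2)[OF u \<sigma>])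
      also have "(\<integral>x. (u n x)\<^sup>2 \<partial>lborel) \<le> S"
        unfolding S_def by (rule integral_mono[OF sq_integrableD(2)[OF u(2)] sq_integrableD(2)[OF g]])
          (simp add: u_def indicator_def)
      finally show "(\<integral>w. ?U w \<partial>lborel) \<le> D * S" using D by (simp add: mult_left_mono)
    qed
    have Vint: "integrable lborel ?V" and Vle: "(\<integral>w. ?V w \<partial>lborel) \<le> D * (\<integral>x. (h n x)\<^sup>2 \<partial>lborel)"
      unfolding D_def C_def by (rule weighted_plancherel[OF h(2,1) \<sigma>])+
    have gint: "integrable lborel (gauss \<sigma> :: 'a \<Rightarrow> real)" by (rule integrable_gauss[OF \<sigma>])
    have Rint: "integrable lborel ?R"
      using Uint Vint gint mint[of \<eta>] by (intro integrable_divide Bochner_Integration.integrable_add integrable_mult_right) auto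
    have "C * \<bar>I n\<bar> = cmod (of_real (C * I n))" using C unfolding norm_of_real by (simp add: abs_mult)
    also have "\<dots> = cmod (\<integral>w. gauss \<sigma> w *\<^sub>R (ft (u n) w * cis (- (a \<bullet> w))) \<partial>lborel)"
      unfolding gauss_pairing[OF u(1) \<sigma>] C_def I_def ..
    also have "\<dots> \<le> (\<integral>w. gauss \<sigma> w * cmod (ft (u n) w) \<partial>lborel)"
      by (rule order_trans[OF integral_norm_bound]) (simp add: norm_mult gauss_pos less_imp_le)
    also have "\<dots> \<le> (\<integral>w. ?R w \<partial>lborel)"
    proof (rule integral_mono[OF _ Rint])
      have pt: "gauss \<sigma> w * cmod (ft (u n) w) \<le> ?R w" for w
      proof -
        have "cmod (ft (u n) w) \<le> (t * (cmod (ft (u n) w))\<^sup>2 + indicator (A \<eta>) w / t + (s * (cmod (ft (h n) w))\<^sup>2 + 1 / s) / \<eta>) / 2"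
        proof (cases "w \<in> A \<eta>")
          case True
          have "0 \<le> (s * (cmod (ft (h n) w))\<^sup>2 + 1 / s) / \<eta>" using s \<eta> by simp
          moreover have "indicator (A \<eta>) w = (1::real)" using True by simp
          ultimately show ?thesis using abs_le_weighted[OF t, of "cmod (ft (u n) w)"] by simp
        next
          case False
          then have "\<eta> * cmod (ft (u n) w) \<le> cmod (ft (h n) w)"
            unfolding ft_h norm_mult A_def by (intro mult_right_mono) auto
          also have "\<dots> \<le> (s * (cmod (ft (h n) w))\<^sup>2 + 1 / s) / 2" by (rule abs_le_weighted[OF s])
          finally have "cmod (ft (u n) w) \<le> (s * (cmod (ft (h n) w))\<^sup>2 + 1 / s) / 2 / \<eta>"
            using \<eta> by (simp add: pos_le_divide_eq mult.commute)
          moreover have "0 \<le> t * (cmod (ft (u n) w))\<^sup>2 / 2" using t by simp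
          ultimately show ?thesis using False by (simp add: add_divide_distrib)
        qed
        from mult_left_mono[OF this less_imp_le[OF gauss_pos[of \<sigma> w]]]
        show ?thesis by (simp add: algebra_simps add_divide_distrib)
      qed
      then show "gauss \<sigma> w * cmod (ft (u n) w) \<le> ?R w" for w .
      show "integrable lborel (\<lambda>w. gauss \<sigma> w * cmod (ft (u n) w))"
      proof (rule Bochner_Integration.integrable_bound[OF Rint], goal_cases)
        case 2
        show ?case
        proof (rule AE_I2)
          fix w
          show "norm (gauss \<sigma> w * cmod (ft (u n) w)) \<le> norm (?R w)"
            using order_trans[OF pt abs_ge_self, of w] by (simp only: real_norm_def abs_mult abs_gauss abs_norm_cancel)
        qed
      qed measurable
    qed
    also have "\<dots> = (t * (\<integral>w. ?U w \<partial>lborel) + m \<eta> / t + (s * (\<integral>w. ?V w \<partial>lborel) + G / s) / \<eta>) / 2"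
      unfolding m_def G_def using Uint Vint gint mint[of \<eta>] by simp
    also have "\<dots> \<le> (t * (D * S) + m \<eta> / t + (s * (D * (\<integral>x. (h n x)\<^sup>2 \<partial>lborel)) + G / s) / \<eta>) / 2"
      using t s \<eta> Ule Vle by (intro divide_right_mono add_mono mult_left_mono) auto
    finally show ?thesis .
  qed
  have nz: "AE w in lborel. ft p w \<noteq> 0" by (rule AE_ft_nonzero[OF p _ pos]) (rule supp)
  have m_lim: "(\<lambda>n. m (1 / real (Suc n))) \<longlonglongrightarrow> 0"
  proof -
    have "(\<lambda>n. m (1 / real (Suc n))) \<longlonglongrightarrow> (\<integral>w. 0 \<partial>(lborel :: 'a measure))"
      unfolding m_def
    proof (rule integral_dominated_convergence[where w="gauss \<sigma>"])
      show "AE w in lborel. (\<lambda>n. gauss \<sigma> w * indicator (A (1 / real (Suc n))) w) \<longlonglongrightarrow> 0"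
        using nz
      proof eventually_elim
        case (elim w)
        have "eventually (\<lambda>n. 1 / real (Suc n) < cmod (ft p w)) sequentially"
          using order_tendstoD(2)[OF LIMSEQ_inverse_real_of_nat, of "cmod (ft p w)"] elim by (simp add: inverse_eq_divide)
        then have "eventually (\<lambda>n. gauss \<sigma> w * indicator (A (1 / real (Suc n))) w = 0) sequentially"
          by eventually_elim (simp add: A_def)
        then show ?case by (rule tendsto_eventually)
      qed
      show "AE w in lborel. norm (gauss \<sigma> w * indicator (A (1 / real (Suc n))) w) \<le> gauss \<sigma> w" for n
        by (intro AE_I2) (simp add: indicator_def gauss_pos less_imp_le)
    qed (use integrable_gauss[OF \<sigma>, where 'a='a] in auto)
    then show ?thesis by simp
  qed
  have I_lim: "I \<longlonglongrightarrow> (\<integral>x. g x * gauss (1 / \<sigma>) (x - a) \<partial>lborel)"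
    unfolding I_def[abs_def]
  proof (rule integral_dominated_convergence[where w="\<lambda>x. \<bar>g x * gauss (1 / \<sigma>) (x - a)\<bar>"])
    have gi: "integrable lborel (\<lambda>x. gauss (1 / \<sigma>) (x - a))"
      using integrable_lborel_shift(1)[OF integrable_gauss[of "1 / \<sigma>", where 'a='a], of a] \<sigma> by simp
    show "integrable lborel (\<lambda>x. \<bar>g x * gauss (1 / \<sigma>) (x - a)\<bar>)"
    proof (rule integrable_abs, rule integrable_mono_square[OF g gi])
      fix x
      have "\<bar>g x\<bar> * gauss (1 / \<sigma>) (x - a) \<le> (1 + (g x)\<^sup>2) * gauss (1 / \<sigma>) (x - a)"
        using abs_le_one_plus_square gauss_pos[of "1/\<sigma>" "x - a"] by (intro mult_right_mono) auto
      also have "\<dots> = gauss (1 / \<sigma>) (x - a) + (g x)\<^sup>2 * gauss (1 / \<sigma>) (x - a)" by (simp add: algebra_simps)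
      also have "(g x)\<^sup>2 * gauss (1 / \<sigma>) (x - a) \<le> (g x)\<^sup>2"
        using gauss_le_1[of "1/\<sigma>" "x - a"] by (intro mult_left_le) auto
      finally show "\<bar>g x * gauss (1 / \<sigma>) (x - a)\<bar> \<le> \<bar>gauss (1 / \<sigma>) (x - a)\<bar> + (g x)\<^sup>2"
        using gauss_pos[of "1/\<sigma>" "x - a"] by (simp add: abs_mult)
    qed measurable
    show "AE x in lborel. (\<lambda>n. u n x * gauss (1 / \<sigma>) (x - a)) \<longlonglongrightarrow> g x * gauss (1 / \<sigma>) (x - a)"
    proof (rule AE_I2)
      fix x :: 'a
      obtain N :: nat where N: "norm x \<le> real N" using real_arch_simple by blast
      have "eventually (\<lambda>n. u n x * gauss (1 / \<sigma>) (x - a) = g x * gauss (1 / \<sigma>) (x - a)) sequentially"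
        using eventually_ge_at_top[of N]
      proof eventually_elim
        case (elim n)
        then have "norm x \<le> real n" using N by (meson order_trans of_nat_le_iff)
        then show ?case by (simp add: u_def)
      qed
      then show "(\<lambda>n. u n x * gauss (1 / \<sigma>) (x - a)) \<longlonglongrightarrow> g x * gauss (1 / \<sigma>) (x - a)" by (rule tendsto_eventually)
    qed
    show "AE x in lborel. norm (u n x * gauss (1 / \<sigma>) (x - a)) \<le> \<bar>g x * gauss (1 / \<sigma>) (x - a)\<bar>" for n
      by (intro AE_I2) (simp add: u_def indicator_def)
  qed measurable
  have small: "C * \<bar>\<integral>x. g x * gauss (1 / \<sigma>) (x - a) \<partial>lborel\<bar> \<le> 3 * e" if e: "0 < e" for e
  proof -
    \<comment> \<open>Parameters are fixed in the order t, \<eta>, s, n: t makes t D S at most e,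
      then \<eta> makes m \<eta> / t at most e, s makes G / (s \<eta>) equal to e, and large n makes
      the term with h n less than e. The 1 in the denominator covers D S = 0.\<close>
    define t where "t = e / (D * S + 1)"
    have DS: "0 \<le> D * S" using D S by simp
    have t: "0 < t" unfolding t_def using e DS by (simp add: add_nonneg_pos)
    have tDS: "t * (D * S) \<le> e" unfolding t_def using e DS by (simp add: field_simps)
    have "eventually (\<lambda>n. m (1 / real (Suc n)) < e * t) sequentially"
      using order_tendstoD(2)[OF m_lim, of "e * t"] e t by simp
    then obtain j where j: "m (1 / real (Suc j)) < e * t" unfolding eventually_sequentially by blast
    define \<eta> where "\<eta> = 1 / real (Suc j)"
    have \<eta>: "0 < \<eta>" unfolding \<eta>_def by simp
    have m\<eta>: "m \<eta> / t \<le> e" using j t unfolding \<eta>_def by (simp add: pos_divide_le_eq)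
    define s where "s = G / (\<eta> * e)"
    have s: "0 < s" unfolding s_def using G \<eta> e by simp
    have Gs: "G / s / \<eta> = e" unfolding s_def using G \<eta> e by simp
    have hl: "(\<lambda>n. s * (D * (\<integral>x. (h n x)\<^sup>2 \<partial>lborel)) / \<eta>) \<longlonglongrightarrow> s * (D * 0) / \<eta>"
      using \<eta> by (intro tendsto_intros h(3)) auto
    have "(\<lambda>n. C * \<bar>I n\<bar>) \<longlonglongrightarrow> C * \<bar>\<integral>x. g x * gauss (1 / \<sigma>) (x - a) \<partial>lborel\<bar>"
      by (intro tendsto_intros I_lim)
    moreover have "eventually (\<lambda>n. C * \<bar>I n\<bar> \<le> 3 * e) sequentially"
      using order_tendstoD(2)[OF hl, of e] e
    proof (simp, elim eventually_mono)
      fix n assume n: "s * (D * (\<integral>x. (h n x)\<^sup>2 \<partial>lborel)) / \<eta> < e"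
      have "C * \<bar>I n\<bar> \<le> (t * (D * S) + m \<eta> / t + (s * (D * (\<integral>x. (h n x)\<^sup>2 \<partial>lborel)) / \<eta> + G / s / \<eta>)) / 2"
        using key[OF t s \<eta>, of n] by (simp add: add_divide_distrib)
      moreover have "X \<le> 3 * e" if "X \<le> (x + y + (z + v)) / 2" "x \<le> e" "y \<le> e" "z < e" "v = e" for X x y z v
        using that e by argo
      ultimately show "C * \<bar>I n\<bar> \<le> 3 * e" using n tDS m\<eta> Gs by blast
    qed
    ultimately show ?thesis by (rule tendsto_upperbound) simp
  qed
  have "C * \<bar>\<integral>x. g x * gauss (1 / \<sigma>) (x - a) \<partial>lborel\<bar> \<le> 0"
  proof (rule field_le_epsilon)
    fix e :: real assume "0 < e"
    then show "C * \<bar>\<integral>x. g x * gauss (1 / \<sigma>) (x - a) \<partial>lborel\<bar> \<le> 0 + e" using small[of "e / 3"] by simp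
  qed
  then show ?thesis using C by (simp add: mult_le_0_iff)
qed

lemma conv_injective:
  fixes p g :: "'a::euclidean_space \<Rightarrow> real"
  assumes "p \<in> borel_measurable borel" and "\<And>x. \<bar>p x\<bar> \<le> M" and "\<And>x. 1 \<le> norm x \<Longrightarrow> p x = 0"
    and "(\<integral>x. p x \<partial>lborel) \<noteq> 0"
    and g: "sq_integrable g" and "\<And>x. conv p g x = 0"
  shows "AE x in lborel. g x = 0"
proof (rule AE_zero_if_box_integrals_zero)
  have gz: "(\<integral>x. g x * gauss \<sigma> (x - a) \<partial>lborel) = 0" if "0 < \<sigma>" for \<sigma> a
    using gauss_pairing_zero[OF assms, of "1 / \<sigma>" a] that by simp
  fix c e
  show "(\<integral>x. indicator (cbox c e) x * g x \<partial>lborel) = 0"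
    by (rule box_integral_zero_if_gauss_zero[OF g gz])
  have [measurable]: "g \<in> borel_measurable borel" "cbox c e \<in> sets borel" using sq_integrableD(1)[OF g] by auto
  have "integrable lborel (indicator (cbox c e) :: 'a \<Rightarrow> real)"
    by (intro integrable_real_indicator emeasure_lborel_cbox_finite) auto
  from integrable_mono_square[OF g this, of "\<lambda>x. indicator (cbox c e) x * g x"]
  show "integrable lborel (\<lambda>x. indicator (cbox c e) x * g x)"
    using abs_le_one_plus_square by (auto simp: indicator_def)
qed (rule sq_integrableD(1)[OF g])

section \<open>The native space\<close>

text \<open>A nonzero integral means a nonzero Fourier transform at the origin, the starting point
  for injectivity; evenness turns the autoconvolution into an inner product of two
  translates.\<close>

locale convolution_root =
  fixes P :: "'a::euclidean_space \<Rightarrow> real" and M :: real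
  assumes measurable_root [measurable]: "P \<in> borel_measurable borel"
    and bounded_root: "\<And>x. \<bar>P x\<bar> \<le> M"
    and support_root: "\<And>x. 1 \<le> norm x \<Longrightarrow> P x = 0"
    and integral_root: "(\<integral>x. P x \<partial>lborel) \<noteq> 0"
    and even_root: "\<And>x. P (- x) = P x"
begin

lemma even_root_diff: "P (x - y) = P (y - x)"
  using even_root[of "y - x"] by simp

lemma sq_integrable_root: "sq_integrable P"
  by (rule sq_integrable_bounded_support[OF measurable_root bounded_root support_root])

lemma conv_integrable: "sq_integrable g \<Longrightarrow> integrable lborel (\<lambda>y. P (x - y) * g y)"
  by (rule integrable_mult_sq[OF sq_integrable_reflect(1)[OF sq_integrable_root]])

lemma conv_add: "sq_integrable g \<Longrightarrow> sq_integrable h \<Longrightarrow> conv P (\<lambda>x. g x + h x) = (\<lambda>x. conv P g x + conv P h x)"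
  unfolding conv_def using conv_integrable by (auto simp: distrib_left fun_eq_iff)

lemma conv_zero: "conv P (\<lambda>_. 0) = (\<lambda>_. 0)"
  unfolding conv_def by simp

lemma conv_scale: "conv P (\<lambda>x. c * g x) = (\<lambda>x. c * conv P g x)"
  unfolding conv_def by (simp add: mult.left_commute fun_eq_iff)

lemma conv_diff: "sq_integrable g \<Longrightarrow> sq_integrable h \<Longrightarrow> conv P (\<lambda>x. g x - h x) = (\<lambda>x. conv P g x - conv P h x)"
  unfolding conv_def using conv_integrable by (auto simp: right_diff_distrib fun_eq_iff)

lemma conv_cong_AE:
  assumes "sq_integrable g" "sq_integrable h" "AE x in lborel. g x = h x"
  shows "conv P g = conv P h"
proof
  fix x
  have [measurable]: "g \<in> borel_measurable borel" "h \<in> borel_measurable borel"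
    using assms(1,2) by (auto dest: sq_integrableD)
  show "conv P g x = conv P h x"
    unfolding conv_def by (rule integral_cong_AE) (use assms(3) in \<open>auto elim!: eventually_mono\<close>)
qed

lemma conv_inj:
  assumes "sq_integrable g" "sq_integrable h" "conv P g = conv P h"
  shows "AE x in lborel. g x = h x"
proof -
  have "AE x in lborel. g x - h x = 0"
    by (rule conv_injective[OF measurable_root bounded_root support_root integral_root sq_integrable_diff[OF assms(1,2)]])
      (simp_all add: conv_diff assms)
  then show ?thesis by simp
qed

definition space_root :: "('a \<Rightarrow> real) set" where
  "space_root = {conv P g | g. sq_integrable g}"

text \<open>\<open>sq_integrable\<close> speaks of functions, not classes, so by
  \<open>conv_inj\<close> a preimage is determined only up to null sets. The integral in
  \<open>ip_root\<close> does not depend on the choice.\<close>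

definition preimage_root :: "('a \<Rightarrow> real) \<Rightarrow> 'a \<Rightarrow> real" where
  "preimage_root f = (SOME g. sq_integrable g \<and> conv P g = f)"

definition ip_root :: "('a \<Rightarrow> real) \<Rightarrow> ('a \<Rightarrow> real) \<Rightarrow> real" where
  "ip_root f h = (\<integral>x. preimage_root f x * preimage_root h x \<partial>lborel)"

lemma preimage_root:
  assumes "sq_integrable g"
  shows "sq_integrable (preimage_root (conv P g))" "AE x in lborel. preimage_root (conv P g) x = g x"
proof -
  have *: "sq_integrable (preimage_root (conv P g)) \<and> conv P (preimage_root (conv P g)) = conv P g"
    unfolding preimage_root_def by (rule someI[of _ g]) (use assms in simp)
  then show "sq_integrable (preimage_root (conv P g))" by blast
  show "AE x in lborel. preimage_root (conv P g) x = g x" using * assms by (intro conv_inj) auto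
qed

lemma ip_root_conv:
  assumes "sq_integrable g" "sq_integrable h"
  shows "ip_root (conv P g) (conv P h) = (\<integral>x. g x * h x \<partial>lborel)"
  unfolding ip_root_def
proof (rule integral_cong_AE)
  have [measurable]: "g \<in> borel_measurable borel" "h \<in> borel_measurable borel"
    "preimage_root (conv P g) \<in> borel_measurable borel" "preimage_root (conv P h) \<in> borel_measurable borel"
    using assms preimage_root(1) by (auto dest: sq_integrableD)
  show "(\<lambda>x. preimage_root (conv P g) x * preimage_root (conv P h) x) \<in> borel_measurable lborel"
    "(\<lambda>x. g x * h x) \<in> borel_measurable lborel" by measurable
  show "AE x in lborel. preimage_root (conv P g) x * preimage_root (conv P h) x = g x * h x"
    using preimage_root(2)[OF assms(1)] preimage_root(2)[OF assms(2)] by eventually_elim simp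
qed

lemma ip_root_self: "sq_integrable g \<Longrightarrow> ip_root (conv P g) (conv P g) = (\<integral>x. (g x)\<^sup>2 \<partial>lborel)"
  by (simp add: ip_root_conv power2_eq_square)

lemma space_rootI: "sq_integrable g \<Longrightarrow> conv P g \<in> space_root"
  unfolding space_root_def by blast

lemma space_rootE:
  assumes "f \<in> space_root"
  obtains g where "sq_integrable g" "f = conv P g"
  using assms unfolding space_root_def by blast

text \<open>The structure of L2 is transported along g -> P * g. The kernel function at y is the
  image of P(y - .), so its inner product with P * u is the integral defining (P * u)(y);
  completeness is \<open>sq_integrable_complete\<close>.\<close>

lemma is_RKHS_root:
  assumes K: "\<And>x y. K x y = conv P (\<lambda>z. P (y - z)) x"
  shows "is_RKHS K space_root ip_root"
  unfolding is_RKHS_def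
proof (intro conjI ballI allI impI)
  have K': "(\<lambda>x. K x y) = conv P (\<lambda>z. P (y - z))" for y using K by auto
  show "(\<lambda>_. 0) \<in> space_root"
    using space_rootI[OF sq_integrable_zero] by (simp add: conv_zero)
  fix f g h assume "f \<in> space_root" "g \<in> space_root"
  then obtain u v where u: "sq_integrable u" "f = conv P u" and v: "sq_integrable v" "g = conv P v"
    by (auto elim!: space_rootE)
  show "(\<lambda>x. f x + g x) \<in> space_root"
    unfolding u(2) v(2) conv_add[OF u(1) v(1), symmetric] by (intro space_rootI sq_integrable_add u v)
  show "ip_root f g = ip_root g f"
    unfolding u(2) v(2) ip_root_conv[OF u(1) v(1)] ip_root_conv[OF v(1) u(1)] by (simp add: mult.commute)
  show "ip_root (\<lambda>x. f x + g x) h = ip_root f h + ip_root g h" if "h \<in> space_root"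
  proof -
    obtain w where w: "sq_integrable w" "h = conv P w" using \<open>h \<in> space_root\<close> by (auto elim!: space_rootE)
    show ?thesis
      unfolding u(2) v(2) w(2) conv_add[OF u(1) v(1), symmetric]
        ip_root_conv[OF sq_integrable_add[OF u(1) v(1)] w(1)] ip_root_conv[OF u(1) w(1)] ip_root_conv[OF v(1) w(1)]
      using integrable_mult_sq[OF u(1) w(1)] integrable_mult_sq[OF v(1) w(1)] by (simp add: distrib_right)
  qed
  show "ip_root (\<lambda>x. c * f x) g = c * ip_root f g" for c
    unfolding u(2) v(2) conv_scale[symmetric] ip_root_conv[OF sq_integrable_scale[OF u(1)] v(1)] ip_root_conv[OF u(1) v(1)]
    by (simp add: mult.assoc)
next
  fix c f assume "f \<in> space_root"
  then obtain u where u: "sq_integrable u" "f = conv P u" by (auto elim!: space_rootE)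
  show "(\<lambda>x. c * f x) \<in> space_root"
    unfolding u(2) conv_scale[symmetric] by (intro space_rootI sq_integrable_scale u)
next
  fix f assume "f \<in> space_root"
  then obtain u where u: "sq_integrable u" "f = conv P u" by (auto elim!: space_rootE)
  show "0 \<le> ip_root f f" unfolding u(2) ip_root_self[OF u(1)] by simp
  show "f = (\<lambda>_. 0)" if "ip_root f f = 0"
  proof -
    have "AE x in lborel. (u x)\<^sup>2 = 0"
      using that unfolding u(2) ip_root_self[OF u(1)]
      by (subst (asm) integral_nonneg_eq_0_iff_AE) (use sq_integrableD(2)[OF u(1)] in auto)
    then have "conv P u = conv P (\<lambda>_. 0)"
      by (intro conv_cong_AE u sq_integrable_zero) (auto elim!: eventually_mono)
    then show ?thesis unfolding u(2) by (simp add: conv_zero)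
  qed
next
  fix s :: "nat \<Rightarrow> 'a \<Rightarrow> real"
  assume s: "(\<forall>n. s n \<in> space_root) \<and> (\<forall>e>0. \<exists>N. \<forall>m\<ge>N. \<forall>n\<ge>N.
    sqrt (ip_root (\<lambda>x. s m x - s n x) (\<lambda>x. s m x - s n x)) < e)"
  then have "\<forall>n. \<exists>g. sq_integrable g \<and> s n = conv P g" by (auto elim!: space_rootE)
  then obtain g where g: "\<And>n. sq_integrable (g n)" "\<And>n. s n = conv P (g n)" by metis
  have ip_diff: "ip_root (\<lambda>x. conv P u x - conv P v x) (\<lambda>x. conv P u x - conv P v x) = (\<integral>x. (u x - v x)\<^sup>2 \<partial>lborel)"
    if "sq_integrable u" "sq_integrable v" for u v
    unfolding conv_diff[OF that, symmetric] by (rule ip_root_self[OF sq_integrable_diff[OF that]])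
  have C: "\<exists>N. \<forall>m\<ge>N. \<forall>n\<ge>N. (\<integral>x. (g m x - g n x)\<^sup>2 \<partial>lborel) < e" if "0 < e" for e
  proof -
    obtain N where "\<forall>m\<ge>N. \<forall>n\<ge>N. sqrt (ip_root (\<lambda>x. s m x - s n x) (\<lambda>x. s m x - s n x)) < sqrt e"
      using s \<open>0 < e\<close> real_sqrt_gt_zero by blast
    then show ?thesis unfolding g(2) ip_diff[OF g(1) g(1)] by (simp only: real_sqrt_less_iff) blast
  qed
  obtain h where h: "sq_integrable h" "(\<lambda>n. \<integral>x. (g n x - h x)\<^sup>2 \<partial>lborel) \<longlonglongrightarrow> 0"
    by (rule sq_integrable_complete[of g, OF g(1) C])
  show "\<exists>f\<in>space_root. (\<lambda>n. sqrt (ip_root (\<lambda>x. s n x - f x) (\<lambda>x. s n x - f x))) \<longlonglongrightarrow> 0"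
  proof (rule bexI[OF _ space_rootI[OF h(1)]])
    show "(\<lambda>n. sqrt (ip_root (\<lambda>x. s n x - conv P h x) (\<lambda>x. s n x - conv P h x))) \<longlonglongrightarrow> 0"
      unfolding g(2) ip_diff[OF g(1) h(1)] using tendsto_real_sqrt[OF h(2)] by simp
  qed
next
  fix y
  show "(\<lambda>x. K x y) \<in> space_root"
    unfolding K[abs_def] by (intro space_rootI sq_integrable_reflect sq_integrable_root)
next
  fix f y assume "f \<in> space_root"
  then obtain u where u: "sq_integrable u" "f = conv P u" by (auto elim!: space_rootE)
  have "ip_root f (\<lambda>x. K x y) = (\<integral>z. u z * P (y - z) \<partial>lborel)"
    unfolding u(2) K[abs_def] by (rule ip_root_conv[OF u(1) sq_integrable_reflect(1)[OF sq_integrable_root]])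
  also have "\<dots> = f y" unfolding u(2) conv_def by (simp add: mult.commute)
  finally show "ip_root f (\<lambda>x. K x y) = f y" .
qed

end

text \<open>The integral is nonzero because P is nonnegative and positive on the whole open unit
  ball, including the case l = k, where it is constant there.\<close>

lemma convolution_root_P_ker:
  assumes "k \<le> l" "0 \<le> l" "0 \<le> k"
  shows "convolution_root (P_ker l k :: 'a::euclidean_space \<Rightarrow> real) (Gamma (l + 1) / Gamma (l - k + 1) * (2 / pi) powr (k / 2))"
proof
  let ?c = "Gamma (l + 1) / Gamma (l - k + 1) * (2 / pi) powr (k / 2)"
  let ?P = "P_ker l k :: 'a \<Rightarrow> real"
  have "0 < Gamma (l + 1)" "0 < Gamma (l - k + 1)" using assms by (auto intro!: Gamma_real_pos)
  then have c: "0 < ?c" by simp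
  show m: "?P \<in> borel_measurable borel" unfolding P_ker_def by measurable
  show "\<bar>?P x\<bar> \<le> ?c" for x
  proof -
    have "pos_pow (1 - (norm x)\<^sup>2) (l - k) \<le> 1"
      using assms powr_mono2[of "l - k" "1 - (norm x)\<^sup>2" 1] by (auto simp: pos_pow_def)
    then have "?c * pos_pow (1 - (norm x)\<^sup>2) (l - k) \<le> ?c * 1" using c by (intro mult_left_mono) auto
    moreover have "0 \<le> ?c * pos_pow (1 - (norm x)\<^sup>2) (l - k)" by (rule mult_nonneg_nonneg[OF less_imp_le[OF c] pos_pow_nonneg])
    ultimately show ?thesis unfolding P_ker_def by linarith
  qed
  show supp: "?P x = 0" if "1 \<le> norm x" for x
  proof -
    have "1 \<le> (norm x)\<^sup>2" using that by (rule one_le_power)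
    then show ?thesis by (simp add: P_ker_def pos_pow_def)
  qed
  show "?P (- x) = ?P x" for x by (simp add: P_ker_def)
  show "(\<integral>x. ?P x \<partial>lborel) \<noteq> 0"
  proof
    assume zero: "(\<integral>x. ?P x \<partial>lborel) = 0"
    have nonneg: "0 \<le> ?P x" for x
      unfolding P_ker_def by (rule mult_nonneg_nonneg[OF less_imp_le[OF c] pos_pow_nonneg])
    have "integrable lborel ?P"
      by (rule integrable_bounded_support[OF m _ supp]) fact
    then have "AE x in lborel. ?P x = 0"
      using zero nonneg by (subst (asm) integral_nonneg_eq_0_iff_AE) auto
    moreover have "?P x \<noteq> 0" if "x \<in> ball 0 1" for x
    proof -
      have "(norm x)\<^sup>2 < 1" using that abs_square_less_1[of "norm x"] by simp
      then have "0 < pos_pow (1 - (norm x)\<^sup>2) (l - k)" by (simp add: pos_pow_def)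
      then show ?thesis unfolding P_ker_def using c by (metis mult_pos_pos less_irrefl)
    qed
    ultimately have "AE x in lborel. x \<notin> ball (0::'a) 1" by (auto elim!: eventually_mono)
    then have "ball (0::'a) 1 \<in> null_sets lborel" by (subst AE_iff_null_sets) auto
    then have "negligible (ball (0::'a) 1)"
      by (simp add: negligible_iff_null_sets null_sets_completionI)
    then show False using open_not_negligible[of "ball (0::'a) 1"] by simp
  qed
qed

text \<open>The bijective isometry is expressed for functions instead of classes: the range is all
  of \<open>H\<close>, squared norms agree, and equal images force equality almost everywhere. The
  existential clause keeps the claim about all \<open>H\<close> and \<open>ip\<close> from being
  vacuous.\<close>

theorem theorem4p2:
  fixes k l :: real
  assumes hk: "2 * k \<in> \<nat>"
    and hl: "0 \<le> l"
    and hkl: "k \<le> l"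
    and hdim: "real DIM('a::euclidean_space) = 2 * k + 1"
  shows "(\<exists>H ip. is_RKHS (\<lambda>x y::'a. wu l k (norm (x - y))) H ip) \<and>
    (\<forall>H ip. is_RKHS (\<lambda>x y::'a. wu l k (norm (x - y))) H ip \<longrightarrow>
       H = {conv (P_ker l k) g | g. sq_integrable g} \<and>
       (\<forall>g. sq_integrable g \<longrightarrow>
          ip (conv (P_ker l k) g) (conv (P_ker l k) g) = (\<integral>x. (g x)^2 \<partial>lborel)) \<and>
       (\<forall>g h :: 'a \<Rightarrow> real. sq_integrable g \<and> sq_integrable h \<and> conv (P_ker l k) g = conv (P_ker l k) h
          \<longrightarrow> (AE x in lborel. g x = h x)))"
proof -
  let ?P = "P_ker l k :: 'a \<Rightarrow> real"
  let ?K = "\<lambda>x y::'a. wu l k (norm (x - y))"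
  have k: "0 \<le> k" using hdim DIM_positive[where 'a='a] by linarith
  interpret convolution_root ?P "Gamma (l + 1) / Gamma (l - k + 1) * (2 / pi) powr (k / 2)"
    by (rule convolution_root_P_ker[OF hkl hl k])
  \<comment> \<open>Translate z by y in the autoconvolution at x - y, then use evenness.\<close>
  have K: "?K x y = conv ?P (\<lambda>z. ?P (y - z)) x" for x y
  proof -
    have "?K x y = (\<integral>z. ?P (x - y - z) * ?P z \<partial>lborel)"
      using wu_eq_autoconv[OF hk hl hkl hdim, of "x - y"] by (simp add: has_bochner_integral_iff)
    also have "\<dots> = (\<integral>z. ?P (x - y - z) * ?P z \<partial>distr lborel borel ((+) (- y)))"
      by (simp add: lborel_distr_plus)
    also have "\<dots> = (\<integral>z. ?P (x - y - (- y + z)) * ?P (- y + z) \<partial>lborel)"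
      by (rule integral_distr) measurable
    also have "\<dots> = conv ?P (\<lambda>z. ?P (y - z)) x"
      unfolding conv_def using even_root_diff[of _ y] by simp
    finally show ?thesis .
  qed
  have R: "is_RKHS ?K space_root ip_root" by (rule is_RKHS_root[OF K])
  show ?thesis
  proof (intro conjI allI impI)
    show "\<exists>H ip. is_RKHS ?K H ip" using R by blast
    fix H ip assume H: "is_RKHS ?K H ip"
    show "H = {conv ?P g | g. sq_integrable g}"
      using rkhs_unique(1)[OF R H] unfolding space_root_def .
    show "ip (conv ?P g) (conv ?P g) = (\<integral>x. (g x)\<^sup>2 \<partial>lborel)" if "sq_integrable g" for g
      using rkhs_unique(2)[OF R H space_rootI[OF that]] ip_root_self[OF that] by simp
  next
    fix g h :: "'a \<Rightarrow> real"
    assume "sq_integrable g \<and> sq_integrable h \<and> conv ?P g = conv ?P h"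
    then show "AE x in lborel. g x = h x" by (intro conv_inj) auto
  qed
qed

end
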